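(* Assume that: (1) for every $\delta>0$ there exists $k_0=k_0(\delta)>0$ such that $\alpha(n,m)\le\delta\,(n+m)(d(n)+d(m))$ whenever $n+m>k_0$, and $d(\cdot)$ is uniformly bounded; (2) $d(\cdot)$ is non-increasing, $\alpha(n,m)\le C_0(n+m)$ for a constant $C_0$, and there exist positive constants $r_1,r_2$ and nonnegative constants $b_2\le b_1$ such that $r_1n^{-b_1}\le d(n)\le r_2n^{-b_2}$ for all $n$. Let $f$ be a weak solution of the Smoluchowski system such that, for every $a\in\mathbb{N}$, $X_a(\cdot,0)\in L^1(\mathbb{R}^d)$ and $$\sum_n n^a\|f_n^0\|_{L^\infty(\mathbb{R}^d)}<\infty.$$ Then $X_a\in L^\infty(\mathbb{R}^d\times[0,T])\cap L^1(\mathbb{R}^d\times[0,T])$ for every $a\in\mathbb{N}$ and $T\in(0,\infty)$.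
   Context: The integer $d\ge 1$ (written without argument) is the spatial dimension; $\mathbb{N}=\{1,2,\dots\}$. The parameters are the diffusion rates $d(\cdot):\mathbb{N}\to[0,\infty)$ and the coagulation propensities $\alpha:\mathbb{N}^2\to[0,\infty)$, with $\alpha(n,m)=\alpha(m,n)$. The Smoluchowski system for $f=(f_n)_{n\in\mathbb{N}}$, $f_n:\mathbb{R}^d\times[0,\infty)\to[0,\infty)$, is $\partial_t f_n=d(n)\Delta f_n+Q_n(f)$, where $Q_n=Q_n^+-Q_n^-$, $Q_n^+(f)=\sum_{m=1}^{n-1}\alpha(m,n-m)f_mf_{n-m}$, $Q_n^-(f)=2f_n\sum_{m=1}^\infty\alpha(n,m)f_m$. A weak solution with initial data $f^0=(f^0_n)$ means: $Q_n^\pm(f)\in L^1(\mathbb{R}^d\times[0,T])$ for every $T\in[0,\infty)$ and $n\in\mathbb{N}$, and $f_n(\cdot,t)=S_t^{d(n)}f_n^0+\int_0^tS_{t-s}^{d(n)}Q_n(f)(\cdot,s)\,ds$, where $S_t^D$ is the semigroup of the equation $u_t=D\Delta u$. Moments: $X_a(x,t)=\sum_n n^af_n(x,t)$ (so $X_a(x,0)=\sum_n n^af_n^0(x)$). *)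

theory Defs
  imports "HOL-Probability.Essential_Supremum"
begin

text \<open>
  Conventions. The space \<open>\<real>\<^sup>d\<close> is an arbitrary Euclidean space \<open>'a\<close>, with \<open>d = DIM('a) \<ge> 1\<close>. The
  index set \<open>{1, 2, \<dots>}\<close> is represented by the positive elements of \<open>nat\<close>; values of the
  parameters and of the unknowns at index \<open>0\<close>, and at negative times, are never used.
  Infinite sums of nonnegative terms are taken in \<open>ennreal\<close>, so that a divergent sum is \<open>\<infinity>\<close>.
  Elements of Lebesgue spaces are represented by Borel functions.
\<close>

definition in_L1 :: "'b measure \<Rightarrow> ('b \<Rightarrow> ennreal) \<Rightarrow> bool" where
  "in_L1 M g \<longleftrightarrow> g \<in> borel_measurable M \<and> (\<integral>\<^sup>+ p. g p \<partial>M) < \<infinity>"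

definition in_Linf :: "'b measure \<Rightarrow> ('b \<Rightarrow> ennreal) \<Rightarrow> bool" where
  "in_Linf M g \<longleftrightarrow> g \<in> borel_measurable M \<and> esssup M g < \<infinity>"

definition Linf_norm :: "('a::euclidean_space \<Rightarrow> real) \<Rightarrow> ennreal" where
  "Linf_norm u = esssup lborel (\<lambda>x. ennreal \<bar>u x\<bar>)"

definition slab :: "real \<Rightarrow> ('a::euclidean_space \<times> real) measure" where
  "slab T = restrict_space lborel (UNIV \<times> {0..T})"

definition heat_kernel :: "real \<Rightarrow> 'a::euclidean_space \<Rightarrow> real" where
  "heat_kernel c z = (4 * pi * c) powr (- real DIM('a) / 2) * exp (- (norm z)\<^sup>2 / (4 * c))"

text \<open>
  The semigroup of \<open>u\<^sub>t = D \<Delta> u\<close>, for \<open>D \<ge> 0\<close> and \<open>t \<ge> 0\<close>: convolution with the Gaussian kernel at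
  \<open>D t\<close> if this is positive, and the identity otherwise.
\<close>

definition heat_semigroup ::
    "real \<Rightarrow> real \<Rightarrow> ('a::euclidean_space \<Rightarrow> real) \<Rightarrow> 'a \<Rightarrow> real" where
  "heat_semigroup D t u x =
     (if 0 < D * t then (LINT y|lborel. heat_kernel (D * t) (x - y) * u y) else u x)"

definition Q_plus ::
    "(nat \<Rightarrow> nat \<Rightarrow> real) \<Rightarrow> (nat \<Rightarrow> 'a \<Rightarrow> real \<Rightarrow> real) \<Rightarrow> nat \<Rightarrow> 'a \<Rightarrow> real \<Rightarrow> ennreal" where
  "Q_plus \<alpha> f n x t = ennreal (\<Sum>m = 1..<n. \<alpha> m (n - m) * f m x t * f (n - m) x t)"

definition Q_minus ::
    "(nat \<Rightarrow> nat \<Rightarrow> real) \<Rightarrow> (nat \<Rightarrow> 'a \<Rightarrow> real \<Rightarrow> real) \<Rightarrow> nat \<Rightarrow> 'a \<Rightarrow> real \<Rightarrow> ennreal" where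
  "Q_minus \<alpha> f n x t =
     2 * ennreal (f n x t) * (\<Sum>k. ennreal (\<alpha> n (Suc k) * f (Suc k) x t))"

text \<open>
  For a weak solution both terms below are finite almost everywhere, so the value of
  \<^const>\<open>enn2real\<close> at \<open>\<infinity>\<close> plays no role.
\<close>

definition Q_coag ::
    "(nat \<Rightarrow> nat \<Rightarrow> real) \<Rightarrow> (nat \<Rightarrow> 'a \<Rightarrow> real \<Rightarrow> real) \<Rightarrow> nat \<Rightarrow> 'a \<Rightarrow> real \<Rightarrow> real" where
  "Q_coag \<alpha> f n x t = enn2real (Q_plus \<alpha> f n x t) - enn2real (Q_minus \<alpha> f n x t)"

text \<open>
  The Duhamel identity is an identity between functions of \<open>x\<close> modulo null sets, at every time.
  The condition \<open>Q\<^sup>\<plusminus> \<in> L\<^sup>1\<close> makes its time integral absolutely convergent for almost every \<open>x\<close>.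
\<close>

definition weak_solution ::
    "(nat \<Rightarrow> real) \<Rightarrow> (nat \<Rightarrow> nat \<Rightarrow> real) \<Rightarrow> (nat \<Rightarrow> 'a::euclidean_space \<Rightarrow> real)
       \<Rightarrow> (nat \<Rightarrow> 'a \<Rightarrow> real \<Rightarrow> real) \<Rightarrow> bool" where
  "weak_solution d \<alpha> f0 f \<longleftrightarrow>
     (\<forall>n\<ge>1. f0 n \<in> borel_measurable borel \<and> (\<forall>x. 0 \<le> f0 n x)) \<and>
     (\<forall>n\<ge>1. set_borel_measurable borel (UNIV \<times> {0..}) (\<lambda>(x, t). f n x t) \<and>
        (\<forall>x. \<forall>t\<ge>0. 0 \<le> f n x t)) \<and>
     (\<forall>n\<ge>1. \<forall>T\<ge>0. in_L1 (slab T) (\<lambda>(x, t). Q_plus \<alpha> f n x t) \<and>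
        in_L1 (slab T) (\<lambda>(x, t). Q_minus \<alpha> f n x t)) \<and>
     (\<forall>n\<ge>1. \<forall>t\<ge>0. AE x in lborel.
        f n x t = heat_semigroup (d n) t (f0 n) x
          + (LINT s:{0..t}|lborel. heat_semigroup (d n) (t - s) (\<lambda>y. Q_coag \<alpha> f n y s) x))"

definition moment :: "nat \<Rightarrow> (nat \<Rightarrow> real) \<Rightarrow> ennreal" where
  "moment a c = (\<Sum>k. ennreal (real (Suc k) ^ a * c (Suc k)))"

end

theory Submission
  imports Defs "HOL-Probability.Distributions"
begin

text \<open>
  The argument works with test kernels that are monotone in the mass. Suppose that \<open>\<kappa> n\<close> is
  non-increasing in \<open>n\<close>. Merging masses \<open>n\<close> and \<open>m\<close> changes the weight \<open>n \<kappa> n + m \<kappa> m\<close> into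
  \<open>(n + m) \<kappa> (n + m)\<close>, which is no larger. Hence coagulation decreases \<open>\<Sum> n \<kappa> n f\<^sub>n\<close>, and such a sum
  is controlled by the initial data. Since \<open>d\<close> is non-increasing, two families of heat kernels have this
  property: the rescaled Gaussians \<open>d(n)\<^bsup>D/2\<^esup> p\<^bsub>d(n) \<tau>\<^esub>\<close>, where \<open>D\<close> is the dimension, and the
  truncated potentials \<open>\<integral>\<^sub>0\<^bsup>d(n) \<tau>\<^esup> p\<^sub>\<sigma> d\<sigma>\<close>. All of this can be tested directly
  on the Duhamel formula, so no regularity of the solution is needed. The formula is used in a form in
  which every term is nonnegative (loss on the left, gain on the right), so that integrals
  may be exchanged freely.

  There are four steps.

  \<^item> The rescaled Gaussians bound \<open>\<Sum> n d(n)\<^bsup>D/2\<^esup> f\<^sub>n\<close> pointwise (\<open>weighted_sum_le\<close>). As \<open>d(n)\<close> decays at most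
    polynomially, \<open>f\<^sub>n\<close> is bounded by a power of \<open>n\<close> (\<open>u_poly_bound\<close>).

  \<^item> The truncated potentials bound the potential \<open>\<Sum> m \<integral>\<^sub>0\<^bsup>(c + d(m)) (T - t)\<^esup> p\<^sub>\<sigma> * f\<^sub>m(t) d\<sigma>\<close> of
    the mass, uniformly in space and time (\<open>mass_potential_le\<close>).

  \<^item> For the integral bounds on the moments, the interaction of two particles of masses \<open>n\<close> and \<open>m\<close>
    is tested against \<open>\<integral>\<^sub>0\<^bsup>(d(n) + d(m)) (T - s)\<^esup> p\<^sub>\<sigma>(y - z) d\<sigma>\<close> (\<open>two_point_identity\<close>). The two heat
    flows produce \<open>(d(n) + d(m)) \<integral>\<integral> f\<^sub>n f\<^sub>m\<close>. With weights \<open>n\<^sup>a m\<close>, the coagulation of the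
    second particle has the good sign, and that of the first costs at most the bound on the potential
    times the excess \<open>\<alpha>(n,m) ((n + m)\<^sup>a - n\<^sup>a - m\<^sup>a) f\<^sub>n f\<^sub>m\<close>. By
    \<open>\<alpha>(n,m) \<le> \<delta> (n + m) (d(n) + d(m))\<close> for large masses, this cost is a small multiple of the
    quantity being estimated, plus finitely many terms. So the excess is integrable
    (\<open>interaction_bound\<close>), and therefore the \<open>a\<close>-th moment is bounded in \<open>L\<^sup>1\<close> (\<open>moment_L1_bound\<close>).

  \<^item> Now the integral of the gain term decays faster than any power of the mass, while its supremum
    grows at most polynomially. In the Duhamel formula, the times within \<open>\<epsilon> = n\<^bsup>-j\<^esup>\<close> of the present are
    estimated by the supremum and the earlier ones by the integral. This makes \<open>sup f\<^sub>n\<close> decay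
    faster than any power (\<open>u_decay\<close>), and the moments are bounded.
\<close>

section \<open>The heat kernel\<close>

text \<open>
  The value \<open>0\<close> at nonpositive \<open>c\<close> encodes causality: with \<open>c = d (t - s)\<close>, an integral over all
  times \<open>s\<close> only sees \<open>s < t\<close>.
\<close>

definition gauss :: "real \<Rightarrow> 'a::euclidean_space \<Rightarrow> ennreal" where
  "gauss c z = (if 0 < c then ennreal (heat_kernel c z) else 0)"

lemma heat_kernel_nonneg: "0 \<le> heat_kernel c z"
  by (simp add: heat_kernel_def)

lemma gauss_measurable[measurable (raw)]:
  assumes [measurable]: "f \<in> borel_measurable M" "g \<in> borel_measurable M"
  shows "(\<lambda>p. gauss (f p) (g p)) \<in> borel_measurable M"
  unfolding gauss_def heat_kernel_def by measurable

lemma gauss_nonpos[simp]: "c \<le> 0 \<Longrightarrow> gauss c z = 0"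
  by (simp add: gauss_def)

lemma gauss_sym: "gauss c (x - y) = gauss c (y - x)"
  by (simp add: gauss_def heat_kernel_def norm_minus_commute)

lemma gauss_eq_prod:
  fixes z :: "'a::euclidean_space"
  assumes c: "0 < c"
  shows "gauss c z = (\<Prod>b\<in>Basis. ennreal (normal_density 0 (sqrt (2 * c)) (z \<bullet> b)))"
proof -
  have "(\<Prod>b\<in>Basis. normal_density 0 (sqrt (2 * c)) (z \<bullet> b))
      = (\<Prod>b\<in>(Basis::'a set). 1 / sqrt (4 * pi * c)) * (\<Prod>b\<in>Basis. exp (- (z \<bullet> b)\<^sup>2 / (4 * c)))"
    using c by (subst prod.distrib[symmetric]) (simp add: normal_density_def ac_simps)
  also have "(\<Prod>b\<in>Basis. exp (- (z \<bullet> b)\<^sup>2 / (4 * c))) = exp (- (norm z)\<^sup>2 / (4 * c))"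
  proof -
    have "(norm z)\<^sup>2 = (\<Sum>b\<in>Basis. (z \<bullet> b)\<^sup>2)"
      unfolding power2_norm_eq_inner euclidean_inner[of z z] by (simp add: power2_eq_square)
    then show ?thesis by (simp add: exp_sum[symmetric] sum_divide_distrib sum_negf)
  qed
  also have "(\<Prod>b\<in>(Basis::'a set). 1 / sqrt (4 * pi * c)) = (4 * pi * c) powr (- real DIM('a) / 2)"
  proof -
    have "1 / sqrt (4 * pi * c) = (4 * pi * c) powr (- 1 / 2)"
      using c powr_half_sqrt[of "4 * pi * c"] powr_minus_divide[of "4 * pi * c" "1 / 2"] by simp
    then have "(1 / sqrt (4 * pi * c)) ^ DIM('a) = ((4 * pi * c) powr (- 1 / 2)) powr real DIM('a)"
      using c by (simp add: powr_realpow)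
    also have "\<dots> = (4 * pi * c) powr (- real DIM('a) / 2)"
      by (simp add: powr_powr)
    finally show ?thesis by simp
  qed
  finally show ?thesis
    using c by (simp add: gauss_def heat_kernel_def prod_ennreal)
qed

lemma nn_integral_normal_density:
  assumes "0 < \<sigma>"
  shows "(\<integral>\<^sup>+x. ennreal (normal_density 0 \<sigma> (x - q)) \<partial>lborel) = 1"
proof -
  have "(\<integral>\<^sup>+x. ennreal (normal_density 0 \<sigma> (x - q)) \<partial>lborel) = (\<integral>\<^sup>+x. ennreal (normal_density q \<sigma> x) \<partial>lborel)"
    by (simp add: normal_density_def)
  also have "\<dots> = 1"
    using assms integral_normal_density[of \<sigma> q] by (simp add: nn_integral_eq_integral)
  finally show ?thesis .
qed

lemma nn_integral_gauss:
  assumes "0 < c"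
  shows "(\<integral>\<^sup>+x. gauss c (x - y) \<partial>(lborel :: 'a::euclidean_space measure)) = 1"
  using assms
  by (simp add: gauss_eq_prod inner_diff_left nn_integral_normal_density
      nn_integral_lborel_prod[where f="\<lambda>b x. ennreal (normal_density 0 (sqrt (2 * c)) (x - y \<bullet> b))"])

lemma nn_integral_gauss': "0 < c \<Longrightarrow> (\<integral>\<^sup>+y. gauss c (x - y) \<partial>(lborel :: 'a::euclidean_space measure)) = 1"
  using nn_integral_gauss[of c x] by (simp add: gauss_sym[of c x])

lemma normal_density_convolution:
  assumes "0 < \<sigma>" "0 < \<tau>"
  shows "(\<integral>\<^sup>+y. ennreal (normal_density 0 \<sigma> (p - y)) * ennreal (normal_density 0 \<tau> (y - q)) \<partial>lborel)
    = ennreal (normal_density 0 (sqrt (\<sigma>\<^sup>2 + \<tau>\<^sup>2)) (p - q))"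
proof -
  have "(\<integral>\<^sup>+y. ennreal (normal_density 0 \<sigma> (p - y)) * ennreal (normal_density 0 \<tau> (y - q)) \<partial>lborel)
    = (\<integral>\<^sup>+y. ennreal (normal_density 0 \<sigma> ((p - q) - y)) * ennreal (normal_density 0 \<tau> y) \<partial>lborel)"
    by (subst nn_integral_real_affine[of _ 1 q]) (simp_all add: algebra_simps)
  also have "\<dots> = (\<integral>\<^sup>+y. ennreal (normal_density 0 \<sigma> ((p - q) - y) * normal_density 0 \<tau> y) \<partial>lborel)"
    by (simp add: ennreal_mult')
  also have "\<dots> = ennreal (normal_density 0 (sqrt (\<sigma>\<^sup>2 + \<tau>\<^sup>2)) (p - q))"
    using fun_cong[OF conv_normal_density_zero_mean[OF assms], of "p - q"] by simp
  finally show ?thesis .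
qed

lemma gauss_convolution:
  fixes x w :: "'a::euclidean_space"
  assumes "0 < a" "0 < b"
  shows "(\<integral>\<^sup>+y. gauss a (x - y) * gauss b (y - w) \<partial>lborel) = gauss (a + b) (x - w)"
proof -
  have "(\<integral>\<^sup>+y. gauss a (x - y) * gauss b (y - w) \<partial>lborel)
    = (\<integral>\<^sup>+y. (\<Prod>i\<in>Basis. ennreal (normal_density 0 (sqrt (2 * a)) (x \<bullet> i - y \<bullet> i))
         * ennreal (normal_density 0 (sqrt (2 * b)) (y \<bullet> i - w \<bullet> i))) \<partial>lborel)"
    using assms by (simp add: gauss_eq_prod inner_diff_left prod.distrib)
  also have "\<dots> = (\<Prod>i\<in>Basis. (\<integral>\<^sup>+y. ennreal (normal_density 0 (sqrt (2 * a)) (x \<bullet> i - y))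
         * ennreal (normal_density 0 (sqrt (2 * b)) (y - w \<bullet> i)) \<partial>lborel))"
    by (rule nn_integral_lborel_prod[where f="\<lambda>i y. ennreal (normal_density 0 (sqrt (2 * a)) (x \<bullet> i - y))
         * ennreal (normal_density 0 (sqrt (2 * b)) (y - w \<bullet> i))"]) simp_all
  also have "\<dots> = gauss (a + b) (x - w)"
    using assms by (simp add: gauss_eq_prod normal_density_convolution inner_diff_left distrib_left)
  finally show ?thesis .
qed

lemma gauss_le:
  fixes z :: "'a::euclidean_space"
  shows "gauss c z \<le> ennreal ((4 * pi * c) powr (- real DIM('a) / 2))"
proof (cases "0 < c")
  case True
  then have "exp (- (norm z)\<^sup>2 / (4 * c)) \<le> 1" by simp
  then show ?thesis using True unfolding gauss_def heat_kernel_def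
    by (auto intro!: ennreal_leI mult_left_le)
qed simp

text \<open>
  The factor \<open>a\<^bsup>D/2\<^esup>\<close> cancels the normalisation, so only the exponential, which increases with the
  diffusion rate, depends on \<open>a\<close>. This gives the first family of monotone test kernels.
\<close>

lemma gauss_weighted_mono:
  fixes z :: "'a::euclidean_space"
  assumes "0 < b" "b \<le> a"
  shows "ennreal (b powr (real DIM('a) / 2)) * gauss (b * \<tau>) z \<le> ennreal (a powr (real DIM('a) / 2)) * gauss (a * \<tau>) z"
proof (cases "0 < \<tau>")
  case True
  have a: "0 < a" using assms by simp
  have eq: "ennreal (c powr (real DIM('a) / 2)) * gauss (c * \<tau>) z
      = ennreal ((4 * pi * \<tau>) powr (- real DIM('a) / 2) * exp (- (norm z)\<^sup>2 / (4 * (c * \<tau>))))" if "0 < c" for c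
  proof -
    have "c powr (real DIM('a) / 2) * (4 * pi * (c * \<tau>)) powr (- real DIM('a) / 2) = (4 * pi * \<tau>) powr (- real DIM('a) / 2)"
      using that True by (simp add: powr_mult powr_minus field_simps)
    then show ?thesis
      using that True by (simp add: gauss_def heat_kernel_def ennreal_mult''[symmetric] mult.assoc[symmetric])
  qed
  have "- (norm z)\<^sup>2 / (4 * (b * \<tau>)) \<le> - (norm z)\<^sup>2 / (4 * (a * \<tau>))"
    using assms a True by (simp add: frac_le)
  then show ?thesis
    using assms a by (auto simp: eq intro!: ennreal_leI mult_left_mono)
next
  case False
  then show ?thesis using assms by (simp add: mult_nonneg_nonpos)
qed

section \<open>Heat flow and its potential\<close>

lemma nn_integral_swap:
  fixes f :: "'a::euclidean_space \<Rightarrow> 'b::euclidean_space \<Rightarrow> ennreal"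
  assumes "case_prod f \<in> borel_measurable (borel \<Otimes>\<^sub>M borel)"
  shows "(\<integral>\<^sup>+x. \<integral>\<^sup>+y. f x y \<partial>lborel \<partial>lborel) = (\<integral>\<^sup>+y. \<integral>\<^sup>+x. f x y \<partial>lborel \<partial>lborel)"
  using lborel_pair.Fubini'[of f] assms by (simp add: measurable_cong_sets[of "lborel \<Otimes>\<^sub>M lborel" "borel \<Otimes>\<^sub>M borel"])

definition heat :: "real \<Rightarrow> ('a::euclidean_space \<Rightarrow> ennreal) \<Rightarrow> 'a \<Rightarrow> ennreal" where
  "heat c \<phi> x = (\<integral>\<^sup>+y. gauss c (x - y) * \<phi> y \<partial>lborel)"

lemma heat_measurable[measurable (raw)]:
  assumes [measurable]: "c \<in> borel_measurable M" "g \<in> borel_measurable M"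
    "case_prod \<phi> \<in> borel_measurable (M \<Otimes>\<^sub>M borel)"
  shows "(\<lambda>p. heat (c p) (\<phi> p) (g p)) \<in> borel_measurable M"
  unfolding heat_def by measurable

lemma heat_nonpos[simp]: "c \<le> 0 \<Longrightarrow> heat c \<phi> x = 0"
  by (simp add: heat_def)

lemma heat_zero[simp]: "heat c (\<lambda>y. 0) x = 0"
  by (simp add: heat_def)

lemma heat_heat:
  assumes [measurable]: "\<phi> \<in> borel_measurable borel" and "0 < a" "0 < b"
  shows "heat a (heat b \<phi>) x = heat (a + b) \<phi> x"
proof -
  have "heat a (heat b \<phi>) x = (\<integral>\<^sup>+y. \<integral>\<^sup>+w. gauss a (x - y) * (gauss b (y - w) * \<phi> w) \<partial>lborel \<partial>lborel)"
    unfolding heat_def by (simp add: nn_integral_cmult)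
  also have "\<dots> = (\<integral>\<^sup>+w. \<integral>\<^sup>+y. gauss a (x - y) * (gauss b (y - w) * \<phi> w) \<partial>lborel \<partial>lborel)"
    by (rule nn_integral_swap) measurable
  also have "\<dots> = (\<integral>\<^sup>+w. gauss (a + b) (x - w) * \<phi> w \<partial>lborel)"
    using assms by (simp add: nn_integral_multc gauss_convolution mult.assoc[symmetric])
  finally show ?thesis by (simp add: heat_def)
qed

lemma nn_integral_heat:
  assumes [measurable]: "\<phi> \<in> borel_measurable borel" and "0 < c"
  shows "(\<integral>\<^sup>+x. heat c \<phi> x \<partial>lborel) = (\<integral>\<^sup>+y. \<phi> y \<partial>lborel)"
proof -
  have "(\<integral>\<^sup>+x. heat c \<phi> x \<partial>lborel) = (\<integral>\<^sup>+y. \<integral>\<^sup>+x. gauss c (x - y) * \<phi> y \<partial>lborel \<partial>lborel)"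
    unfolding heat_def by (rule nn_integral_swap) measurable
  then show ?thesis
    using assms by (simp add: nn_integral_multc nn_integral_gauss)
qed

lemma nn_integral_heat_mult:
  assumes [measurable]: "\<phi> \<in> borel_measurable borel" "\<psi> \<in> borel_measurable borel" and "0 < a" "0 < b"
  shows "(\<integral>\<^sup>+x. heat a \<phi> x * heat b \<psi> x \<partial>lborel) = (\<integral>\<^sup>+y. \<phi> y * heat (a + b) \<psi> y \<partial>lborel)"
proof -
  have "(\<integral>\<^sup>+x. heat a \<phi> x * heat b \<psi> x \<partial>lborel)
      = (\<integral>\<^sup>+x. \<integral>\<^sup>+y. \<phi> y * (gauss a (y - x) * heat b \<psi> x) \<partial>lborel \<partial>lborel)"
    unfolding heat_def[of a]
    by (subst nn_integral_multc[symmetric]) (simp_all add: gauss_sym[of a] ac_simps)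
  also have "\<dots> = (\<integral>\<^sup>+y. \<integral>\<^sup>+x. \<phi> y * (gauss a (y - x) * heat b \<psi> x) \<partial>lborel \<partial>lborel)"
    by (rule nn_integral_swap) measurable
  also have "\<dots> = (\<integral>\<^sup>+y. \<phi> y * heat a (heat b \<psi>) y \<partial>lborel)"
    unfolding heat_def[of a] by (simp add: nn_integral_cmult)
  finally show ?thesis
    using assms by (simp add: heat_heat)
qed

lemma heat_cong_AE:
  assumes "AE y in lborel. \<phi> y = \<psi> y"
  shows "heat c \<phi> x = heat c \<psi> x"
  unfolding heat_def by (rule nn_integral_cong_AE) (use assms in auto)

lemma heat_le_const:
  fixes \<phi> :: "'a::euclidean_space \<Rightarrow> ennreal"
  assumes "AE y in lborel. \<phi> y \<le> C"
  shows "heat c \<phi> x \<le> C"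
proof (cases "0 < c")
  case True
  have "heat c \<phi> x \<le> (\<integral>\<^sup>+y. gauss c (x - y) * C \<partial>lborel)"
    unfolding heat_def using assms by (intro nn_integral_mono_AE) (auto elim!: eventually_mono intro!: mult_left_mono)
  also have "\<dots> = C"
    using True by (simp add: nn_integral_multc nn_integral_gauss')
  finally show ?thesis .
qed simp

lemma heat_le_L1:
  fixes \<phi> :: "'a::euclidean_space \<Rightarrow> ennreal"
  assumes [measurable]: "\<phi> \<in> borel_measurable borel"
  shows "heat c \<phi> x \<le> ennreal ((4 * pi * c) powr (- real DIM('a) / 2)) * (\<integral>\<^sup>+y. \<phi> y \<partial>lborel)"
proof -
  have "heat c \<phi> x \<le> (\<integral>\<^sup>+y. ennreal ((4 * pi * c) powr (- real DIM('a) / 2)) * \<phi> y \<partial>lborel)"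
    unfolding heat_def by (intro nn_integral_mono mult_right_mono gauss_le) simp
  then show ?thesis by (simp add: nn_integral_cmult)
qed

lemma heat_add:
  assumes [measurable]: "\<phi> \<in> borel_measurable borel" "\<psi> \<in> borel_measurable borel"
  shows "heat c (\<lambda>y. \<phi> y + \<psi> y) x = heat c \<phi> x + heat c \<psi> x"
  unfolding heat_def by (simp add: distrib_left nn_integral_add)

lemma heat_nn_integral:
  fixes \<phi> :: "real \<Rightarrow> 'a::euclidean_space \<Rightarrow> ennreal"
  assumes [measurable]: "case_prod \<phi> \<in> borel_measurable (borel \<Otimes>\<^sub>M borel)"
  shows "heat c (\<lambda>y. \<integral>\<^sup>+s. \<phi> s y \<partial>lborel) x = (\<integral>\<^sup>+s. heat c (\<phi> s) x \<partial>lborel)"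
proof -
  have "heat c (\<lambda>y. \<integral>\<^sup>+s. \<phi> s y \<partial>lborel) x = (\<integral>\<^sup>+y. \<integral>\<^sup>+s. gauss c (x - y) * \<phi> s y \<partial>lborel \<partial>lborel)"
    unfolding heat_def by (simp add: nn_integral_cmult)
  also have "\<dots> = (\<integral>\<^sup>+s. \<integral>\<^sup>+y. gauss c (x - y) * \<phi> s y \<partial>lborel \<partial>lborel)"
    by (rule nn_integral_swap) measurable
  finally show ?thesis by (simp add: heat_def)
qed

text \<open>
  The factor \<open>heat \<sigma>\<close> vanishes for \<open>\<sigma> \<le> 0\<close>, so the integral runs over \<open>0 < \<sigma> < \<tau>\<close>. Its kernel
  increases with \<open>\<tau>\<close>; this is the second family of monotone test kernels.
\<close>

definition potential :: "real \<Rightarrow> ('a::euclidean_space \<Rightarrow> ennreal) \<Rightarrow> 'a \<Rightarrow> ennreal" where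
  "potential \<tau> \<phi> x = (\<integral>\<^sup>+\<sigma>. indicator {..<\<tau>} \<sigma> * heat \<sigma> \<phi> x \<partial>lborel)"

lemma potential_measurable[measurable (raw)]:
  assumes [measurable]: "c \<in> borel_measurable M" "g \<in> borel_measurable M"
    "case_prod \<phi> \<in> borel_measurable (M \<Otimes>\<^sub>M borel)"
  shows "(\<lambda>p. potential (c p) (\<phi> p) (g p)) \<in> borel_measurable M"
  unfolding potential_def indicator_def lessThan_iff by measurable

lemma potential_mono: "\<tau> \<le> \<tau>' \<Longrightarrow> potential \<tau> \<phi> x \<le> potential \<tau>' \<phi> x"
  unfolding potential_def by (intro nn_integral_mono mult_right_mono) (auto simp: indicator_def)

lemma potential_le_const:
  fixes \<phi> :: "'a::euclidean_space \<Rightarrow> ennreal"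
  assumes "AE y in lborel. \<phi> y \<le> C"
  shows "potential \<tau> \<phi> x \<le> ennreal \<tau> * C"
proof -
  have "potential \<tau> \<phi> x \<le> (\<integral>\<^sup>+\<sigma>. C * indicator {0<..<\<tau>} \<sigma> \<partial>lborel)"
    unfolding potential_def
  proof (intro nn_integral_mono)
    fix \<sigma> :: real
    show "indicator {..<\<tau>} \<sigma> * heat \<sigma> \<phi> x \<le> C * indicator {0<..<\<tau>} \<sigma>"
      using heat_le_const[OF assms, of \<sigma> x] by (cases "0 < \<sigma>") (auto simp: indicator_def)
  qed
  also have "\<dots> = ennreal \<tau> * C"
    by (cases "0 \<le> \<tau>") (simp_all add: nn_integral_cmult_indicator mult.commute ennreal_neg)
  finally show ?thesis .
qed

text \<open>
  The substitution \<open>\<sigma> = c (t - s)\<close> turns the time integral of a flow with diffusion rate \<open>c\<close>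
  into a potential; multiplication by \<open>c\<close> removes the rate from the kernel, so that only the
  upper limit depends on it.
\<close>

lemma potential_scale:
  assumes [measurable]: "\<phi> \<in> borel_measurable borel" and c: "0 < c"
  shows "ennreal c * (\<integral>\<^sup>+t. indicator {..<T} t * heat (c * (t - s)) \<phi> x \<partial>lborel) = potential (c * (T - s)) \<phi> x"
proof -
  have "potential (c * (T - s)) \<phi> x
      = ennreal c * (\<integral>\<^sup>+t. indicator {..<c * (T - s)} (- c * s + c * t) * heat (- c * s + c * t) \<phi> x \<partial>lborel)"
    unfolding potential_def using c by (subst nn_integral_real_affine[of _ c "- c * s"]) auto
  also have "(\<lambda>t. indicator {..<c * (T - s)} (- c * s + c * t) * heat (- c * s + c * t) \<phi> x)
      = (\<lambda>t. indicator {..<T} t * heat (c * (t - s)) \<phi> x)"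
    using c by (auto simp: indicator_def algebra_simps fun_eq_iff)
  finally show ?thesis by simp
qed

text \<open>
  Two independent diffusions with rates \<open>a\<close> and \<open>b\<close> have the relative position of a single diffusion
  with rate \<open>a + b\<close>. Evaluating both flows at the same point and integrating over space and time
  thus produces the potential.
\<close>

lemma nn_integral_heat_product:
  fixes q g :: "'a::euclidean_space \<times> real \<Rightarrow> ennreal"
  assumes [measurable]: "q \<in> borel_measurable (borel \<Otimes>\<^sub>M borel)" "g \<in> borel_measurable (borel \<Otimes>\<^sub>M borel)"
    and ab: "0 < a" "0 < b"
  shows "ennreal (a + b) * (\<integral>\<^sup>+t. indicator {..<T} t * (\<integral>\<^sup>+x. \<integral>\<^sup>+s.
        heat (a * (t - s)) (\<lambda>y. q (y, s)) x * heat (b * (t - s)) (\<lambda>y. g (y, s)) x \<partial>lborel \<partial>lborel) \<partial>lborel)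
    = (\<integral>\<^sup>+s. \<integral>\<^sup>+y. q (y, s) * potential ((a + b) * (T - s)) (\<lambda>z. g (z, s)) y \<partial>lborel \<partial>lborel)"
proof -
  let ?h = "\<lambda>t s x. heat (a * (t - s)) (\<lambda>y. q (y, s)) x * heat (b * (t - s)) (\<lambda>y. g (y, s)) x"
  let ?k = "\<lambda>t s y. ennreal (a + b) * (indicator {..<T} t * (q (y, s) * heat ((a + b) * (t - s)) (\<lambda>z. g (z, s)) y))"
  have 1: "(\<integral>\<^sup>+x. \<integral>\<^sup>+s. ?h t s x \<partial>lborel \<partial>lborel)
     = (\<integral>\<^sup>+s. \<integral>\<^sup>+y. q (y, s) * heat ((a + b) * (t - s)) (\<lambda>z. g (z, s)) y \<partial>lborel \<partial>lborel)" for t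
  proof -
    have "(\<integral>\<^sup>+x. \<integral>\<^sup>+s. ?h t s x \<partial>lborel \<partial>lborel)
     = (\<integral>\<^sup>+s. \<integral>\<^sup>+x. ?h t s x \<partial>lborel \<partial>lborel)"
      by (rule nn_integral_swap) measurable
    also have "\<dots> = (\<integral>\<^sup>+s. \<integral>\<^sup>+y. q (y, s) * heat ((a + b) * (t - s)) (\<lambda>z. g (z, s)) y \<partial>lborel \<partial>lborel)"
    proof (rule nn_integral_cong)
      fix s
      show "(\<integral>\<^sup>+x. ?h t s x \<partial>lborel)
        = (\<integral>\<^sup>+y. q (y, s) * heat ((a + b) * (t - s)) (\<lambda>z. g (z, s)) y \<partial>lborel)"
        using ab by (cases "s < t") (simp_all add: nn_integral_heat_mult distrib_right[symmetric] mult_nonneg_nonpos)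
    qed
    finally show ?thesis .
  qed
  have "ennreal (a + b) * (\<integral>\<^sup>+t. indicator {..<T} t *
      (\<integral>\<^sup>+s. \<integral>\<^sup>+y. q (y, s) * heat ((a + b) * (t - s)) (\<lambda>z. g (z, s)) y \<partial>lborel \<partial>lborel) \<partial>lborel)
    = (\<integral>\<^sup>+t. \<integral>\<^sup>+s. \<integral>\<^sup>+y. ?k t s y
       \<partial>lborel \<partial>lborel \<partial>lborel)"
    by (simp add: nn_integral_cmult)
  also have "\<dots> = (\<integral>\<^sup>+s. \<integral>\<^sup>+t. \<integral>\<^sup>+y. ?k t s y
       \<partial>lborel \<partial>lborel \<partial>lborel)"
    by (rule nn_integral_swap) measurable
  also have "\<dots> = (\<integral>\<^sup>+s. \<integral>\<^sup>+y. \<integral>\<^sup>+t. ?k t s y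
       \<partial>lborel \<partial>lborel \<partial>lborel)"
    by (intro nn_integral_cong nn_integral_swap) measurable
  also have "\<dots> = (\<integral>\<^sup>+s. \<integral>\<^sup>+y. q (y, s) * potential ((a + b) * (T - s)) (\<lambda>z. g (z, s)) y \<partial>lborel \<partial>lborel)"
  proof (intro nn_integral_cong)
    fix s y
    have "(\<integral>\<^sup>+t. ?k t s y \<partial>lborel)
      = (\<integral>\<^sup>+t. q (y, s) * (ennreal (a + b) * (indicator {..<T} t * heat ((a + b) * (t - s)) (\<lambda>z. g (z, s)) y)) \<partial>lborel)"
      by (simp add: ac_simps)
    also have "\<dots> = q (y, s) * (ennreal (a + b) * (\<integral>\<^sup>+t. indicator {..<T} t * heat ((a + b) * (t - s)) (\<lambda>z. g (z, s)) y \<partial>lborel))"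
      by (subst nn_integral_cmult, measurable, subst nn_integral_cmult, measurable)
    also have "\<dots> = q (y, s) * potential ((a + b) * (T - s)) (\<lambda>z. g (z, s)) y"
      using ab by (subst potential_scale) auto
    finally show "(\<integral>\<^sup>+t. ?k t s y \<partial>lborel)
      = q (y, s) * potential ((a + b) * (T - s)) (\<lambda>z. g (z, s)) y" .
  qed
  finally show ?thesis unfolding 1 .
qed

lemma potential_nonpos[simp]: "\<tau> \<le> 0 \<Longrightarrow> potential \<tau> \<phi> x = 0"
  unfolding potential_def by (auto simp: indicator_def intro!: nn_integral_zero')

lemma potential_shift:
  assumes [measurable]: "\<phi> \<in> borel_measurable borel" and e: "0 \<le> e" "0 \<le> \<tau>"
  shows "potential e \<phi> x + (\<integral>\<^sup>+\<sigma>. indicator {0<..<\<tau>} \<sigma> * heat (\<sigma> + e) \<phi> x \<partial>lborel) = potential (\<tau> + e) \<phi> x"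
proof -
  have "(\<integral>\<^sup>+\<sigma>. indicator {e<..<\<tau> + e} \<sigma> * heat \<sigma> \<phi> x \<partial>lborel)
      = (\<integral>\<^sup>+\<sigma>. indicator {e<..<\<tau> + e} (e + 1 * \<sigma>) * heat (e + 1 * \<sigma>) \<phi> x \<partial>lborel)"
    by (subst nn_integral_real_affine[of _ 1 e]) auto
  also have "\<dots> = (\<integral>\<^sup>+\<sigma>. indicator {0<..<\<tau>} \<sigma> * heat (\<sigma> + e) \<phi> x \<partial>lborel)"
    by (intro nn_integral_cong) (auto simp: indicator_def add.commute)
  finally have "potential e \<phi> x + (\<integral>\<^sup>+\<sigma>. indicator {0<..<\<tau>} \<sigma> * heat (\<sigma> + e) \<phi> x \<partial>lborel)
     = (\<integral>\<^sup>+\<sigma>. indicator {..<e} \<sigma> * heat \<sigma> \<phi> x + indicator {e<..<\<tau> + e} \<sigma> * heat \<sigma> \<phi> x \<partial>lborel)"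
    unfolding potential_def by (simp add: nn_integral_add)
  also have "\<dots> = potential (\<tau> + e) \<phi> x"
    unfolding potential_def
  proof (rule nn_integral_cong_AE)
    show "AE \<sigma> in lborel. indicator {..<e} \<sigma> * heat \<sigma> \<phi> x + indicator {e<..<\<tau> + e} \<sigma> * heat \<sigma> \<phi> x = indicator {..<\<tau> + e} \<sigma> * heat \<sigma> \<phi> x"
      using AE_lborel_singleton[of e] by eventually_elim (use e in \<open>auto simp: indicator_def\<close>)
  qed
  finally show ?thesis .
qed

lemma potential_pos_eq: "potential \<tau> \<phi> x = (\<integral>\<^sup>+\<sigma>. indicator {0<..<\<tau>} \<sigma> * heat \<sigma> \<phi> x \<partial>lborel)"
  unfolding potential_def by (intro nn_integral_cong) (auto simp: indicator_def)

lemma nn_integral_potential: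
  fixes \<phi> :: "'a::euclidean_space \<Rightarrow> ennreal"
  assumes [measurable]: "\<phi> \<in> borel_measurable borel"
  shows "(\<integral>\<^sup>+x. potential \<tau> \<phi> x \<partial>lborel) = ennreal \<tau> * (\<integral>\<^sup>+y. \<phi> y \<partial>lborel)"
proof -
  have "(\<integral>\<^sup>+x. potential \<tau> \<phi> x \<partial>lborel) = (\<integral>\<^sup>+\<sigma>. \<integral>\<^sup>+x. indicator {0<..<\<tau>} \<sigma> * heat \<sigma> \<phi> x \<partial>lborel \<partial>lborel)"
    unfolding potential_pos_eq by (rule nn_integral_swap) measurable
  also have "\<dots> = (\<integral>\<^sup>+\<sigma>. (\<integral>\<^sup>+y. \<phi> y \<partial>lborel) * indicator {0<..<\<tau>} \<sigma> \<partial>lborel)"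
    by (intro nn_integral_cong) (auto simp: nn_integral_cmult nn_integral_heat indicator_def)
  also have "\<dots> = ennreal \<tau> * (\<integral>\<^sup>+y. \<phi> y \<partial>lborel)"
    by (cases "0 \<le> \<tau>") (simp_all add: nn_integral_cmult_indicator mult.commute ennreal_neg)
  finally show ?thesis .
qed

section \<open>Duhamel terms\<close>

abbreviation integral_before :: "real \<Rightarrow> ('a::euclidean_space \<times> real \<Rightarrow> ennreal) \<Rightarrow> ennreal" where
  "integral_before T q \<equiv> \<integral>\<^sup>+s. indicator {..<T} s * (\<integral>\<^sup>+y. q (y, s) \<partial>lborel) \<partial>lborel"

definition duhamel :: "real \<Rightarrow> ('a::euclidean_space \<times> real \<Rightarrow> ennreal) \<Rightarrow> 'a \<Rightarrow> real \<Rightarrow> ennreal" where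
  "duhamel c q x t = (\<integral>\<^sup>+s. heat (c * (t - s)) (\<lambda>y. q (y, s)) x \<partial>lborel)"

lemma duhamel_measurable[measurable (raw)]:
  assumes [measurable]: "q \<in> borel_measurable (borel \<Otimes>\<^sub>M borel)" "f \<in> borel_measurable M" "g \<in> borel_measurable M"
  shows "(\<lambda>p. duhamel c q (f p) (g p)) \<in> borel_measurable M"
  unfolding duhamel_def by measurable

lemma nn_integral_duhamel:
  assumes [measurable]: "q \<in> borel_measurable (borel \<Otimes>\<^sub>M borel)" and c: "0 < c"
  shows "(\<integral>\<^sup>+x. duhamel c q x t \<partial>lborel) = integral_before t q"
proof -
  have "(\<integral>\<^sup>+x. duhamel c q x t \<partial>lborel) = (\<integral>\<^sup>+s. \<integral>\<^sup>+x. heat (c * (t - s)) (\<lambda>y. q (y, s)) x \<partial>lborel \<partial>lborel)"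
    unfolding duhamel_def by (rule nn_integral_swap) measurable
  also have "\<dots> = integral_before t q"
  proof (rule nn_integral_cong)
    fix s show "(\<integral>\<^sup>+x. heat (c * (t - s)) (\<lambda>y. q (y, s)) x \<partial>lborel) = indicator {..<t} s * (\<integral>\<^sup>+y. q (y, s) \<partial>lborel)"
      using c by (cases "s < t") (simp_all add: nn_integral_heat mult_nonneg_nonpos)
  qed
  finally show ?thesis .
qed

lemma AE_duhamel_finite:
  assumes [measurable]: "q \<in> borel_measurable (borel \<Otimes>\<^sub>M borel)" and c: "0 < c"
    and "integral_before t q < \<infinity>"
  shows "AE x in lborel. duhamel c q x t < \<infinity>"
proof -
  have "AE x in lborel. duhamel c q x t \<noteq> \<infinity>"
    using assms by (intro nn_integral_PInf_AE) (auto simp: nn_integral_duhamel)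
  then show ?thesis by eventually_elim (simp add: less_top)
qed

lemma sum_duhamel:
  fixes q :: "nat \<Rightarrow> 'a::euclidean_space \<times> real \<Rightarrow> ennreal"
  assumes [measurable]: "\<And>n. q n \<in> borel_measurable (borel \<Otimes>\<^sub>M borel)"
  shows "(\<Sum>n\<le>N. w n * duhamel (c n) (q n) x t)
    = (\<integral>\<^sup>+s. \<integral>\<^sup>+y. (\<Sum>n\<le>N. w n * gauss (c n * (t - s)) (x - y) * q n (y, s)) \<partial>lborel \<partial>lborel)"
  unfolding duhamel_def heat_def
  by (simp add: nn_integral_sum nn_integral_cmult mult.assoc)

lemma nn_integral_duhamel_time:
  fixes q :: "'a::euclidean_space \<times> real \<Rightarrow> ennreal"
  assumes [measurable]: "q \<in> borel_measurable (borel \<Otimes>\<^sub>M borel)" and c: "0 < c"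
  shows "ennreal c * (\<integral>\<^sup>+r. indicator {..<t} r * duhamel c q x r \<partial>lborel)
    = (\<integral>\<^sup>+s. potential (c * (t - s)) (\<lambda>y. q (y, s)) x \<partial>lborel)"
proof -
  have "ennreal c * (\<integral>\<^sup>+r. indicator {..<t} r * duhamel c q x r \<partial>lborel)
    = ennreal c * (\<integral>\<^sup>+r. \<integral>\<^sup>+s. indicator {..<t} r * heat (c * (r - s)) (\<lambda>y. q (y, s)) x \<partial>lborel \<partial>lborel)"
    unfolding duhamel_def by (simp add: nn_integral_cmult)
  also have "\<dots> = ennreal c * (\<integral>\<^sup>+s. \<integral>\<^sup>+r. indicator {..<t} r * heat (c * (r - s)) (\<lambda>y. q (y, s)) x \<partial>lborel \<partial>lborel)"
    by (subst nn_integral_swap) simp_all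
  also have "\<dots> = (\<integral>\<^sup>+s. ennreal c * (\<integral>\<^sup>+r. indicator {..<t} r * heat (c * (r - s)) (\<lambda>y. q (y, s)) x \<partial>lborel) \<partial>lborel)"
    by (simp add: nn_integral_cmult)
  also have "\<dots> = (\<integral>\<^sup>+s. potential (c * (t - s)) (\<lambda>y. q (y, s)) x \<partial>lborel)"
    using c by (intro nn_integral_cong potential_scale) auto
  finally show ?thesis .
qed

text \<open>
  Recent times are estimated by the supremum of the source, earlier ones by its integral and
  the supremum of the kernel.
\<close>

lemma duhamel_split:
  fixes q :: "'a::euclidean_space \<times> real \<Rightarrow> ennreal"
  assumes \<epsilon>: "0 < \<epsilon>" and c: "0 < c" and Q: "\<And>s. AE y in lborel. q (y, s) \<le> Q"
    and [measurable]: "q \<in> borel_measurable (borel \<Otimes>\<^sub>M borel)"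
  shows "duhamel c q x t \<le> ennreal \<epsilon> * Q + ennreal ((4 * pi * (c * \<epsilon>)) powr (- real DIM('a) / 2))
     * integral_before t q"
proof -
  let ?R = "ennreal ((4 * pi * (c * \<epsilon>)) powr (- real DIM('a) / 2))"
  have "duhamel c q x t \<le> (\<integral>\<^sup>+s. Q * indicator {t - \<epsilon><..t} s + ?R * (indicator {..<t} s * (\<integral>\<^sup>+y. q (y, s) \<partial>lborel)) \<partial>lborel)"
    unfolding duhamel_def
  proof (rule nn_integral_mono)
    fix s
    show "heat (c * (t - s)) (\<lambda>y. q (y, s)) x \<le> Q * indicator {t - \<epsilon><..t} s + ?R * (indicator {..<t} s * (\<integral>\<^sup>+y. q (y, s) \<partial>lborel))"
    proof (cases "t \<le> s")
      case True
      then show ?thesis using c by (simp add: mult_nonneg_nonpos)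
    next
      case False
      show ?thesis
      proof (cases "t - \<epsilon> < s")
        case True
        then show ?thesis using False heat_le_const[OF Q[of s]] by (simp add: add_increasing2)
      next
        case le: False
        have "heat (c * (t - s)) (\<lambda>y. q (y, s)) x \<le> ennreal ((4 * pi * (c * (t - s))) powr (- real DIM('a) / 2)) * (\<integral>\<^sup>+y. q (y, s) \<partial>lborel)"
          by (rule heat_le_L1) measurable
        also have "\<dots> \<le> ?R * (\<integral>\<^sup>+y. q (y, s) \<partial>lborel)"
          using le c \<epsilon> by (intro mult_right_mono ennreal_leI powr_mono2') auto
        finally show ?thesis using False le by simp
      qed
    qed
  qed
  also have "\<dots> = (\<integral>\<^sup>+s. Q * indicator {t - \<epsilon><..t} s \<partial>lborel)
      + (\<integral>\<^sup>+s. ?R * (indicator {..<t} s * (\<integral>\<^sup>+y. q (y, s) \<partial>lborel)) \<partial>lborel)"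
    by (rule nn_integral_add) measurable
  also have "(\<integral>\<^sup>+s. Q * indicator {t - \<epsilon><..t} s \<partial>lborel) = ennreal \<epsilon> * Q"
    using \<epsilon> by (subst nn_integral_cmult_indicator) (simp_all add: mult.commute)
  also have "(\<integral>\<^sup>+s. ?R * (indicator {..<t} s * (\<integral>\<^sup>+y. q (y, s) \<partial>lborel)) \<partial>lborel)
      = ?R * integral_before t q"
    by (rule nn_integral_cmult) measurable
  finally show ?thesis .
qed

section \<open>A product rule for indefinite integrals\<close>

text \<open>
  The functions \<open>a\<close> and \<open>b\<close> are absolutely continuous with derivatives \<open>qp - qm\<close> and \<open>rp - rm\<close>, and
  the conclusion is \<open>(a b)' = a' b + a b'\<close> in integrated form, with the negative terms moved to
  the other side. The reason is Tonelli's theorem: the square of integration splits into the two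
  triangles \<open>\<rho> < s\<close> and \<open>s < \<rho>\<close>.
\<close>

lemma product_rule:
  fixes qp qm rp rm a b :: "real \<Rightarrow> ennreal"
  assumes [measurable]: "qp \<in> borel_measurable borel" "qm \<in> borel_measurable borel"
      "rp \<in> borel_measurable borel" "rm \<in> borel_measurable borel"
      "a \<in> borel_measurable borel" "b \<in> borel_measurable borel"
    and fin: "(\<integral>\<^sup>+s. qp s \<partial>lborel) < \<infinity>" "(\<integral>\<^sup>+s. qm s \<partial>lborel) < \<infinity>"
      "(\<integral>\<^sup>+s. rp s \<partial>lborel) < \<infinity>" "(\<integral>\<^sup>+s. rm s \<partial>lborel) < \<infinity>" "A0 < \<infinity>" "B0 < \<infinity>"
    and supp: "\<And>s. s \<notin> {0<..<t} \<Longrightarrow> qp s = 0 \<and> qm s = 0 \<and> rp s = 0 \<and> rm s = 0"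
    and a: "\<And>s. 0 < s \<Longrightarrow> s < t \<Longrightarrow>
        a s + (\<integral>\<^sup>+r. indicator {..<s} r * qm r \<partial>lborel) = A0 + (\<integral>\<^sup>+r. indicator {..<s} r * qp r \<partial>lborel)"
    and b: "\<And>s. 0 < s \<Longrightarrow> s < t \<Longrightarrow>
        b s + (\<integral>\<^sup>+r. indicator {..<s} r * rm r \<partial>lborel) = B0 + (\<integral>\<^sup>+r. indicator {..<s} r * rp r \<partial>lborel)"
    and aT: "aT + (\<integral>\<^sup>+r. qm r \<partial>lborel) = A0 + (\<integral>\<^sup>+r. qp r \<partial>lborel)"
    and bT: "bT + (\<integral>\<^sup>+r. rm r \<partial>lborel) = B0 + (\<integral>\<^sup>+r. rp r \<partial>lborel)"
  shows "aT * bT + ((\<integral>\<^sup>+s. qm s * b s \<partial>lborel) + (\<integral>\<^sup>+s. rm s * a s \<partial>lborel))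
    = A0 * B0 + ((\<integral>\<^sup>+s. qp s * b s \<partial>lborel) + (\<integral>\<^sup>+s. rp s * a s \<partial>lborel))"
proof -
  define C where "C r s = (\<integral>\<^sup>+\<rho>. indicator {..<s} \<rho> * r \<rho> \<partial>lborel)" for r :: "real \<Rightarrow> ennreal" and s
  define J where "J q r = (\<integral>\<^sup>+s. q s * C r s \<partial>lborel)" for q r
  define I where "I q = (\<integral>\<^sup>+s. q s \<partial>lborel)" for q :: "real \<Rightarrow> ennreal"
  have C_meas[measurable]: "C r \<in> borel_measurable borel" if [measurable]: "r \<in> borel_measurable borel" for r
    unfolding C_def indicator_def lessThan_iff by measurable
  have tonelli: "J q r + J r q = I q * I r"
    if [measurable]: "q \<in> borel_measurable borel" "r \<in> borel_measurable borel" for q r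
  proof -
    have 1: "J q r = (\<integral>\<^sup>+s. \<integral>\<^sup>+\<rho>. q s * (indicator {..<s} \<rho> * r \<rho>) \<partial>lborel \<partial>lborel)"
      unfolding J_def C_def by (subst nn_integral_cmult) (simp_all add: indicator_def)
    have "J r q = (\<integral>\<^sup>+s. \<integral>\<^sup>+\<rho>. r s * (indicator {..<s} \<rho> * q \<rho>) \<partial>lborel \<partial>lborel)"
      unfolding J_def C_def by (subst nn_integral_cmult) (simp_all add: indicator_def)
    also have "\<dots> = (\<integral>\<^sup>+\<rho>. \<integral>\<^sup>+s. r s * (indicator {..<s} \<rho> * q \<rho>) \<partial>lborel \<partial>lborel)"
      by (rule nn_integral_swap) (simp add: indicator_def)
    finally have 2: "J r q = (\<integral>\<^sup>+s. \<integral>\<^sup>+\<rho>. q s * (indicator {s<..} \<rho> * r \<rho>) \<partial>lborel \<partial>lborel)"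
      by (simp add: indicator_def ac_simps)
    have "J q r + J r q = (\<integral>\<^sup>+s. \<integral>\<^sup>+\<rho>. q s * (indicator {..<s} \<rho> * r \<rho>) + q s * (indicator {s<..} \<rho> * r \<rho>) \<partial>lborel \<partial>lborel)"
      unfolding 1 2 indicator_def by (simp add: nn_integral_add)
    also have "\<dots> = (\<integral>\<^sup>+s. \<integral>\<^sup>+\<rho>. q s * r \<rho> \<partial>lborel \<partial>lborel)"
    proof (rule nn_integral_cong, rule nn_integral_cong_AE)
      fix s :: real
      show "AE \<rho> in lborel. q s * (indicator {..<s} \<rho> * r \<rho>) + q s * (indicator {s<..} \<rho> * r \<rho>) = q s * r \<rho>"
        using AE_lborel_singleton[of s] by eventually_elim (auto simp: indicator_def)
    qed
    also have "\<dots> = I q * I r"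
      by (simp add: I_def nn_integral_cmult nn_integral_multc)
    finally show ?thesis .
  qed
  have bal: "(\<integral>\<^sup>+s. q s * w s \<partial>lborel) + J q r' = I q * W0 + J q r"
    if [measurable]: "q \<in> borel_measurable borel" "r \<in> borel_measurable borel" "r' \<in> borel_measurable borel"
      "w \<in> borel_measurable borel" and q: "\<And>s. s \<notin> {0<..<t} \<Longrightarrow> q s = 0"
      and w: "\<And>s. 0 < s \<Longrightarrow> s < t \<Longrightarrow> w s + C r' s = W0 + C r s" for q r r' w W0
  proof -
    have "(\<integral>\<^sup>+s. q s * w s \<partial>lborel) + J q r' = (\<integral>\<^sup>+s. q s * (w s + C r' s) \<partial>lborel)"
      unfolding J_def by (simp add: nn_integral_add distrib_left)
    also have "\<dots> = (\<integral>\<^sup>+s. q s * (W0 + C r s) \<partial>lborel)"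
    proof (rule nn_integral_cong)
      fix s show "q s * (w s + C r' s) = q s * (W0 + C r s)"
        using q[of s] w[of s] by (cases "0 < s \<and> s < t") auto
    qed
    also have "\<dots> = I q * W0 + J q r"
      unfolding J_def I_def by (simp add: nn_integral_add distrib_left nn_integral_multc)
    finally show ?thesis .
  qed
  have a': "a s + C qm s = A0 + C qp s" and b': "b s + C rm s = B0 + C rp s" if "0 < s" "s < t" for s
    using a[OF that] b[OF that] by (simp_all add: C_def)
  have e: "(\<integral>\<^sup>+s. qm s * b s \<partial>lborel) + J qm rm = I qm * B0 + J qm rp"
    "(\<integral>\<^sup>+s. rm s * a s \<partial>lborel) + J rm qm = I rm * A0 + J rm qp"
    "(\<integral>\<^sup>+s. qp s * b s \<partial>lborel) + J qp rm = I qp * B0 + J qp rp"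
    "(\<integral>\<^sup>+s. rp s * a s \<partial>lborel) + J rp qm = I rp * A0 + J rp qp"
    using bal[of qm rp rm b B0] bal[of rm qp qm a A0] bal[of qp rp rm b B0] bal[of rp qp qm a A0] supp a' b' by auto
  have t: "J qm rm + J rm qm = I qm * I rm" "J qm rp + J rp qm = I qm * I rp"
    "J qp rm + J rm qp = I qp * I rm" "J qp rp + J rp qp = I qp * I rp"
    by (rule tonelli; measurable)+
  have fI: "I qp < \<infinity>" "I qm < \<infinity>" "I rp < \<infinity>" "I rm < \<infinity>"
    using fin by (auto simp: I_def)
  have finJ: "J q r < \<infinity>" "J r q < \<infinity>"
    if "J q r + J r q = I q * I r" "I q < \<infinity>" "I r < \<infinity>" for q r
  proof -
    have "J q r + J r q < \<infinity>" using that by (simp add: ennreal_mult_less_top)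
    then show "J q r < \<infinity>" "J r q < \<infinity>" by auto
  qed
  have fJ: "J qm rm < \<infinity>" "J rm qm < \<infinity>" "J qm rp < \<infinity>" "J rp qm < \<infinity>"
    "J qp rm < \<infinity>" "J rm qp < \<infinity>" "J qp rp < \<infinity>" "J rp qp < \<infinity>"
    using finJ t fI by auto
  have finL: "X < \<infinity>" if "X + Y = Z + W" "Z < \<infinity>" "W < \<infinity>" for X Y Z W :: ennreal
  proof -
    have "X + Y < \<infinity>" using that by simp
    then show ?thesis by auto
  qed
  have "I qm * B0 < \<infinity>" "I rm * A0 < \<infinity>" "I qp * B0 < \<infinity>" "I rp * A0 < \<infinity>"
    using fin fI by (simp_all add: ennreal_mult_less_top)
  then have fX: "(\<integral>\<^sup>+s. qm s * b s \<partial>lborel) < \<infinity>" "(\<integral>\<^sup>+s. rm s * a s \<partial>lborel) < \<infinity>"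
    "(\<integral>\<^sup>+s. qp s * b s \<partial>lborel) < \<infinity>" "(\<integral>\<^sup>+s. rp s * a s \<partial>lborel) < \<infinity>"
    using finL[OF e(1)] finL[OF e(2)] finL[OF e(3)] finL[OF e(4)] fJ by auto
  have fT: "aT < \<infinity>" "bT < \<infinity>"
    using finL[OF aT] finL[OF bT] fin by auto
  have toR: "\<exists>r\<ge>0. X = ennreal r" if "X < \<infinity>" for X
    using that by (cases X) auto
  obtain x1 x2 x3 x4 where x: "x1 \<ge> 0" "x2 \<ge> 0" "x3 \<ge> 0" "x4 \<ge> 0"
    "(\<integral>\<^sup>+s. qm s * b s \<partial>lborel) = ennreal x1" "(\<integral>\<^sup>+s. rm s * a s \<partial>lborel) = ennreal x2"
    "(\<integral>\<^sup>+s. qp s * b s \<partial>lborel) = ennreal x3" "(\<integral>\<^sup>+s. rp s * a s \<partial>lborel) = ennreal x4"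
    using toR[OF fX(1)] toR[OF fX(2)] toR[OF fX(3)] toR[OF fX(4)] by blast
  obtain i1 i2 i3 i4 where i: "i1 \<ge> 0" "i2 \<ge> 0" "i3 \<ge> 0" "i4 \<ge> 0"
    "I qp = ennreal i1" "I qm = ennreal i2" "I rp = ennreal i3" "I rm = ennreal i4"
    using toR[OF fI(1)] toR[OF fI(2)] toR[OF fI(3)] toR[OF fI(4)] by blast
  obtain j1 j2 j3 j4 where j: "j1 \<ge> 0" "j2 \<ge> 0" "j3 \<ge> 0" "j4 \<ge> 0"
    "J qm rm = ennreal j1" "J rm qm = ennreal j2" "J qm rp = ennreal j3" "J rp qm = ennreal j4"
    using toR[OF fJ(1)] toR[OF fJ(2)] toR[OF fJ(3)] toR[OF fJ(4)] by blast
  obtain k1 k2 k3 k4 where k: "k1 \<ge> 0" "k2 \<ge> 0" "k3 \<ge> 0" "k4 \<ge> 0"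
    "J qp rm = ennreal k1" "J rm qp = ennreal k2" "J qp rp = ennreal k3" "J rp qp = ennreal k4"
    using toR[OF fJ(5)] toR[OF fJ(6)] toR[OF fJ(7)] toR[OF fJ(8)] by blast
  obtain a0 b0 av bv where z: "a0 \<ge> 0" "b0 \<ge> 0" "av \<ge> 0" "bv \<ge> 0"
    "A0 = ennreal a0" "B0 = ennreal b0" "aT = ennreal av" "bT = ennreal bv"
    using toR[OF fin(5)] toR[OF fin(6)] toR[OF fT(1)] toR[OF fT(2)] by blast
  have conv: "w + y = u * v + z"
    if "ennreal w + ennreal y = ennreal u * ennreal v + ennreal z" "0 \<le> w" "0 \<le> y" "0 \<le> u" "0 \<le> v" "0 \<le> z"
    for w y u v z
  proof -
    have "ennreal (w + y) = ennreal (u * v + z)" using that by (simp add: ennreal_plus ennreal_mult)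
    then show ?thesis using that by (subst (asm) ennreal_inj) auto
  qed
  have conv2: "w + y = u * v"
    if "ennreal w + ennreal y = ennreal u * ennreal v" "0 \<le> w" "0 \<le> y" "0 \<le> u" "0 \<le> v" for w y u v
    using conv[of w y u v 0] that by simp
  have conv1: "w + y = u + v"
    if "ennreal w + ennreal y = ennreal u + ennreal v" "0 \<le> w" "0 \<le> y" "0 \<le> u" "0 \<le> v" for w y u v
    using conv[of w y u 1 v] that by simp
  note e' = e[unfolded x(5-8) i(5-8) j(5-8) k(5-8) z(5-8)] and t' = t[unfolded i(5-8) j(5-8) k(5-8)]
  note pos = x(1-4) i(1-4) j(1-4) k(1-4) z(1-4)
  have r11: "x1 + j1 = i2 * b0 + j3"
    by (rule conv[OF e'(1)] pos)+
  have r12: "x2 + j2 = i4 * a0 + k2"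
    by (rule conv[OF e'(2)] pos)+
  have r13: "x3 + k1 = i1 * b0 + k3"
    by (rule conv[OF e'(3)] pos)+
  have r14: "x4 + j4 = i3 * a0 + k4"
    by (rule conv[OF e'(4)] pos)+
  have r21: "j1 + j2 = i2 * i4"
    by (rule conv2[OF t'(1)] pos)+
  have r22: "j3 + j4 = i2 * i3"
    by (rule conv2[OF t'(2)] pos)+
  have r23: "k1 + k2 = i1 * i4"
    by (rule conv2[OF t'(3)] pos)+
  have r24: "k3 + k4 = i1 * i3"
    by (rule conv2[OF t'(4)] pos)+
  have r31: "av + i2 = a0 + i1"
    by (rule conv1[OF aT[folded I_def, unfolded z(5-8) i(5-8)]] pos)+
  have r32: "bv + i4 = b0 + i3"
    by (rule conv1[OF bT[folded I_def, unfolded z(5-8) i(5-8)]] pos)+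
  have "av * bv + (x1 + x2) = a0 * b0 + (x3 + x4)"
  proof -
    have s: "av = a0 + i1 - i2" "bv = b0 + i3 - i4" "x1 = i2 * b0 + j3 - j1" "x2 = i4 * a0 + k2 - j2"
      "x3 = i1 * b0 + k3 - k1" "x4 = i3 * a0 + k4 - j4" using r11 r12 r13 r14 r31 r32 by simp_all
    have s2: "j1 = i2 * i4 - j2" "j3 = i2 * i3 - j4" "k1 = i1 * i4 - k2" "k3 = i1 * i3 - k4"
      using r21 r22 r23 r24 by simp_all
    show ?thesis unfolding s s2 by (simp add: algebra_simps)
  qed
  then have "ennreal (av * bv + (x1 + x2)) = ennreal (a0 * b0 + (x3 + x4))" by simp
  then show ?thesis
    unfolding x z using x(1-4) z(1-4) by (simp add: ennreal_plus ennreal_mult)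
qed

section \<open>Coagulation systems in nonnegative form\<close>

definition gain :: "(nat \<Rightarrow> nat \<Rightarrow> real) \<Rightarrow> (nat \<Rightarrow> 'p \<Rightarrow> ennreal) \<Rightarrow> nat \<Rightarrow> 'p \<Rightarrow> ennreal" where
  "gain al u n p = (\<Sum>m\<le>n. ennreal (al m (n - m)) * u m p * u (n - m) p)"

definition loss :: "(nat \<Rightarrow> nat \<Rightarrow> real) \<Rightarrow> (nat \<Rightarrow> 'p \<Rightarrow> ennreal) \<Rightarrow> nat \<Rightarrow> 'p \<Rightarrow> ennreal" where
  "loss al u n p = 2 * u n p * (\<Sum>k. ennreal (al n k) * u k p)"

lemma gain_measurable[measurable]:
  assumes [measurable]: "\<And>n. u n \<in> borel_measurable M"
  shows "gain al u n \<in> borel_measurable M"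
  unfolding gain_def[abs_def] by measurable

lemma loss_measurable[measurable]:
  assumes [measurable]: "\<And>n. u n \<in> borel_measurable M"
  shows "loss al u n \<in> borel_measurable M"
  unfolding loss_def[abs_def] by measurable

text \<open>
  The gain term is a sum over pairs with \<open>n + m \<le> N\<close>, whereas the truncated loss term contains all pairs
  with \<open>n, m \<le> N\<close>. Truncation therefore only helps, and what remains is the comparison of
  \<open>g (n + m)\<close> with \<open>g n + g m\<close> for each pair.
\<close>

lemma coag_gain_le_loss:
  fixes v g :: "nat \<Rightarrow> ennreal" and A e :: "nat \<Rightarrow> nat \<Rightarrow> ennreal"
  assumes sym: "\<And>n m. A n m = A m n"
    and sub: "\<And>n m. g (n + m) \<le> g n + g m + e n m"
  shows "(\<Sum>n\<le>N. g n * (\<Sum>m\<le>n. A m (n - m) * v m * v (n - m)))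
    \<le> (\<Sum>n\<le>N. g n * (2 * v n * (\<Sum>k. A n k * v k))) + (\<Sum>n\<le>N. \<Sum>m\<le>N. A n m * v n * v m * e n m)"
proof -
  let ?B = "\<lambda>n m. A n m * v n * v m"
  have "(\<Sum>n\<le>N. g n * (\<Sum>m\<le>n. ?B m (n - m))) = (\<Sum>n\<le>N. \<Sum>m\<le>n. (\<lambda>m l. g (m + l) * ?B m l) m (n - m))"
    by (simp add: sum_distrib_left)
  also have "\<dots> = (\<Sum>(m, l)\<in>{(i, j). i + j \<le> N}. g (m + l) * ?B m l)"
    by (rule sum.triangle_reindex_eq[symmetric])
  also have "\<dots> \<le> (\<Sum>(m, l)\<in>{..N} \<times> {..N}. g (m + l) * ?B m l)"
    by (rule sum_mono2) auto
  also have "\<dots> \<le> (\<Sum>(m, l)\<in>{..N} \<times> {..N}. (g m + g l + e m l) * ?B m l)"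
    by (intro sum_mono) (auto intro!: mult_right_mono sub)
  also have "\<dots> = (\<Sum>m\<le>N. \<Sum>l\<le>N. (g m + g l + e m l) * ?B m l)"
    by (rule sum.cartesian_product[symmetric])
  also have "\<dots> = (\<Sum>m\<le>N. \<Sum>l\<le>N. g m * ?B m l) + (\<Sum>m\<le>N. \<Sum>l\<le>N. g l * ?B m l) + (\<Sum>m\<le>N. \<Sum>l\<le>N. ?B m l * e m l)"
    by (simp add: distrib_right sum.distrib mult.commute)
  also have "(\<Sum>m\<le>N. \<Sum>l\<le>N. g l * ?B m l) = (\<Sum>m\<le>N. \<Sum>l\<le>N. g m * ?B m l)"
    by (subst sum.swap) (simp add: sym[of _ "_::nat"] ac_simps)
  also have "(\<Sum>m\<le>N. \<Sum>l\<le>N. g m * ?B m l) + (\<Sum>m\<le>N. \<Sum>l\<le>N. g m * ?B m l)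
      = (\<Sum>n\<le>N. g n * (2 * v n * (\<Sum>k\<le>N. A n k * v k)))"
    unfolding mult_2[symmetric] sum_distrib_left by (simp add: ac_simps)
  also have "\<dots> \<le> (\<Sum>n\<le>N. g n * (2 * v n * (\<Sum>k. A n k * v k)))"
    by (intro sum_mono mult_left_mono sum_le_suminf) auto
  finally show ?thesis by (simp add: add_mono)
qed

lemma ennreal_cancel_le:
  fixes X Y G L :: ennreal
  assumes "X + L = Y + G" "G \<le> L" "L < \<infinity>"
  shows "X \<le> Y"
proof -
  have "L + X \<le> L + Y" using assms by (metis add.commute add_left_mono)
  then show ?thesis using assms by (auto simp: ennreal_add_left_cancel_le)
qed

text \<open>
  The data of a weak solution, with the unphysical index \<open>0\<close> and the nonpositive times set to zero.
  The Duhamel identity has its loss term on the left, so that no difference occurs. It is an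
  identity of extended nonnegative functions, and Tonelli's theorem applies to every term.
\<close>

locale coagulation =
  fixes d :: "nat \<Rightarrow> real" and al :: "nat \<Rightarrow> nat \<Rightarrow> real"
    and u :: "nat \<Rightarrow> 'a::euclidean_space \<times> real \<Rightarrow> ennreal" and h :: "nat \<Rightarrow> 'a \<Rightarrow> ennreal"
    and H :: "nat \<Rightarrow> ennreal"
  assumes d_pos: "0 < d n"
    and d_anti: "n \<le> m \<Longrightarrow> d m \<le> d n"
    and d_low: "\<exists>C\<ge>1. \<exists>b::nat. \<forall>n. 1 \<le> d n * (C * real (Suc n) ^ b)"
    and al_nonneg: "0 \<le> al n m"
    and al_sym: "al n m = al m n"
    and al_lin: "\<exists>C\<ge>0. \<forall>n m. al n m \<le> C * real (n + m)"
    and al_small: "0 < \<delta> \<Longrightarrow> \<exists>k::nat. \<forall>n m. n + m > k \<longrightarrow> al n m \<le> \<delta> * real (n + m) * (d n + d m)"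
    and u_meas[measurable]: "u n \<in> borel_measurable (borel \<Otimes>\<^sub>M borel)"
    and h_meas[measurable]: "h n \<in> borel_measurable borel"
    and u_fin: "u n p < \<infinity>"
    and u_0: "u 0 p = 0"
    and u_nonpos: "t \<le> 0 \<Longrightarrow> u n (x, t) = 0"
    and h_L1: "(\<Sum>n. ennreal (real n ^ a) * (\<integral>\<^sup>+x. h n x \<partial>lborel)) < \<infinity>"
    and h_le: "AE x in lborel. h n x \<le> H n"
    and H_sum: "(\<Sum>n. ennreal (real n ^ a) * H n) < \<infinity>"
    and gain_L1: "integral_before T (gain al u n) < \<infinity>"
    and loss_L1: "integral_before T (loss al u n) < \<infinity>"
    and mild: "0 < t \<Longrightarrow> AE x in lborel.
      u n (x, t) + duhamel (d n) (loss al u n) x t = heat (d n * t) (h n) x + duhamel (d n) (gain al u n) x t"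
begin

abbreviation "G \<equiv> gain al u"
abbreviation "L \<equiv> loss al u"

lemma G_meas[measurable]: "G n \<in> borel_measurable (borel \<Otimes>\<^sub>M borel)"
  and L_meas[measurable]: "L n \<in> borel_measurable (borel \<Otimes>\<^sub>M borel)"
  by measurable

lemma G_nonpos: "t \<le> 0 \<Longrightarrow> G n (x, t) = 0" and L_nonpos: "t \<le> 0 \<Longrightarrow> L n (x, t) = 0"
  by (simp_all add: gain_def loss_def u_nonpos)

lemma h_fin: "(\<integral>\<^sup>+x. h n x \<partial>lborel) < \<infinity>"
proof -
  have "ennreal (real n ^ 0) * (\<integral>\<^sup>+x. h n x \<partial>lborel) \<le> (\<Sum>n. ennreal (real n ^ 0) * (\<integral>\<^sup>+x. h n x \<partial>lborel))"
    using sum_le_suminf[of "\<lambda>n. ennreal (real n ^ 0) * (\<integral>\<^sup>+x. h n x \<partial>lborel)" "{n}"] by simp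
  then show ?thesis using h_L1[of 0] by simp
qed

lemma gain_le_loss:
  assumes "\<And>n m. g (n + m) \<le> g n + g m + e n m"
  shows "(\<Sum>n\<le>N. g n * G n p) \<le> (\<Sum>n\<le>N. g n * L n p)
    + (\<Sum>n\<le>N. \<Sum>m\<le>N. ennreal (al n m) * u n p * u m p * e n m)"
  unfolding gain_def loss_def
  by (rule coag_gain_le_loss[where A="\<lambda>n m. ennreal (al n m)" and v="\<lambda>n. u n p", OF _ assms]) (simp add: al_sym)

lemma gain_le_loss_anti:
  assumes \<kappa>: "\<And>n m. n \<le> m \<Longrightarrow> \<kappa> m \<le> \<kappa> n"
  shows "(\<Sum>n\<le>N. ennreal (real n) * \<kappa> n * G n p) \<le> (\<Sum>n\<le>N. ennreal (real n) * \<kappa> n * L n p)"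
proof -
  have "(\<Sum>n\<le>N. ennreal (real n) * \<kappa> n * G n p) \<le> (\<Sum>n\<le>N. ennreal (real n) * \<kappa> n * L n p)
    + (\<Sum>n\<le>N. \<Sum>m\<le>N. ennreal (al n m) * u n p * u m p * 0)"
  proof (rule gain_le_loss)
    fix n m
    have "ennreal (real (n + m)) * \<kappa> (n + m) = ennreal (real n) * \<kappa> (n + m) + ennreal (real m) * \<kappa> (n + m)"
      by (simp add: distrib_right)
    also have "\<dots> \<le> ennreal (real n) * \<kappa> n + ennreal (real m) * \<kappa> m"
      by (intro add_mono mult_left_mono \<kappa>) auto
    finally show "ennreal (real (n + m)) * \<kappa> (n + m) \<le> ennreal (real n) * \<kappa> n + ennreal (real m) * \<kappa> m + 0"
      by simp
  qed
  then show ?thesis by simp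
qed

section \<open>A polynomial supremum bound\<close>

text \<open>
  Multiplied by \<open>n d(n)\<^bsup>D/2\<^esup>\<close>, the Duhamel terms have the kernels \<open>n d(n)\<^bsup>D/2\<^esup> p\<^bsub>d(n) (t - s)\<^esub>\<close>, so in the sum
  the gain is at most the loss, which is finite almost everywhere and cancels.
\<close>

lemma weighted_sum_le:
  assumes t: "0 < t"
  shows "AE x in lborel. (\<Sum>n\<le>N. ennreal (real n * d n powr (real DIM('a) / 2)) * u n (x, t))
    \<le> (\<Sum>n\<le>N. ennreal (real n * d n powr (real DIM('a) / 2)) * H n)"
proof -
  let ?w = "\<lambda>n. ennreal (real n * d n powr (real DIM('a) / 2))"
  have 1: "AE x in lborel. \<forall>n. u n (x, t) + duhamel (d n) (L n) x t = heat (d n * t) (h n) x + duhamel (d n) (G n) x t"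
    unfolding AE_all_countable using mild[OF t] by blast
  have 2: "AE x in lborel. \<forall>n. duhamel (d n) (L n) x t < \<infinity>"
    unfolding AE_all_countable using AE_duhamel_finite[OF L_meas d_pos loss_L1] by blast
  from 1 2 show ?thesis
  proof eventually_elim
    case (elim x)
    have "(\<Sum>n\<le>N. ?w n * u n (x, t)) + (\<Sum>n\<le>N. ?w n * duhamel (d n) (L n) x t)
      = (\<Sum>n\<le>N. ?w n * heat (d n * t) (h n) x) + (\<Sum>n\<le>N. ?w n * duhamel (d n) (G n) x t)"
      unfolding sum.distrib[symmetric] distrib_left[symmetric] using elim(1) by simp
    moreover have "(\<Sum>n\<le>N. ?w n * duhamel (d n) (G n) x t) \<le> (\<Sum>n\<le>N. ?w n * duhamel (d n) (L n) x t)"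
      unfolding sum_duhamel[OF G_meas] sum_duhamel[OF L_meas]
    proof (intro nn_integral_mono)
      fix s y
      have "(\<Sum>n\<le>N. ennreal (real n) * (ennreal (d n powr (real DIM('a) / 2)) * gauss (d n * (t - s)) (x - y)) * G n (y, s))
        \<le> (\<Sum>n\<le>N. ennreal (real n) * (ennreal (d n powr (real DIM('a) / 2)) * gauss (d n * (t - s)) (x - y)) * L n (y, s))"
        by (intro gain_le_loss_anti gauss_weighted_mono d_pos d_anti)
      then show "(\<Sum>n\<le>N. ?w n * gauss (d n * (t - s)) (x - y) * G n (y, s))
        \<le> (\<Sum>n\<le>N. ?w n * gauss (d n * (t - s)) (x - y) * L n (y, s))"
        by (simp add: ennreal_mult mult.assoc)
    qed
    moreover have "(\<Sum>n\<le>N. ?w n * duhamel (d n) (L n) x t) < \<infinity>"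
      using elim(2) by (simp add: ennreal_mult_less_top)
    ultimately have "(\<Sum>n\<le>N. ?w n * u n (x, t)) \<le> (\<Sum>n\<le>N. ?w n * heat (d n * t) (h n) x)"
      by (rule ennreal_cancel_le)
    also have "\<dots> \<le> (\<Sum>n\<le>N. ?w n * H n)"
      by (intro sum_mono mult_left_mono heat_le_const h_le) simp
    finally show ?case .
  qed
qed

lemma u_poly_bound:
  obtains U b where "0 \<le> U" "\<And>n t. AE x in lborel. u n (x, t) \<le> ennreal (U * real (Suc n) ^ b)"
proof -
  obtain C b0 where C: "1 \<le> C" and Cb: "\<And>n. 1 \<le> d n * (C * real (Suc n) ^ b0)"
    using d_low by blast
  let ?D = "real DIM('a) / 2"
  define S where "S = ennreal (d 0 powr ?D) * (\<Sum>n. ennreal (real n ^ 1) * H n)"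
  have "S < \<infinity>"
    unfolding S_def using H_sum[of 1] by (simp add: ennreal_mult_less_top)
  then obtain M where M: "0 \<le> M" "S = ennreal M" by (cases S) auto
  have bound: "ennreal (real n * d n powr ?D) * u n (x, t) \<le> ennreal M"
    if "(\<Sum>k\<le>n. ennreal (real k * d k powr ?D) * u k (x, t)) \<le> (\<Sum>k\<le>n. ennreal (real k * d k powr ?D) * H k)" for n x t
  proof -
    have "ennreal (real n * d n powr ?D) * u n (x, t) \<le> (\<Sum>k\<le>n. ennreal (real k * d k powr ?D) * u k (x, t))"
      by (rule member_le_sum) auto
    also note that
    also have "(\<Sum>k\<le>n. ennreal (real k * d k powr ?D) * H k) \<le> (\<Sum>k\<le>n. ennreal (d 0 powr ?D) * (ennreal (real k ^ 1) * H k))"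
    proof (rule sum_mono)
      fix k
      have "d k powr ?D \<le> d 0 powr ?D"
        using d_pos[of k] d_anti[of 0 k] by (intro powr_mono2) auto
      then have "ennreal (real k * d k powr ?D) \<le> ennreal (d 0 powr ?D * real k)"
        by (intro ennreal_leI) (simp add: mult_left_mono mult.commute)
      then have "ennreal (real k * d k powr ?D) \<le> ennreal (d 0 powr ?D) * ennreal (real k ^ 1)"
        by (simp add: ennreal_mult)
      then have "ennreal (real k * d k powr ?D) * H k \<le> (ennreal (d 0 powr ?D) * ennreal (real k ^ 1)) * H k"
        by (rule mult_right_mono) simp
      then show "ennreal (real k * d k powr ?D) * H k \<le> ennreal (d 0 powr ?D) * (ennreal (real k ^ 1) * H k)"
        by (simp add: mult.assoc)
    qed
    also have "\<dots> \<le> S"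
      unfolding S_def sum_distrib_left[symmetric] by (intro mult_left_mono sum_le_suminf) auto
    finally show ?thesis using M by simp
  qed
  have "AE x in lborel. u n (x, t) \<le> ennreal ((M * C ^ DIM('a)) * real (Suc n) ^ (b0 * DIM('a)))" for n t
  proof (cases "0 < t \<and> 0 < n")
    case False
    then show ?thesis by (auto simp: u_nonpos u_0)
  next
    case True
    have "AE x in lborel. ennreal (real n * d n powr ?D) * u n (x, t) \<le> ennreal M"
      using weighted_sum_le[of t n] True bound by auto
    then show ?thesis
    proof eventually_elim
      case (elim x)
      obtain r where r: "0 \<le> r" "u n (x, t) = ennreal r"
        using u_fin[of n "(x, t)"] by (cases "u n (x, t)") auto
      have "real n * d n powr ?D * r \<le> M"
        using elim r M by (simp add: ennreal_mult''[symmetric])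
      moreover have "1 * d n powr ?D * r \<le> real n * d n powr ?D * r"
        using True r by (intro mult_right_mono) auto
      ultimately have rM: "d n powr ?D * r \<le> M" by simp
      let ?X = "C * real (Suc n) ^ b0"
      have X1: "1 \<le> ?X"
        using C mult_mono[of 1 C 1 "real (Suc n) ^ b0"] by simp
      have "1 \<le> (d n * ?X) powr ?D"
        using Cb[of n] by (intro ge_one_powr_ge_zero) auto
      also have "\<dots> = d n powr ?D * ?X powr ?D"
        using d_pos[of n] X1 by (subst powr_mult) auto
      also have "\<dots> \<le> d n powr ?D * ?X ^ DIM('a)"
      proof (intro mult_left_mono)
        have "?X powr ?D \<le> ?X powr real DIM('a)"
          using X1 by (intro powr_mono) auto
        then show "?X powr ?D \<le> ?X ^ DIM('a)" using X1 by (simp add: powr_realpow)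
      qed simp
      finally have "1 * r \<le> (d n powr ?D * ?X ^ DIM('a)) * r"
        using r by (intro mult_right_mono) auto
      also have "\<dots> = (d n powr ?D * r) * ?X ^ DIM('a)" by simp
      also have "\<dots> \<le> M * ?X ^ DIM('a)"
        using rM X1 by (intro mult_right_mono) auto
      also have "\<dots> = (M * C ^ DIM('a)) * real (Suc n) ^ (b0 * DIM('a))"
        by (simp add: power_mult_distrib power_mult)
      finally show ?case using r by (simp add: ennreal_leI)
    qed
  qed
  moreover have "0 \<le> M * C ^ DIM('a)" using M C by simp
  ultimately show ?thesis using that by blast
qed

section \<open>The two-point identity\<close>

text \<open>
  After smoothing by \<open>heat \<sigma>\<close>, the identity holds at every point, because the exceptional null set
  is integrated out.
\<close>

lemma mild_heat:
  assumes \<sigma>: "0 < \<sigma>" and t: "0 < t"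
  shows "heat \<sigma> (\<lambda>y. u n (y, t)) x + (\<integral>\<^sup>+s. indicator {..<t} s * heat (\<sigma> + d n * (t - s)) (\<lambda>y. L n (y, s)) x \<partial>lborel)
    = heat (\<sigma> + d n * t) (h n) x + (\<integral>\<^sup>+s. indicator {..<t} s * heat (\<sigma> + d n * (t - s)) (\<lambda>y. G n (y, s)) x \<partial>lborel)"
proof -
  have D: "heat \<sigma> (\<lambda>y. duhamel (d n) q y t) x = (\<integral>\<^sup>+s. indicator {..<t} s * heat (\<sigma> + d n * (t - s)) (\<lambda>y. q (y, s)) x \<partial>lborel)"
    if [measurable]: "q \<in> borel_measurable (borel \<Otimes>\<^sub>M borel)" for q
  proof -
    have hc0: "heat c (\<lambda>y. q (y, s)) = (\<lambda>x. 0)" if "c \<le> 0" for c s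
      using that by (simp add: fun_eq_iff)
    have "heat \<sigma> (\<lambda>y. duhamel (d n) q y t) x = (\<integral>\<^sup>+s. heat \<sigma> (heat (d n * (t - s)) (\<lambda>y. q (y, s))) x \<partial>lborel)"
      unfolding duhamel_def by (rule heat_nn_integral) measurable
    also have "\<dots> = (\<integral>\<^sup>+s. indicator {..<t} s * heat (\<sigma> + d n * (t - s)) (\<lambda>y. q (y, s)) x \<partial>lborel)"
    proof (rule nn_integral_cong)
      fix s show "heat \<sigma> (heat (d n * (t - s)) (\<lambda>y. q (y, s))) x = indicator {..<t} s * heat (\<sigma> + d n * (t - s)) (\<lambda>y. q (y, s)) x"
        using \<sigma> d_pos[of n] by (cases "s < t") (simp_all add: heat_heat hc0 mult_nonneg_nonpos)
    qed
    finally show ?thesis .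
  qed
  have "heat \<sigma> (\<lambda>y. u n (y, t) + duhamel (d n) (L n) y t) x = heat \<sigma> (\<lambda>y. heat (d n * t) (h n) y + duhamel (d n) (G n) y t) x"
    by (rule heat_cong_AE) (use mild[OF t] in auto)
  then show ?thesis
    using \<sigma> t d_pos[of n] by (simp add: heat_add D heat_heat)
qed

lemma duhamel_loss_finite: "AE x in lborel. duhamel (d n) (L n) x t < \<infinity>"
  by (rule AE_duhamel_finite[OF L_meas d_pos loss_L1])

lemma duhamel_gain_finite: "AE x in lborel. duhamel (d n) (G n) x t < \<infinity>"
  by (rule AE_duhamel_finite[OF G_meas d_pos gain_L1])

text \<open>
  For fixed \<open>(x, t)\<close>, free diffusion does not change \<open>heat (d n * (t - s)) (u n (\<cdot>, s)) x\<close> as a function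
  of \<open>s\<close>, so its derivative is the coagulation term alone. The product rule is applied to this
  function and its counterpart for \<open>m\<close>.
\<close>

lemma two_point_pointwise:
  assumes t: "0 < t"
  shows "AE x in lborel. u n (x, t) * u m (x, t) +
      ((\<integral>\<^sup>+s. heat (d n * (t - s)) (\<lambda>y. L n (y, s)) x * heat (d m * (t - s)) (\<lambda>y. u m (y, s)) x \<partial>lborel)
      + (\<integral>\<^sup>+s. heat (d m * (t - s)) (\<lambda>y. L m (y, s)) x * heat (d n * (t - s)) (\<lambda>y. u n (y, s)) x \<partial>lborel))
    = heat (d n * t) (h n) x * heat (d m * t) (h m) x +
      ((\<integral>\<^sup>+s. heat (d n * (t - s)) (\<lambda>y. G n (y, s)) x * heat (d m * (t - s)) (\<lambda>y. u m (y, s)) x \<partial>lborel)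
      + (\<integral>\<^sup>+s. heat (d m * (t - s)) (\<lambda>y. G m (y, s)) x * heat (d n * (t - s)) (\<lambda>y. u n (y, s)) x \<partial>lborel))"
proof -
  have init: "heat (d n * t) (h n) x < \<infinity>" for n x
    using heat_le_L1[of "h n" "d n * t" x] h_fin[of n]
    by (auto simp: ennreal_mult_less_top intro: le_less_trans)
  have run: "heat (d n * (t - s)) (\<lambda>y. u n (y, s)) x
      + (\<integral>\<^sup>+r. indicator {..<s} r * heat (d n * (t - r)) (\<lambda>y. L n (y, r)) x \<partial>lborel)
    = heat (d n * t) (h n) x + (\<integral>\<^sup>+r. indicator {..<s} r * heat (d n * (t - r)) (\<lambda>y. G n (y, r)) x \<partial>lborel)"
    if "0 < s" "s < t" for n s x
  proof -
    have "d n * (t - s) + d n * (s - r) = d n * (t - r)" "d n * (t - s) + d n * s = d n * t" for r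
      by (simp_all add: algebra_simps)
    then show ?thesis
      using mild_heat[of "d n * (t - s)" s n x] that d_pos[of n] by simp
  qed
  have supp: "s \<notin> {0<..<t} \<Longrightarrow> heat (d n * (t - s)) (\<lambda>y. G n (y, s)) x = 0 \<and> heat (d n * (t - s)) (\<lambda>y. L n (y, s)) x = 0" for n s x
    using d_pos[of n] by (cases "0 < s") (auto simp: G_nonpos L_nonpos mult_nonneg_nonpos)
  from mild[OF t, of n] mild[OF t, of m]
    duhamel_loss_finite[of n t] duhamel_loss_finite[of m t] duhamel_gain_finite[of n t] duhamel_gain_finite[of m t]
  show ?thesis
  proof eventually_elim
    case (elim x)
    show ?case
      by (rule product_rule[where t=t])
        (use elim init supp run in \<open>simp_all add: duhamel_def\<close>)
  qed
qed

text \<open>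
  The previous identity integrated over \<open>x\<close> and \<open>t\<close>. The term with \<open>d n + d m\<close> is the dissipation of the
  two-particle functional with kernel \<open>potential\<close>, and it is what the smallness assumption on the
  coagulation rate is compared with.
\<close>

lemma two_point_identity:
  fixes T
  defines "c n m \<equiv> d n + d m"
  shows "ennreal (c n m) * (\<integral>\<^sup>+t. indicator {..<T} t * (\<integral>\<^sup>+x. u n (x, t) * u m (x, t) \<partial>lborel) \<partial>lborel)
      + ((\<integral>\<^sup>+s. \<integral>\<^sup>+y. L n (y, s) * potential (c n m * (T - s)) (\<lambda>z. u m (z, s)) y \<partial>lborel \<partial>lborel)
       + (\<integral>\<^sup>+s. \<integral>\<^sup>+y. L m (y, s) * potential (c n m * (T - s)) (\<lambda>z. u n (z, s)) y \<partial>lborel \<partial>lborel))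
    = (\<integral>\<^sup>+y. h n y * potential (c n m * T) (h m) y \<partial>lborel)
      + ((\<integral>\<^sup>+s. \<integral>\<^sup>+y. G n (y, s) * potential (c n m * (T - s)) (\<lambda>z. u m (z, s)) y \<partial>lborel \<partial>lborel)
       + (\<integral>\<^sup>+s. \<integral>\<^sup>+y. G m (y, s) * potential (c n m * (T - s)) (\<lambda>z. u n (z, s)) y \<partial>lborel \<partial>lborel))"
proof -
  define X where "X q n m t x = (\<integral>\<^sup>+s. heat (d n * (t - s)) (\<lambda>y. q (y, s)) x * heat (d m * (t - s)) (\<lambda>y. u m (y, s)) x \<partial>lborel)"
    for q :: "'a \<times> real \<Rightarrow> ennreal" and n m t x
  have X_meas[measurable]: "case_prod (X q n m) \<in> borel_measurable (borel \<Otimes>\<^sub>M borel)"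
    if [measurable]: "q \<in> borel_measurable (borel \<Otimes>\<^sub>M borel)" for q n m
    unfolding X_def by measurable
  have X_meas'[measurable]: "X q n m t \<in> borel_measurable borel"
    if [measurable]: "q \<in> borel_measurable (borel \<Otimes>\<^sub>M borel)" for q n m t
    unfolding X_def by measurable
  have X_nonpos: "X q n m t x = 0" if "t \<le> 0" "\<And>x s. s \<le> 0 \<Longrightarrow> q (x, s) = 0" for q n m t x
  proof -
    have "heat (d n * (t - s)) (\<lambda>y. q (y, s)) x = 0" for s
      using that d_pos[of n] by (cases "s \<le> 0") (auto simp: mult_nonneg_nonpos)
    then show ?thesis by (simp add: X_def)
  qed
  have id: "(\<integral>\<^sup>+x. u n (x, t) * u m (x, t) \<partial>lborel) + ((\<integral>\<^sup>+x. X (L n) n m t x \<partial>lborel) + (\<integral>\<^sup>+x. X (L m) m n t x \<partial>lborel))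
    = (\<integral>\<^sup>+y. h n y * heat (c n m * t) (h m) y \<partial>lborel)
      + ((\<integral>\<^sup>+x. X (G n) n m t x \<partial>lborel) + (\<integral>\<^sup>+x. X (G m) m n t x \<partial>lborel))" (is "?l t = ?r t") for t
  proof (cases "0 < t")
    case True
    have "?l t = (\<integral>\<^sup>+x. u n (x, t) * u m (x, t) + (X (L n) n m t x + X (L m) m n t x) \<partial>lborel)"
      by (simp add: nn_integral_add)
    also have "\<dots> = (\<integral>\<^sup>+x. heat (d n * t) (h n) x * heat (d m * t) (h m) x + (X (G n) n m t x + X (G m) m n t x) \<partial>lborel)"
      unfolding X_def by (rule nn_integral_cong_AE) (rule two_point_pointwise[OF True])
    also have "\<dots> = (\<integral>\<^sup>+x. heat (d n * t) (h n) x * heat (d m * t) (h m) x \<partial>lborel)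
      + ((\<integral>\<^sup>+x. X (G n) n m t x \<partial>lborel) + (\<integral>\<^sup>+x. X (G m) m n t x \<partial>lborel))"
      by (simp add: nn_integral_add)
    finally show ?thesis
      using True d_pos by (simp add: nn_integral_heat_mult c_def distrib_right)
  next
    case False
    then have "c n m * t \<le> 0"
      using d_pos[of n] d_pos[of m] by (simp add: c_def mult_nonneg_nonpos)
    then show ?thesis
      using False by (simp add: u_nonpos X_nonpos L_nonpos G_nonpos)
  qed
  have cpos: "0 < c n m" using d_pos[of n] d_pos[of m] by (simp add: c_def)
  have hP: "ennreal (c n m) * (\<integral>\<^sup>+t. indicator {..<T} t * (\<integral>\<^sup>+y. h n y * heat (c n m * t) (h m) y \<partial>lborel) \<partial>lborel)
    = (\<integral>\<^sup>+y. h n y * potential (c n m * T) (h m) y \<partial>lborel)"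
  proof -
    have "ennreal (c n m) * (\<integral>\<^sup>+t. indicator {..<T} t * (\<integral>\<^sup>+y. h n y * heat (c n m * t) (h m) y \<partial>lborel) \<partial>lborel)
      = ennreal (c n m) * (\<integral>\<^sup>+t. \<integral>\<^sup>+y. h n y * (indicator {..<T} t * heat (c n m * t) (h m) y) \<partial>lborel \<partial>lborel)"
      by (subst nn_integral_cmult[symmetric]) (simp_all add: ac_simps)
    also have "\<dots> = ennreal (c n m) * (\<integral>\<^sup>+y. \<integral>\<^sup>+t. h n y * (indicator {..<T} t * heat (c n m * t) (h m) y) \<partial>lborel \<partial>lborel)"
      by (subst nn_integral_swap) simp_all
    also have "\<dots> = (\<integral>\<^sup>+y. h n y * (ennreal (c n m) * (\<integral>\<^sup>+t. indicator {..<T} t * heat (c n m * (t - 0)) (h m) y \<partial>lborel)) \<partial>lborel)"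
      by (subst nn_integral_cmult[symmetric]) (simp_all add: nn_integral_cmult ac_simps)
    also have "\<dots> = (\<integral>\<^sup>+y. h n y * potential (c n m * T) (h m) y \<partial>lborel)"
      using cpos by (subst potential_scale) auto
    finally show ?thesis .
  qed
  have XP: "ennreal (c n m) * (\<integral>\<^sup>+t. indicator {..<T} t * (\<integral>\<^sup>+x. X q n m t x \<partial>lborel) \<partial>lborel)
     = (\<integral>\<^sup>+s. \<integral>\<^sup>+y. q (y, s) * potential (c n m * (T - s)) (\<lambda>z. u m (z, s)) y \<partial>lborel \<partial>lborel)"
    if [measurable]: "q \<in> borel_measurable (borel \<Otimes>\<^sub>M borel)" for q n m
    unfolding X_def c_def by (rule nn_integral_heat_product) (use d_pos in auto)
  have csym: "c m n = c n m" by (simp add: c_def)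
  have "ennreal (c n m) * (\<integral>\<^sup>+t. indicator {..<T} t * ?l t \<partial>lborel) = ennreal (c n m) * (\<integral>\<^sup>+t. indicator {..<T} t * ?r t \<partial>lborel)"
    unfolding id ..
  then show ?thesis
    using XP[of "L n" n m] XP[of "G n" n m] XP[of "L m" m n] XP[of "G m" m n] hP
    by (simp add: distrib_left nn_integral_add csym)
qed

section \<open>A uniform bound on the potential of the mass\<close>

lemma AE_mild_all_times:
  "AE x in lborel. AE t in lborel.
      u n (x, t) + duhamel (d n) (L n) x t = heat (d n * t) (h n) x + duhamel (d n) (G n) x t"
proof -
  have "AE x in lborel. u n (x, t) + duhamel (d n) (L n) x t = heat (d n * t) (h n) x + duhamel (d n) (G n) x t" for t
  proof (cases "0 < t")
    case False
    have "duhamel (d n) q x t = 0" if "\<And>x s. s \<le> 0 \<Longrightarrow> q (x, s) = 0" for q x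
    proof -
      have "heat (d n * (t - s)) (\<lambda>y. q (y, s)) x = 0" for s
        using that False d_pos[of n] by (cases "s \<le> 0") (auto simp: mult_nonneg_nonpos)
      then show ?thesis by (simp add: duhamel_def)
    qed
    from this[of "L n"] this[of "G n"] have "duhamel (d n) (L n) x t = 0" "duhamel (d n) (G n) x t = 0" for x
      by (simp_all add: L_nonpos G_nonpos)
    then show ?thesis
      using False d_pos[of n] by (simp add: u_nonpos mult_nonneg_nonpos)
  qed (rule mild)
  then have 1: "AE t in lborel. AE x in lborel.
      u n (x, t) + duhamel (d n) (L n) x t = heat (d n * t) (h n) x + duhamel (d n) (G n) x t" by simp
  have 2: "{p \<in> space (lborel \<Otimes>\<^sub>M lborel). u n (fst p, snd p) + duhamel (d n) (L n) (fst p) (snd p)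
      = heat (d n * snd p) (h n) (fst p) + duhamel (d n) (G n) (fst p) (snd p)} \<in> sets (lborel \<Otimes>\<^sub>M lborel)"
    by (rule borel_measurable_eq) measurable
  show ?thesis
    using lborel_pair.AE_commute[where P="\<lambda>x t. u n (x, t) + duhamel (d n) (L n) x t
      = heat (d n * t) (h n) x + duhamel (d n) (G n) x t", OF 2] 1 by blast
qed

definition potential_bound :: "real \<Rightarrow> ennreal" where
  "potential_bound T = ennreal (2 * d 0 * T) * (\<Sum>m. ennreal (real m ^ 1) * H m)"

lemma potential_bound_finite: "potential_bound T < \<infinity>"
  unfolding potential_bound_def using H_sum[of 1] by (simp add: ennreal_mult_less_top)

lemma sum_potential_initial_le:
  assumes e: "\<And>m. e m \<le> 2 * d 0 * T"
  shows "(\<Sum>m\<le>N. ennreal (real m) * potential (e m) (h m) x) \<le> potential_bound T"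
proof -
  have "(\<Sum>m\<le>N. ennreal (real m) * potential (e m) (h m) x) \<le> (\<Sum>m\<le>N. ennreal (2 * d 0 * T) * (ennreal (real m ^ 1) * H m))"
  proof (rule sum_mono)
    fix m
    have "potential (e m) (h m) x \<le> ennreal (2 * d 0 * T) * H m"
      by (intro order_trans[OF potential_le_const[OF h_le]] mult_right_mono ennreal_leI e) auto
    then have "ennreal (real m) * potential (e m) (h m) x \<le> ennreal (real m) * (ennreal (2 * d 0 * T) * H m)"
      by (rule mult_left_mono) simp
    then show "ennreal (real m) * potential (e m) (h m) x \<le> ennreal (2 * d 0 * T) * (ennreal (real m ^ 1) * H m)"
      by (simp only: power_one_right mult.left_commute)
  qed
  also have "\<dots> \<le> potential_bound T"
    unfolding potential_bound_def sum_distrib_left[symmetric] by (intro mult_left_mono sum_le_suminf) auto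
  finally show ?thesis .
qed

text \<open>
  Applied to the Duhamel identity, the potential alone has as kernel the integral of \<open>p\<^sub>\<sigma>\<close> over
  \<open>d m * (t - s) < \<sigma> < c * (T - t) + d m * (T - s)\<close>. Its lower limit has the wrong monotonicity in \<open>m\<close>.
  Adding the accumulated mass \<open>d m * \<integral>\<^sub>0\<^sup>t u m\<close>, which is nonnegative, extends the kernel down to
  \<open>\<sigma> = 0\<close>; the resulting kernel is non-increasing in \<open>m\<close>.
\<close>

lemma mass_potential_le:
  assumes t: "0 < t" "t < T" and c: "0 < c" "c \<le> d 0"
  shows "AE x in lborel. (\<Sum>m\<le>N. ennreal (real m) * potential ((c + d m) * (T - t)) (\<lambda>y. u m (y, t)) x) \<le> potential_bound T"
proof -
  define \<tau> where "\<tau> m = (c + d m) * (T - t)" for m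
  have \<tau>: "0 \<le> \<tau> m" for m using t c d_pos[of m] by (simp add: \<tau>_def)
  \<comment> \<open>\<open>V\<close> is the accumulated mass; \<open>W\<close> and \<open>Y\<close> are the Duhamel terms of \<open>V\<close> and of the potential, and \<open>Z\<close> is their sum\<close>
  define V where "V m x = ennreal (d m) * (\<integral>\<^sup>+r. indicator {..<t} r * u m (x, r) \<partial>lborel)" for m x
  define W where "W q m x = (\<integral>\<^sup>+s. potential (d m * (t - s)) (\<lambda>y. q (y, s)) x \<partial>lborel)"
    for q :: "'a \<times> real \<Rightarrow> ennreal" and m x
  define Y where "Y q m x = (\<integral>\<^sup>+\<sigma>. indicator {0<..<\<tau> m} \<sigma> *
      (\<integral>\<^sup>+s. indicator {..<t} s * heat (\<sigma> + d m * (t - s)) (\<lambda>y. q (y, s)) x \<partial>lborel) \<partial>lborel)"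
    for q :: "'a \<times> real \<Rightarrow> ennreal" and m x
  define Z where "Z q m x = (\<integral>\<^sup>+s. indicator {..<t} s * potential (c * (T - t) + d m * (T - s)) (\<lambda>y. q (y, s)) x \<partial>lborel)"
    for q :: "'a \<times> real \<Rightarrow> ennreal" and m x
  have shift: "\<tau> m + d m * (t - s) = c * (T - t) + d m * (T - s)" for m s
    by (simp add: \<tau>_def algebra_simps)
  have WYZ: "W q m x + Y q m x = Z q m x" if [measurable]: "q \<in> borel_measurable (borel \<Otimes>\<^sub>M borel)" for q m x
  proof -
    let ?k = "\<lambda>s \<sigma>. indicator {0<..<\<tau> m} \<sigma> * (indicator {..<t} s * heat (\<sigma> + d m * (t - s)) (\<lambda>y. q (y, s)) x)"
    have "Y q m x = (\<integral>\<^sup>+\<sigma>. \<integral>\<^sup>+s. ?k s \<sigma> \<partial>lborel \<partial>lborel)"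
      unfolding Y_def by (simp add: nn_integral_cmult)
    also have "\<dots> = (\<integral>\<^sup>+s. \<integral>\<^sup>+\<sigma>. ?k s \<sigma> \<partial>lborel \<partial>lborel)"
      by (rule nn_integral_swap) measurable
    finally have "W q m x + Y q m x = (\<integral>\<^sup>+s. potential (d m * (t - s)) (\<lambda>y. q (y, s)) x + (\<integral>\<^sup>+\<sigma>. ?k s \<sigma> \<partial>lborel) \<partial>lborel)"
      unfolding W_def by (simp add: nn_integral_add)
    also have "\<dots> = Z q m x"
      unfolding Z_def
    proof (rule nn_integral_cong)
      fix s
      show "potential (d m * (t - s)) (\<lambda>y. q (y, s)) x + (\<integral>\<^sup>+\<sigma>. ?k s \<sigma> \<partial>lborel)
        = indicator {..<t} s * potential (c * (T - t) + d m * (T - s)) (\<lambda>y. q (y, s)) x"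
      proof (cases "s < t")
        case True
        then show ?thesis
          using potential_shift[of "\<lambda>y. q (y, s)" "d m * (t - s)" "\<tau> m" x] d_pos[of m] \<tau>[of m]
          by (simp add: shift)
      next
        case False
        then show ?thesis using d_pos[of m] by (simp add: mult_nonneg_nonpos)
      qed
    qed
    finally show ?thesis .
  qed
  have PY: "potential (\<tau> m) (\<lambda>y. u m (y, t)) x + Y (L m) m x
    = (\<integral>\<^sup>+\<sigma>. indicator {0<..<\<tau> m} \<sigma> * heat (\<sigma> + d m * t) (h m) x \<partial>lborel) + Y (G m) m x" for m x
  proof -
    have "potential (\<tau> m) (\<lambda>y. u m (y, t)) x + Y (L m) m x = (\<integral>\<^sup>+\<sigma>. indicator {0<..<\<tau> m} \<sigma> * (heat \<sigma> (\<lambda>y. u m (y, t)) x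
        + (\<integral>\<^sup>+s. indicator {..<t} s * heat (\<sigma> + d m * (t - s)) (\<lambda>y. L m (y, s)) x \<partial>lborel)) \<partial>lborel)"
      unfolding potential_pos_eq Y_def by (simp add: distrib_left nn_integral_add)
    also have "\<dots> = (\<integral>\<^sup>+\<sigma>. indicator {0<..<\<tau> m} \<sigma> * (heat (\<sigma> + d m * t) (h m) x
        + (\<integral>\<^sup>+s. indicator {..<t} s * heat (\<sigma> + d m * (t - s)) (\<lambda>y. G m (y, s)) x \<partial>lborel)) \<partial>lborel)"
    proof (rule nn_integral_cong)
      fix \<sigma>
      show "indicator {0<..<\<tau> m} \<sigma> * (heat \<sigma> (\<lambda>y. u m (y, t)) x
        + (\<integral>\<^sup>+s. indicator {..<t} s * heat (\<sigma> + d m * (t - s)) (\<lambda>y. L m (y, s)) x \<partial>lborel))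
       = indicator {0<..<\<tau> m} \<sigma> * (heat (\<sigma> + d m * t) (h m) x
        + (\<integral>\<^sup>+s. indicator {..<t} s * heat (\<sigma> + d m * (t - s)) (\<lambda>y. G m (y, s)) x \<partial>lborel))"
        using mild_heat[of \<sigma> t m x] t by (cases "0 < \<sigma>") simp_all
    qed
    also have "\<dots> = (\<integral>\<^sup>+\<sigma>. indicator {0<..<\<tau> m} \<sigma> * heat (\<sigma> + d m * t) (h m) x \<partial>lborel) + Y (G m) m x"
      unfolding Y_def by (simp add: distrib_left nn_integral_add)
    finally show ?thesis .
  qed
  have VW: "AE x in lborel. \<forall>m. V m x + W (L m) m x = potential (d m * t) (h m) x + W (G m) m x"
    unfolding AE_all_countable
  proof
    fix m
    show "AE x in lborel. V m x + W (L m) m x = potential (d m * t) (h m) x + W (G m) m x"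
      using AE_mild_all_times[of m]
    proof eventually_elim
      case (elim x)
      have "(\<integral>\<^sup>+r. indicator {..<t} r * (u m (x, r) + duhamel (d m) (L m) x r) \<partial>lborel)
        = (\<integral>\<^sup>+r. indicator {..<t} r * (heat (d m * r) (h m) x + duhamel (d m) (G m) x r) \<partial>lborel)"
        by (rule nn_integral_cong_AE) (use elim in eventually_elim, simp)
      then have "ennreal (d m) * (\<integral>\<^sup>+r. indicator {..<t} r * (u m (x, r) + duhamel (d m) (L m) x r) \<partial>lborel)
        = ennreal (d m) * (\<integral>\<^sup>+r. indicator {..<t} r * (heat (d m * r) (h m) x + duhamel (d m) (G m) x r) \<partial>lborel)"
        by simp
      then show ?case
        using potential_scale[of "h m" "d m" t 0 x] d_pos[of m]
        by (simp add: V_def W_def distrib_left nn_integral_add nn_integral_duhamel_time)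
    qed
  qed
  have Zfin: "AE x in lborel. \<forall>m. Z (L m) m x < \<infinity>"
    unfolding AE_all_countable
  proof
    fix m
    have "(\<integral>\<^sup>+x. Z (L m) m x \<partial>lborel)
      = (\<integral>\<^sup>+s. \<integral>\<^sup>+x. indicator {..<t} s * potential (c * (T - t) + d m * (T - s)) (\<lambda>y. L m (y, s)) x \<partial>lborel \<partial>lborel)"
      unfolding Z_def by (rule nn_integral_swap) measurable
    also have "\<dots> = (\<integral>\<^sup>+s. indicator {..<t} s * (ennreal (c * (T - t) + d m * (T - s)) * (\<integral>\<^sup>+y. L m (y, s) \<partial>lborel)) \<partial>lborel)"
      by (simp add: nn_integral_cmult nn_integral_potential)
    also have "\<dots> \<le> (\<integral>\<^sup>+s. ennreal (c * (T - t) + d m * T) * (indicator {..<t} s * (\<integral>\<^sup>+y. L m (y, s) \<partial>lborel)) \<partial>lborel)"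
    proof (rule nn_integral_mono)
      fix s :: real
      show "indicator {..<t} s * (ennreal (c * (T - t) + d m * (T - s)) * (\<integral>\<^sup>+y. L m (y, s) \<partial>lborel))
        \<le> ennreal (c * (T - t) + d m * T) * (indicator {..<t} s * (\<integral>\<^sup>+y. L m (y, s) \<partial>lborel))"
      proof (cases "0 < s")
        case True
        then have "ennreal (c * (T - t) + d m * (T - s)) \<le> ennreal (c * (T - t) + d m * T)"
          using d_pos[of m] by (intro ennreal_leI) (simp add: algebra_simps)
        then show ?thesis by (auto simp: indicator_def intro!: mult_right_mono)
      qed (simp add: L_nonpos)
    qed
    also have "\<dots> < \<infinity>"
      using loss_L1[of t m] by (simp add: nn_integral_cmult ennreal_mult_less_top)
    finally have "AE x in lborel. Z (L m) m x \<noteq> \<infinity>"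
      by (intro nn_integral_PInf_AE) (auto simp: Z_def)
    then show "AE x in lborel. Z (L m) m x < \<infinity>"
      by eventually_elim (simp add: less_top)
  qed
  have Z_mono: "(\<Sum>m\<le>N. ennreal (real m) * Z (G m) m x) \<le> (\<Sum>m\<le>N. ennreal (real m) * Z (L m) m x)" for x
  proof -
    define \<kappa> where "\<kappa> s \<sigma> y m = indicator {..<t} s * (indicator {..<c * (T - t) + d m * (T - s)} \<sigma> * gauss \<sigma> (x - y))"
      for s \<sigma> :: real and y and m :: nat
    have ex: "(\<Sum>m\<le>N. ennreal (real m) * Z (q m) m x)
      = (\<integral>\<^sup>+s. \<integral>\<^sup>+\<sigma>. \<integral>\<^sup>+y. (\<Sum>m\<le>N. ennreal (real m) * \<kappa> s \<sigma> y m * q m (y, s)) \<partial>lborel \<partial>lborel \<partial>lborel)"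
      if [measurable]: "\<And>m. q m \<in> borel_measurable (borel \<Otimes>\<^sub>M borel)" for q :: "nat \<Rightarrow> 'a \<times> real \<Rightarrow> ennreal"
    proof -
      show ?thesis
        unfolding Z_def potential_def heat_def \<kappa>_def indicator_def lessThan_iff
        by (simp add: nn_integral_sum nn_integral_cmult mult.assoc)
    qed
    show ?thesis
      unfolding ex[OF G_meas] ex[OF L_meas]
    proof (intro nn_integral_mono gain_le_loss_anti)
      fix s \<sigma> :: real and y :: 'a and n m :: nat
      assume nm: "n \<le> m"
      show "\<kappa> s \<sigma> y m \<le> \<kappa> s \<sigma> y n"
      proof (cases "s < t")
        case True
        then have "d m * (T - s) \<le> d n * (T - s)"
          using t d_anti[OF nm] by (intro mult_right_mono) auto
        then show ?thesis
          unfolding \<kappa>_def by (intro mult_left_mono mult_right_mono) (auto simp: indicator_def)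
      qed (simp add: \<kappa>_def)
    qed
  qed
  from VW Zfin show ?thesis
  proof eventually_elim
    case (elim x)
    have eq: "(potential (\<tau> m) (\<lambda>y. u m (y, t)) x + V m x) + Z (L m) m x
       = potential (c * (T - t) + d m * T) (h m) x + Z (G m) m x" for m
    proof -
      have "(potential (\<tau> m) (\<lambda>y. u m (y, t)) x + V m x) + Z (L m) m x
        = (potential (\<tau> m) (\<lambda>y. u m (y, t)) x + Y (L m) m x) + (V m x + W (L m) m x)"
        by (simp add: WYZ[symmetric] ac_simps)
      also have "\<dots> = (potential (d m * t) (h m) x + (\<integral>\<^sup>+\<sigma>. indicator {0<..<\<tau> m} \<sigma> * heat (\<sigma> + d m * t) (h m) x \<partial>lborel))
           + (W (G m) m x + Y (G m) m x)"
        unfolding PY elim(1)[rule_format] by (simp only: ac_simps)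
      also have "\<dots> = potential (\<tau> m + d m * t) (h m) x + Z (G m) m x"
        using d_pos[of m] t \<tau>[of m] by (simp add: potential_shift WYZ)
      also have "\<tau> m + d m * t = c * (T - t) + d m * T"
        by (simp add: \<tau>_def algebra_simps)
      finally show ?thesis .
    qed
    have "(\<Sum>m\<le>N. ennreal (real m) * (potential (\<tau> m) (\<lambda>y. u m (y, t)) x + V m x)) + (\<Sum>m\<le>N. ennreal (real m) * Z (L m) m x)
      = (\<Sum>m\<le>N. ennreal (real m) * potential (c * (T - t) + d m * T) (h m) x) + (\<Sum>m\<le>N. ennreal (real m) * Z (G m) m x)"
      unfolding sum.distrib[symmetric] by (intro sum.cong refl) (simp only: distrib_left[symmetric] eq)
    moreover have "(\<Sum>m\<le>N. ennreal (real m) * Z (L m) m x) < \<infinity>"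
      using elim(2) by (simp add: ennreal_mult_less_top)
    ultimately have "(\<Sum>m\<le>N. ennreal (real m) * (potential (\<tau> m) (\<lambda>y. u m (y, t)) x + V m x))
        \<le> (\<Sum>m\<le>N. ennreal (real m) * potential (c * (T - t) + d m * T) (h m) x)"
      by (intro ennreal_cancel_le[OF _ Z_mono])
    also have "\<dots> \<le> potential_bound T"
    proof (rule sum_potential_initial_le)
      fix m
      have "c * (T - t) + d m * T \<le> d 0 * T + d 0 * T"
        using c t d_anti[of 0 m] d_pos[of 0] by (intro add_mono mult_mono) auto
      then show "c * (T - t) + d m * T \<le> 2 * d 0 * T" by (simp add: ac_simps)
    qed
    finally have "(\<Sum>m\<le>N. ennreal (real m) * (potential (\<tau> m) (\<lambda>y. u m (y, t)) x + V m x)) \<le> potential_bound T" .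
    moreover have "(\<Sum>m\<le>N. ennreal (real m) * potential (\<tau> m) (\<lambda>y. u m (y, t)) x)
      \<le> (\<Sum>m\<le>N. ennreal (real m) * (potential (\<tau> m) (\<lambda>y. u m (y, t)) x + V m x))"
      by (intro sum_mono mult_left_mono) auto
    ultimately show ?case unfolding \<tau>_def by (rule order_trans[rotated])
  qed
qed

end

section \<open>Integral bounds on all moments\<close>

text \<open>
  An upper bound for \<open>(n + m)\<^bsup>b+1\<^esup> - n\<^bsup>b+1\<^esup> - m\<^bsup>b+1\<^esup>\<close>. It is of first order in the smaller mass, so
  that \<open>(n + m) * excess b n m\<close> is comparable to \<open>n\<^bsup>b+1\<^esup> m + m\<^bsup>b+1\<^esup> n\<close>.
\<close>

definition excess :: "nat \<Rightarrow> nat \<Rightarrow> nat \<Rightarrow> real" where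
  "excess b n m = 2 ^ Suc b * real (max n m) ^ b * real (min n m)"

lemma power_add_le_excess: "real (n + m) ^ Suc b \<le> real n ^ Suc b + real m ^ Suc b + excess b n m"
proof -
  have aux: "(x + y) ^ Suc b \<le> x ^ Suc b + (2 ^ Suc b - 1) * x ^ b * y" if "0 \<le> y" "y \<le> x" for x y :: real
  proof (induction b)
    case (Suc b)
    have "(x + y) ^ Suc (Suc b) = (x + y) ^ Suc b * (x + y)" by simp
    also have "\<dots> \<le> (x ^ Suc b + (2 ^ Suc b - 1) * x ^ b * y) * (x + y)"
      using that by (intro mult_right_mono Suc) auto
    also have "\<dots> = x ^ Suc (Suc b) + (1 + (2 ^ Suc b - 1)) * x ^ Suc b * y + (2 ^ Suc b - 1) * (x ^ b * y) * y"
      by (simp add: algebra_simps)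
    also have "(2 ^ Suc b - 1) * (x ^ b * y) * y \<le> (2 ^ Suc b - 1) * (x ^ b * y) * x"
      using that by (intro mult_left_mono mult_nonneg_nonneg) (auto simp: one_le_power[of "2::real" "Suc b", simplified])
    finally show ?case by (simp add: algebra_simps)
  qed simp
  have main: "(x + y) ^ Suc b \<le> x ^ Suc b + y ^ Suc b + 2 ^ Suc b * x ^ b * y" if "0 \<le> y" "y \<le> x" for x y :: real
  proof -
    have "(2 ^ Suc b - 1) * (x ^ b * y) \<le> 2 ^ Suc b * (x ^ b * y)"
      using that by (intro mult_right_mono) auto
    moreover have "0 \<le> y ^ Suc b" using that by simp
    ultimately show ?thesis using aux[OF that] by (simp only: mult.assoc)
  qed
  show ?thesis
  proof (cases "m \<le> n")
    case True
    then show ?thesis using main[of "real m" "real n"] by (simp add: excess_def max_def min_def)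
  next
    case False
    then show ?thesis using main[of "real n" "real m"] by (simp add: excess_def max_def min_def add.commute)
  qed
qed

lemma excess_nonneg: "0 \<le> excess b n m"
  by (simp add: excess_def)

lemma sum_mult_excess_le:
  "real (n + m) * excess b n m \<le> 2 * 2 ^ Suc b * (real n ^ Suc b * real m + real m ^ Suc b * real n)"
proof -
  have "real (n + m) * excess b n m \<le> (2 * real (max n m)) * excess b n m"
    by (intro mult_right_mono excess_nonneg) (simp add: max_def)
  also have "\<dots> = 2 * 2 ^ Suc b * (real (max n m) ^ Suc b * real (min n m))"
    by (simp add: excess_def)
  also have "\<dots> \<le> 2 * 2 ^ Suc b * (real n ^ Suc b * real m + real m ^ Suc b * real n)"
    by (intro mult_left_mono) (auto simp: max_def min_def)
  finally show ?thesis .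
qed

lemma sum_if_le:
  fixes f :: "nat \<Rightarrow> ennreal"
  shows "(\<Sum>n\<le>N. if n \<le> k then f n else 0) \<le> (\<Sum>n\<le>k. f n)"
proof -
  have "(\<Sum>n\<le>N. if n \<le> k then f n else 0) = (\<Sum>n\<in>{..N} \<inter> {..k}. f n)"
    using sum.inter_restrict[of "{..N}" f "{..k}"] by simp
  also have "\<dots> \<le> (\<Sum>n\<le>k. f n)" by (rule sum_mono2) auto
  finally show ?thesis .
qed

context coagulation
begin

lemma u_bounded: obtains B where "B < \<infinity>" "\<And>t. AE x in lborel. u n (x, t) \<le> B"
  using u_poly_bound[of thesis] by (metis ennreal_less_top infinity_ennreal_def)

lemma mass_balance:
  assumes t: "0 < t"
  shows "(\<integral>\<^sup>+x. u n (x, t) \<partial>lborel) + integral_before t (L n)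
    = (\<integral>\<^sup>+x. h n x \<partial>lborel) + integral_before t (G n)"
proof -
  have "(\<integral>\<^sup>+x. u n (x, t) + duhamel (d n) (L n) x t \<partial>lborel)
    = (\<integral>\<^sup>+x. heat (d n * t) (h n) x + duhamel (d n) (G n) x t \<partial>lborel)"
    by (rule nn_integral_cong_AE) (rule mild[OF t])
  then show ?thesis
    using t d_pos[of n] by (simp add: nn_integral_add nn_integral_duhamel nn_integral_heat)
qed

lemma u_L1: obtains M where "M < \<infinity>" "\<And>t. t < T \<Longrightarrow> (\<integral>\<^sup>+x. u n (x, t) \<partial>lborel) \<le> M"
proof
  let ?M = "(\<integral>\<^sup>+x. h n x \<partial>lborel) + integral_before T (G n)"
  show "?M < \<infinity>" using h_fin[of n] gain_L1[of T n] by simp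
  fix t assume t: "t < T"
  show "(\<integral>\<^sup>+x. u n (x, t) \<partial>lborel) \<le> ?M"
  proof (cases "0 < t")
    case True
    have "(\<integral>\<^sup>+x. u n (x, t) \<partial>lborel) \<le> (\<integral>\<^sup>+x. h n x \<partial>lborel) + integral_before t (G n)"
      unfolding mass_balance[OF True, symmetric] by simp
    also have "\<dots> \<le> ?M"
      using t by (intro add_left_mono nn_integral_mono mult_right_mono) (auto simp: indicator_def)
    finally show ?thesis .
  qed (simp add: u_nonpos)
qed

definition overlap :: "real \<Rightarrow> nat \<Rightarrow> nat \<Rightarrow> ennreal" where
  "overlap T n m = (\<integral>\<^sup>+t. indicator {..<T} t * (\<integral>\<^sup>+x. u n (x, t) * u m (x, t) \<partial>lborel) \<partial>lborel)"

lemma overlap_sym: "overlap T n m = overlap T m n"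
  by (simp add: overlap_def mult.commute)

lemma overlap_finite: "overlap T n m < \<infinity>"
proof -
  obtain B where B: "B < \<infinity>" "\<And>t. AE x in lborel. u m (x, t) \<le> B" using u_bounded[of m] by blast
  obtain M where M: "M < \<infinity>" "\<And>t. t < T \<Longrightarrow> (\<integral>\<^sup>+x. u n (x, t) \<partial>lborel) \<le> M" using u_L1[of T n] by blast
  have "overlap T n m \<le> (\<integral>\<^sup>+t. (M * B) * indicator {0<..<T} t \<partial>lborel)"
    unfolding overlap_def
  proof (rule nn_integral_mono)
    fix t
    show "indicator {..<T} t * (\<integral>\<^sup>+x. u n (x, t) * u m (x, t) \<partial>lborel) \<le> (M * B) * indicator {0<..<T} t"
    proof (cases "0 < t \<and> t < T")
      case True
      have "(\<integral>\<^sup>+x. u n (x, t) * u m (x, t) \<partial>lborel) \<le> (\<integral>\<^sup>+x. u n (x, t) * B \<partial>lborel)"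
        using B(2)[of t] by (intro nn_integral_mono_AE) (auto elim!: eventually_mono intro!: mult_left_mono)
      also have "\<dots> \<le> M * B"
        using True M(2)[of t] by (simp add: nn_integral_multc mult_right_mono)
      finally show ?thesis using True by simp
    next
      case False
      then show ?thesis by (cases "t \<le> 0") (auto simp: u_nonpos)
    qed
  qed
  also have "\<dots> < \<infinity>"
    using B M by (cases "0 \<le> T") (simp_all add: nn_integral_cmult_indicator ennreal_mult_less_top)
  finally show ?thesis .
qed

lemma weighted_loss_finite:
  fixes v :: "nat \<Rightarrow> ennreal" and \<Phi> :: "nat \<Rightarrow> real \<Rightarrow> 'a \<Rightarrow> ennreal"
  assumes "\<And>n. v n < \<infinity>" "C < \<infinity>"
    and \<Phi>: "\<And>s. 0 < s \<Longrightarrow> s < T \<Longrightarrow> AE y in lborel. \<forall>n\<le>N. \<Phi> n s y \<le> C"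
    and \<Phi>0: "\<And>n s y. T \<le> s \<Longrightarrow> \<Phi> n s y = 0"
  shows "(\<integral>\<^sup>+s. \<integral>\<^sup>+y. (\<Sum>n\<le>N. v n * \<Phi> n s y * L n (y, s)) \<partial>lborel \<partial>lborel) < \<infinity>"
proof -
  have "(\<integral>\<^sup>+s. \<integral>\<^sup>+y. (\<Sum>n\<le>N. v n * \<Phi> n s y * L n (y, s)) \<partial>lborel \<partial>lborel)
    \<le> (\<integral>\<^sup>+s. (\<Sum>n\<le>N. (v n * C) * (indicator {..<T} s * (\<integral>\<^sup>+y. L n (y, s) \<partial>lborel))) \<partial>lborel)"
  proof (rule nn_integral_mono)
    fix s
    show "(\<integral>\<^sup>+y. (\<Sum>n\<le>N. v n * \<Phi> n s y * L n (y, s)) \<partial>lborel)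
      \<le> (\<Sum>n\<le>N. (v n * C) * (indicator {..<T} s * (\<integral>\<^sup>+y. L n (y, s) \<partial>lborel)))"
    proof (cases "0 < s \<and> s < T")
      case True
      then have "(\<integral>\<^sup>+y. (\<Sum>n\<le>N. v n * \<Phi> n s y * L n (y, s)) \<partial>lborel)
        \<le> (\<integral>\<^sup>+y. (\<Sum>n\<le>N. v n * C * L n (y, s)) \<partial>lborel)"
        using \<Phi>[of s] by (intro nn_integral_mono_AE)
          (auto elim!: eventually_mono intro!: sum_mono mult_right_mono mult_left_mono)
      also have "\<dots> = (\<Sum>n\<le>N. (v n * C) * (\<integral>\<^sup>+y. L n (y, s) \<partial>lborel))"
        by (simp add: nn_integral_sum nn_integral_cmult)
      finally show ?thesis using True by simp
    next
      case False
      then show ?thesis by (cases "s \<le> 0") (auto simp: L_nonpos \<Phi>0)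
    qed
  qed
  also have "\<dots> = (\<Sum>n\<le>N. (v n * C) * integral_before T (L n))"
    by (simp add: nn_integral_sum nn_integral_cmult)
  also have "\<dots> < \<infinity>"
    using assms(1,2) loss_L1[of T] by (simp add: ennreal_mult_less_top)
  finally show ?thesis .
qed

definition excess_rate :: "nat \<Rightarrow> nat \<Rightarrow> 'a \<times> real \<Rightarrow> ennreal" where
  "excess_rate b N p = (\<Sum>n\<le>N. \<Sum>m\<le>N. ennreal (al n m) * u n p * u m p * ennreal (excess b n m))"

lemma excess_rate_measurable[measurable]: "excess_rate b N \<in> borel_measurable (borel \<Otimes>\<^sub>M borel)"
  unfolding excess_rate_def[abs_def] by measurable

lemma nn_integral_excess_rate:
  "integral_before T (excess_rate b N)
    = (\<Sum>n\<le>N. \<Sum>m\<le>N. ennreal (al n m * excess b n m) * overlap T n m)"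
proof -
  have "integral_before T (excess_rate b N)
    = (\<integral>\<^sup>+s. (\<Sum>n\<le>N. \<Sum>m\<le>N. ennreal (al n m * excess b n m) *
        (indicator {..<T} s * (\<integral>\<^sup>+y. u n (y, s) * u m (y, s) \<partial>lborel))) \<partial>lborel)"
  proof (rule nn_integral_cong)
    fix s
    have "excess_rate b N (y, s) = (\<Sum>n\<le>N. \<Sum>m\<le>N. ennreal (al n m * excess b n m) * (u n (y, s) * u m (y, s)))" for y
      unfolding excess_rate_def by (simp add: ennreal_mult al_nonneg excess_nonneg ac_simps)
    then have "(\<integral>\<^sup>+y. excess_rate b N (y, s) \<partial>lborel)
      = (\<Sum>n\<le>N. \<Sum>m\<le>N. ennreal (al n m * excess b n m) * (\<integral>\<^sup>+y. u n (y, s) * u m (y, s) \<partial>lborel))"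
      by (simp add: nn_integral_sum nn_integral_cmult)
    then show "indicator {..<T} s * (\<integral>\<^sup>+y. excess_rate b N (y, s) \<partial>lborel)
      = (\<Sum>n\<le>N. \<Sum>m\<le>N. ennreal (al n m * excess b n m) *
        (indicator {..<T} s * (\<integral>\<^sup>+y. u n (y, s) * u m (y, s) \<partial>lborel)))"
      by (simp add: sum_distrib_left ac_simps)
  qed
  then show ?thesis
    unfolding overlap_def by (simp add: nn_integral_sum nn_integral_cmult)
qed

text \<open>
  The weight \<open>n\<^bsup>b+1\<^esup> \<kappa> n\<close> is not subadditive, but monotonicity of \<open>\<kappa>\<close> reduces the defect to that of
  the powers.
\<close>

lemma power_gain_le_loss:
  assumes K: "\<And>n. \<kappa> n \<le> K" and \<kappa>: "\<And>n m. n \<le> m \<Longrightarrow> \<kappa> m \<le> \<kappa> n"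
  shows "(\<Sum>n\<le>N. ennreal (real n ^ Suc b) * \<kappa> n * G n p) \<le> (\<Sum>n\<le>N. ennreal (real n ^ Suc b) * \<kappa> n * L n p) + K * excess_rate b N p"
proof -
  have "(\<Sum>n\<le>N. ennreal (real n ^ Suc b) * \<kappa> n * G n p) \<le> (\<Sum>n\<le>N. ennreal (real n ^ Suc b) * \<kappa> n * L n p)
    + (\<Sum>n\<le>N. \<Sum>m\<le>N. ennreal (al n m) * u n p * u m p * (K * ennreal (excess b n m)))"
  proof (rule gain_le_loss)
    fix n m
    have "ennreal (real (n + m) ^ Suc b) \<le> ennreal (real n ^ Suc b + real m ^ Suc b + excess b n m)"
      by (rule ennreal_leI) (rule power_add_le_excess)
    also have "\<dots> = ennreal (real n ^ Suc b) + ennreal (real m ^ Suc b) + ennreal (excess b n m)"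
      by (simp add: ennreal_plus excess_nonneg del: power_Suc)
    finally have "ennreal (real (n + m) ^ Suc b) * \<kappa> (n + m)
      \<le> (ennreal (real n ^ Suc b) + ennreal (real m ^ Suc b) + ennreal (excess b n m)) * \<kappa> (n + m)"
      by (rule mult_right_mono) simp
    also have "\<dots> = ennreal (real n ^ Suc b) * \<kappa> (n + m) + ennreal (real m ^ Suc b) * \<kappa> (n + m) + ennreal (excess b n m) * \<kappa> (n + m)"
      by (simp only: distrib_right)
    also have "\<dots> \<le> ennreal (real n ^ Suc b) * \<kappa> n + ennreal (real m ^ Suc b) * \<kappa> m + ennreal (excess b n m) * K"
      by (intro add_mono mult_left_mono \<kappa> K) auto
    finally show "ennreal (real (n + m) ^ Suc b) * \<kappa> (n + m)
      \<le> ennreal (real n ^ Suc b) * \<kappa> n + ennreal (real m ^ Suc b) * \<kappa> m + K * ennreal (excess b n m)"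
      by (simp only: mult.commute[of K])
  qed
  also have "(\<Sum>n\<le>N. \<Sum>m\<le>N. ennreal (al n m) * u n p * u m p * (K * ennreal (excess b n m))) = K * excess_rate b N p"
    unfolding excess_rate_def sum_distrib_left by (simp only: ac_simps)
  finally show ?thesis .
qed

text \<open>
  The identity for pairs summed with weights \<open>n\<^bsup>b+1\<^esup> m\<close>. Coagulation of the particle with weight
  \<open>m\<close> only decreases the sum (\<open>\<B>\<close> below); coagulation of the one with weight \<open>n\<^bsup>b+1\<^esup>\<close> (\<open>\<A>\<close>) costs
  the excess times the potential of the mass, which is bounded.
\<close>

lemma two_point_sum:
  assumes T: "0 < T"
  shows "(\<Sum>n\<le>N. \<Sum>m\<le>N. ennreal (real n ^ Suc b) * ennreal (real m) * (ennreal (d n + d m) * overlap T n m))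
    \<le> (\<Sum>n\<le>N. \<Sum>m\<le>N. ennreal (real n ^ Suc b) * ennreal (real m) * (\<integral>\<^sup>+y. h n y * potential ((d n + d m) * T) (h m) y \<partial>lborel))
      + potential_bound T * integral_before T (excess_rate b N)"
proof -
  define w where "w n = ennreal (real n ^ Suc b)" for n
  define c where "c n m = d n + d m" for n m
  have cpos: "0 < c n m" for n m using d_pos[of n] d_pos[of m] by (simp add: c_def)
  have c_anti: "n \<le> n' \<Longrightarrow> c n' m \<le> c n m" for n n' m using d_anti by (simp add: c_def)
  define \<Lambda> where "\<Lambda> n s y = (\<Sum>m\<le>N. ennreal (real m) * potential (c n m * (T - s)) (\<lambda>z. u m (z, s)) y)" for n s y
  define \<Omega> where "\<Omega> m s y = (\<Sum>n\<le>N. w n * potential (c n m * (T - s)) (\<lambda>z. u n (z, s)) y)" for m s y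
  define A where "A q n m = (\<integral>\<^sup>+s. \<integral>\<^sup>+y. q n (y, s) * potential (c n m * (T - s)) (\<lambda>z. u m (z, s)) y \<partial>lborel \<partial>lborel)"
    for q :: "nat \<Rightarrow> 'a \<times> real \<Rightarrow> ennreal" and n m
  define B where "B q n m = (\<integral>\<^sup>+s. \<integral>\<^sup>+y. q m (y, s) * potential (c n m * (T - s)) (\<lambda>z. u n (z, s)) y \<partial>lborel \<partial>lborel)"
    for q :: "nat \<Rightarrow> 'a \<times> real \<Rightarrow> ennreal" and n m
  define E where "E n m = (\<integral>\<^sup>+y. h n y * potential (c n m * T) (h m) y \<partial>lborel)" for n m
  define X where "X = (\<Sum>n\<le>N. \<Sum>m\<le>N. w n * ennreal (real m) * (ennreal (c n m) * overlap T n m))"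
  define \<A> where "\<A> q = (\<Sum>n\<le>N. \<Sum>m\<le>N. w n * ennreal (real m) * A q n m)" for q
  define \<B> where "\<B> q = (\<Sum>n\<le>N. \<Sum>m\<le>N. w n * ennreal (real m) * B q n m)" for q
  define \<E> where "\<E> = (\<Sum>n\<le>N. \<Sum>m\<le>N. w n * ennreal (real m) * E n m)"
  define IS where "IS = integral_before T (excess_rate b N)"
  have [measurable]: "case_prod (\<Lambda> n) \<in> borel_measurable (borel \<Otimes>\<^sub>M borel)" "\<Lambda> n s \<in> borel_measurable borel" for n s
    unfolding \<Lambda>_def by measurable
  have id: "ennreal (c n m) * overlap T n m + (A L n m + B L n m) = E n m + (A G n m + B G n m)" for n m
    using two_point_identity[of n m T] unfolding overlap_def A_def B_def E_def c_def .
  have total: "X + (\<A> L + \<B> L) = \<E> + (\<A> G + \<B> G)"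
    unfolding X_def \<A>_def \<B>_def \<E>_def
    by (simp only: sum.distrib[symmetric] distrib_left[symmetric] id)
  have \<A>_eq: "\<A> q = (\<integral>\<^sup>+s. \<integral>\<^sup>+y. (\<Sum>n\<le>N. w n * \<Lambda> n s y * q n (y, s)) \<partial>lborel \<partial>lborel)"
    if [measurable]: "\<And>n. q n \<in> borel_measurable (borel \<Otimes>\<^sub>M borel)" for q
  proof -
    have "\<A> q = (\<integral>\<^sup>+s. \<integral>\<^sup>+y. (\<Sum>n\<le>N. \<Sum>m\<le>N. w n * ennreal (real m) *
        (q n (y, s) * potential (c n m * (T - s)) (\<lambda>z. u m (z, s)) y)) \<partial>lborel \<partial>lborel)"
      unfolding \<A>_def A_def by (simp add: nn_integral_sum nn_integral_cmult)
    then show ?thesis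
      unfolding \<Lambda>_def sum_distrib_left sum_distrib_right by (simp only: ac_simps)
  qed
  have \<B>_eq: "\<B> q = (\<integral>\<^sup>+s. \<integral>\<^sup>+y. (\<Sum>m\<le>N. ennreal (real m) * \<Omega> m s y * q m (y, s)) \<partial>lborel \<partial>lborel)"
    if [measurable]: "\<And>n. q n \<in> borel_measurable (borel \<Otimes>\<^sub>M borel)" for q
  proof -
    have "\<B> q = (\<Sum>m\<le>N. \<Sum>n\<le>N. w n * ennreal (real m) * B q n m)"
      unfolding \<B>_def by (rule sum.swap)
    also have "\<dots> = (\<integral>\<^sup>+s. \<integral>\<^sup>+y. (\<Sum>m\<le>N. \<Sum>n\<le>N. w n * ennreal (real m) *
        (q m (y, s) * potential (c n m * (T - s)) (\<lambda>z. u n (z, s)) y)) \<partial>lborel \<partial>lborel)"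
      unfolding B_def by (simp add: nn_integral_sum nn_integral_cmult)
    finally show ?thesis
      unfolding \<Omega>_def sum_distrib_left sum_distrib_right by (simp only: ac_simps)
  qed
  have late: "\<Lambda> n s y = 0 \<and> \<Omega> n s y = 0" if "T \<le> s" for n s y
    using that cpos by (simp add: \<Lambda>_def \<Omega>_def mult_nonneg_nonpos less_imp_le)
  have anti: "\<Lambda> m s y \<le> \<Lambda> n s y" "\<Omega> m s y \<le> \<Omega> n s y" if "n \<le> m" for n m s y
  proof -
    have "potential (c m k * (T - s)) \<phi> y \<le> potential (c n k * (T - s)) \<phi> y" for k and \<phi> :: "'a \<Rightarrow> ennreal"
    proof (cases "s < T")
      case True
      then show ?thesis using c_anti[OF that] by (intro potential_mono mult_right_mono) auto
    next
      case False
      then show ?thesis using cpos by (simp add: mult_nonneg_nonpos less_imp_le)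
    qed
    moreover have "c k m = c m k" "c k n = c n k" for k by (simp_all add: c_def)
    ultimately show "\<Lambda> m s y \<le> \<Lambda> n s y" "\<Omega> m s y \<le> \<Omega> n s y"
      unfolding \<Lambda>_def \<Omega>_def by (auto intro!: sum_mono mult_left_mono)
  qed
  have \<Lambda>_le: "AE y in lborel. \<forall>n. \<Lambda> n s y \<le> potential_bound T" if "0 < s" "s < T" for s
    unfolding AE_all_countable \<Lambda>_def c_def
    using mass_potential_le[OF that d_pos d_anti[OF le0]] by blast
  have \<Lambda>_le': "AE y in lborel. \<forall>n\<le>N. \<Lambda> n s y \<le> potential_bound T" if "0 < s" "s < T" for s
    by (rule eventually_mono[OF \<Lambda>_le[OF that]]) simp
  have \<A>_mono: "\<A> G \<le> \<A> L + potential_bound T * IS"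
  proof -
    have "(\<integral>\<^sup>+y. (\<Sum>n\<le>N. w n * \<Lambda> n s y * G n (y, s)) \<partial>lborel)
      \<le> (\<integral>\<^sup>+y. (\<Sum>n\<le>N. w n * \<Lambda> n s y * L n (y, s)) \<partial>lborel)
        + potential_bound T * (indicator {..<T} s * (\<integral>\<^sup>+y. excess_rate b N (y, s) \<partial>lborel))" for s
    proof (cases "0 < s \<and> s < T")
      case True
      have "AE y in lborel. (\<Sum>n\<le>N. w n * \<Lambda> n s y * G n (y, s))
        \<le> (\<Sum>n\<le>N. w n * \<Lambda> n s y * L n (y, s)) + potential_bound T * excess_rate b N (y, s)"
        using \<Lambda>_le[of s] True
      proof (auto elim!: eventually_mono)
        fix y assume "\<forall>n. \<Lambda> n s y \<le> potential_bound T"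
        then show "(\<Sum>n\<le>N. w n * \<Lambda> n s y * G n (y, s))
          \<le> (\<Sum>n\<le>N. w n * \<Lambda> n s y * L n (y, s)) + potential_bound T * excess_rate b N (y, s)"
          unfolding w_def by (intro power_gain_le_loss anti) auto
      qed
      then have "(\<integral>\<^sup>+y. (\<Sum>n\<le>N. w n * \<Lambda> n s y * G n (y, s)) \<partial>lborel)
        \<le> (\<integral>\<^sup>+y. (\<Sum>n\<le>N. w n * \<Lambda> n s y * L n (y, s)) + potential_bound T * excess_rate b N (y, s) \<partial>lborel)"
        by (rule nn_integral_mono_AE)
      then show ?thesis using True by (simp add: nn_integral_add nn_integral_cmult)
    next
      case False
      then show ?thesis by (cases "s \<le> 0") (auto simp: G_nonpos late)
    qed
    then have "\<A> G \<le> (\<integral>\<^sup>+s. (\<integral>\<^sup>+y. (\<Sum>n\<le>N. w n * \<Lambda> n s y * L n (y, s)) \<partial>lborel)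
        + potential_bound T * (indicator {..<T} s * (\<integral>\<^sup>+y. excess_rate b N (y, s) \<partial>lborel)) \<partial>lborel)"
      unfolding \<A>_eq[OF G_meas] by (intro nn_integral_mono)
    also have "\<dots> = \<A> L + potential_bound T * IS"
      unfolding \<A>_eq[OF L_meas] IS_def by (simp add: nn_integral_add nn_integral_cmult)
    finally show ?thesis .
  qed
  have \<B>_mono: "\<B> G \<le> \<B> L"
    unfolding \<B>_eq[OF G_meas] \<B>_eq[OF L_meas]
    by (intro nn_integral_mono gain_le_loss_anti anti)
  have fin: "\<A> L + \<B> L < \<infinity>"
  proof -
    have 1: "\<A> L < \<infinity>"
      unfolding \<A>_eq[OF L_meas]
      by (rule weighted_loss_finite[where C="potential_bound T" and T=T])
        (use \<Lambda>_le' potential_bound_finite late in \<open>simp_all add: w_def\<close>)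
    have "\<exists>B. \<forall>n. B n < \<infinity> \<and> (\<forall>t. AE x in lborel. u n (x, t) \<le> B n)"
      by (rule choice) (metis u_bounded)
    then obtain Bu where Bu: "\<And>n. Bu n < \<infinity>" "\<And>n t. AE x in lborel. u n (x, t) \<le> Bu n" by blast
    let ?C = "\<Sum>n\<le>N. w n * (ennreal ((d 0 + d 0) * T) * Bu n)"
    have C: "\<Omega> m s y \<le> ?C" if "0 < s" "s < T" for m s y
      unfolding \<Omega>_def
    proof (intro sum_mono mult_left_mono)
      fix n
      have "c n m * (T - s) \<le> (d 0 + d 0) * T"
        using that d_anti[of 0 n] d_anti[of 0 m] d_pos[of 0] by (intro mult_mono) (auto simp: c_def)
      then show "potential (c n m * (T - s)) (\<lambda>z. u n (z, s)) y \<le> ennreal ((d 0 + d 0) * T) * Bu n"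
        by (intro order_trans[OF potential_le_const[OF Bu(2)]] mult_right_mono ennreal_leI) auto
    qed simp
    have "\<B> L < \<infinity>"
      unfolding \<B>_eq[OF L_meas]
      by (rule weighted_loss_finite[where C="?C" and T=T])
        (use C late Bu(1) in \<open>auto simp: w_def ennreal_mult_less_top\<close>)
    with 1 show ?thesis by simp
  qed
  have "(\<A> L + \<B> L) + X \<le> (\<A> L + \<B> L) + (\<E> + potential_bound T * IS)"
  proof -
    have "(\<A> L + \<B> L) + X = \<E> + (\<A> G + \<B> G)" using total by (simp only: add.commute)
    also have "\<dots> \<le> \<E> + ((\<A> L + potential_bound T * IS) + \<B> L)"
      by (intro add_mono \<A>_mono \<B>_mono order_refl)
    also have "\<dots> = (\<A> L + \<B> L) + (\<E> + potential_bound T * IS)" by (simp only: ac_simps)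
    finally show ?thesis .
  qed
  then have "X \<le> \<E> + potential_bound T * IS"
    using fin by (auto simp: ennreal_add_left_cancel_le)
  then show ?thesis
    unfolding X_def \<E>_def E_def IS_def c_def w_def .
qed

lemma initial_interaction_le:
  assumes T: "0 < T"
  shows "(\<Sum>n\<le>N. \<Sum>m\<le>N. ennreal (real n ^ Suc b) * ennreal (real m) * (\<integral>\<^sup>+y. h n y * potential ((d n + d m) * T) (h m) y \<partial>lborel))
    \<le> (\<Sum>n. ennreal (real n ^ Suc b) * (\<integral>\<^sup>+y. h n y \<partial>lborel)) * potential_bound T"
proof -
  have "(\<Sum>m\<le>N. ennreal (real n ^ Suc b) * ennreal (real m) * (\<integral>\<^sup>+y. h n y * potential ((d n + d m) * T) (h m) y \<partial>lborel))
    \<le> ennreal (real n ^ Suc b) * (\<integral>\<^sup>+y. h n y \<partial>lborel) * potential_bound T" for n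
  proof -
    have "(\<Sum>m\<le>N. ennreal (real n ^ Suc b) * ennreal (real m) * (\<integral>\<^sup>+y. h n y * potential ((d n + d m) * T) (h m) y \<partial>lborel))
      = (\<integral>\<^sup>+y. ennreal (real n ^ Suc b) * h n y * (\<Sum>m\<le>N. ennreal (real m) * potential ((d n + d m) * T) (h m) y) \<partial>lborel)"
    proof -
      have "(\<Sum>m\<le>N. ennreal (real n ^ Suc b) * ennreal (real m) * (\<integral>\<^sup>+y. h n y * potential ((d n + d m) * T) (h m) y \<partial>lborel))
        = (\<integral>\<^sup>+y. (\<Sum>m\<le>N. ennreal (real n ^ Suc b) * ennreal (real m) * (h n y * potential ((d n + d m) * T) (h m) y)) \<partial>lborel)"
        by (simp add: nn_integral_sum nn_integral_cmult)
      then show ?thesis unfolding sum_distrib_left by (simp only: ac_simps)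
    qed
    also have "\<dots> \<le> (\<integral>\<^sup>+y. ennreal (real n ^ Suc b) * h n y * potential_bound T \<partial>lborel)"
    proof (intro nn_integral_mono mult_left_mono sum_potential_initial_le)
      fix m
      have "(d n + d m) * T \<le> (d 0 + d 0) * T"
        using T d_anti[of 0 m] d_anti[of 0 n] by (intro mult_right_mono add_mono) auto
      then show "(d n + d m) * T \<le> 2 * d 0 * T" by (simp add: algebra_simps)
    qed simp
    also have "\<dots> = ennreal (real n ^ Suc b) * (\<integral>\<^sup>+y. h n y \<partial>lborel) * potential_bound T"
      by (simp add: nn_integral_cmult nn_integral_multc)
    finally show ?thesis .
  qed
  then have "(\<Sum>n\<le>N. \<Sum>m\<le>N. ennreal (real n ^ Suc b) * ennreal (real m) * (\<integral>\<^sup>+y. h n y * potential ((d n + d m) * T) (h m) y \<partial>lborel))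
    \<le> (\<Sum>n\<le>N. ennreal (real n ^ Suc b) * (\<integral>\<^sup>+y. h n y \<partial>lborel)) * potential_bound T"
    unfolding sum_distrib_right by (rule sum_mono)
  also have "\<dots> \<le> (\<Sum>n. ennreal (real n ^ Suc b) * (\<integral>\<^sup>+y. h n y \<partial>lborel)) * potential_bound T"
    by (intro mult_right_mono sum_le_suminf) auto
  finally show ?thesis .
qed

text \<open>
  The absorption argument: beyond a finite range of masses, the coagulation rate times the excess is at
  most a multiple of \<open>\<delta>\<close> times the dissipation \<open>X N\<close>, and \<open>\<delta>\<close> is chosen such that the resulting cost is at most \<open>X N / 2\<close>. The
  truncation at \<open>N\<close> makes \<open>X N\<close> finite, so that it can be absorbed; the bound is uniform in \<open>N\<close>.
\<close>

lemma interaction_bound: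
  assumes T: "0 < T"
  shows "\<exists>C<\<infinity>. \<forall>N. integral_before T (excess_rate b N) \<le> C"
proof -
  define IS where "IS N = integral_before T (excess_rate b N)" for N
  define w where "w n m = real n ^ Suc b * real m" for n m :: nat
  have w0: "0 \<le> w n m" for n m by (simp add: w_def)
  define X where "X N = (\<Sum>n\<le>N. \<Sum>m\<le>N. ennreal (w n m) * (ennreal (d n + d m) * overlap T n m))" for N
  define Eb where "Eb = (\<Sum>n. ennreal (real n ^ Suc b) * (\<integral>\<^sup>+y. h n y \<partial>lborel)) * potential_bound T"
  have "Eb < \<infinity>"
    unfolding Eb_def using h_L1[of "Suc b"] potential_bound_finite[of T] by (simp add: ennreal_mult_less_top)
  then obtain e where e: "0 \<le> e" "Eb = ennreal e" by (cases Eb) auto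
  obtain K where K: "0 \<le> K" "potential_bound T = ennreal K"
    using potential_bound_finite[of T] by (cases "potential_bound T") auto
  define q :: real where "q = 2 * 2 ^ Suc b"
  have q: "0 < q" by (simp add: q_def)
  \<comment> \<open>with this choice \<open>K * (2 * \<delta> * q) \<le> 1 / 2\<close>; the summand \<open>1\<close> covers \<open>K = 0\<close>\<close>
  define \<delta> where "\<delta> = 1 / (4 * q * (K + 1))"
  have \<delta>: "0 < \<delta>" using q K by (simp add: \<delta>_def)
  obtain k where k: "\<And>n m. n + m > k \<Longrightarrow> al n m \<le> \<delta> * real (n + m) * (d n + d m)"
    using al_small[OF \<delta>] by blast
  obtain C0 where C0: "0 \<le> C0" "\<And>n m. al n m \<le> C0 * real (n + m)" using al_lin by blast
  define Ck where "Ck = C0 * (q * (2 * real k ^ Suc b * real k))"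
  have Ck: "0 \<le> Ck" using C0 q by (simp add: Ck_def)
  define M where "M = (\<Sum>n\<le>k. \<Sum>m\<le>k. ennreal Ck * overlap T n m)"
  have "M < \<infinity>" unfolding M_def using overlap_finite by (simp add: ennreal_mult_less_top)
  then obtain \<mu> where \<mu>: "0 \<le> \<mu>" "M = ennreal \<mu>" by (cases M) auto
  have ale: "al n m * excess b n m \<le> \<delta> * q * ((w n m + w m n) * (d n + d m)) + (if n \<le> k \<and> m \<le> k then Ck else 0)" for n m
  proof (cases "n + m > k")
    case True
    have "al n m * excess b n m \<le> \<delta> * real (n + m) * (d n + d m) * excess b n m"
      by (intro mult_right_mono k True excess_nonneg)
    also have "\<dots> = \<delta> * (d n + d m) * (real (n + m) * excess b n m)" by simp
    also have "\<dots> \<le> \<delta> * (d n + d m) * (q * (w n m + w m n))"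
      using \<delta> d_pos[of n] d_pos[of m] sum_mult_excess_le[of n m b]
      by (intro mult_left_mono) (auto simp: q_def w_def)
    finally show ?thesis using Ck by (simp add: algebra_simps)
  next
    case False
    then have nm: "n \<le> k" "m \<le> k" by auto
    have "al n m * excess b n m \<le> C0 * real (n + m) * excess b n m"
      by (intro mult_right_mono C0 excess_nonneg)
    also have "\<dots> = C0 * (real (n + m) * excess b n m)" by simp
    also have "\<dots> \<le> C0 * (q * (w n m + w m n))"
      using C0 sum_mult_excess_le[of n m b] by (intro mult_left_mono) (auto simp: q_def w_def)
    also have "\<dots> \<le> Ck"
    proof -
      have "w n m \<le> real k ^ Suc b * real k" "w m n \<le> real k ^ Suc b * real k"
        unfolding w_def using nm by (auto intro!: mult_mono power_mono simp del: power_Suc)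
      then have "w n m + w m n \<le> 2 * real k ^ Suc b * real k" by simp
      then show ?thesis
        using C0 q unfolding Ck_def by (intro mult_left_mono) auto
    qed
    finally have "al n m * excess b n m \<le> Ck" .
    moreover have "0 \<le> \<delta> * q * ((w n m + w m n) * (d n + d m))"
      using \<delta> q w0[of n m] w0[of m n] d_pos[of n] d_pos[of m] by simp
    ultimately show ?thesis using nm by simp
  qed
  have IS_le: "IS N \<le> ennreal (2 * \<delta> * q) * X N + M" for N
  proof -
    have "IS N \<le> (\<Sum>n\<le>N. \<Sum>m\<le>N. ennreal (\<delta> * q) * (ennreal (w n m) * (ennreal (d n + d m) * overlap T n m))
        + ennreal (\<delta> * q) * (ennreal (w m n) * (ennreal (d m + d n) * overlap T m n))
        + (if n \<le> k then if m \<le> k then ennreal Ck * overlap T n m else 0 else 0))"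
      unfolding IS_def nn_integral_excess_rate
    proof (intro sum_mono)
      fix n m
      have "ennreal (al n m * excess b n m)
        \<le> ennreal (\<delta> * q * ((w n m + w m n) * (d n + d m)) + (if n \<le> k \<and> m \<le> k then Ck else 0))"
        by (rule ennreal_leI) (rule ale)
      also have "\<dots> = ennreal (\<delta> * q) * ((ennreal (w n m) + ennreal (w m n)) * ennreal (d n + d m)) + ennreal (if n \<le> k \<and> m \<le> k then Ck else 0)"
        using \<delta> q w0[of n m] w0[of m n] d_pos[of n] d_pos[of m] Ck
        by (subst ennreal_plus) (auto simp: ennreal_mult ennreal_plus)
      finally have "ennreal (al n m * excess b n m) * overlap T n m
        \<le> (ennreal (\<delta> * q) * ((ennreal (w n m) + ennreal (w m n)) * ennreal (d n + d m))
            + ennreal (if n \<le> k \<and> m \<le> k then Ck else 0)) * overlap T n m"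
        by (rule mult_right_mono) simp
      also have "\<dots> = ennreal (\<delta> * q) * (ennreal (w n m) * (ennreal (d n + d m) * overlap T n m))
        + ennreal (\<delta> * q) * (ennreal (w m n) * (ennreal (d m + d n) * overlap T m n))
        + (if n \<le> k then if m \<le> k then ennreal Ck * overlap T n m else 0 else 0)"
        by (auto simp: distrib_left distrib_right overlap_sym[of T m n] add.commute[of "d m"] mult.assoc)
      finally show "ennreal (al n m * excess b n m) * overlap T n m \<le> \<dots>" .
    qed
    also have "\<dots> = ennreal (\<delta> * q) * X N + ennreal (\<delta> * q) * X N
      + (\<Sum>n\<le>N. \<Sum>m\<le>N. if n \<le> k then if m \<le> k then ennreal Ck * overlap T n m else 0 else 0)"
    proof -
      have "(\<Sum>n\<le>N. \<Sum>m\<le>N. ennreal (w m n) * (ennreal (d m + d n) * overlap T m n)) = X N"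
        unfolding X_def by (rule sum.swap)
      then show ?thesis
        unfolding sum.distrib sum_distrib_left[symmetric] by (simp add: X_def)
    qed
    also have "(\<Sum>n\<le>N. \<Sum>m\<le>N. if n \<le> k then if m \<le> k then ennreal Ck * overlap T n m else 0 else 0) \<le> M"
    proof -
      have "(\<Sum>n\<le>N. \<Sum>m\<le>N. if n \<le> k then if m \<le> k then ennreal Ck * overlap T n m else 0 else 0)
        = (\<Sum>n\<le>N. if n \<le> k then (\<Sum>m\<le>N. if m \<le> k then ennreal Ck * overlap T n m else 0) else 0)"
        by (intro sum.cong) auto
      also have "\<dots> \<le> (\<Sum>n\<le>N. if n \<le> k then (\<Sum>m\<le>k. ennreal Ck * overlap T n m) else 0)"
        by (intro sum_mono) (auto intro: sum_if_le)
      also have "\<dots> \<le> M" unfolding M_def by (rule sum_if_le)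
      finally show ?thesis .
    qed
    also have "ennreal (\<delta> * q) * X N + ennreal (\<delta> * q) * X N = ennreal (2 * \<delta> * q) * X N"
      using \<delta> q by (simp add: distrib_right[symmetric] ennreal_plus[symmetric] del: ennreal_plus)
    finally show ?thesis by simp
  qed
  have X_le: "X N \<le> ennreal (2 * (e + K * \<mu>))" for N
  proof -
    have "X N < \<infinity>" unfolding X_def using overlap_finite by (simp add: ennreal_mult_less_top)
    then obtain x where x: "0 \<le> x" "X N = ennreal x" by (cases "X N") auto
    have wsplit: "ennreal (real n ^ Suc b) * ennreal (real m) = ennreal (w n m)" for n m
      by (simp add: w_def ennreal_mult del: power_Suc)
    have "X N \<le> Eb + potential_bound T * IS N"
      unfolding X_def Eb_def IS_def wsplit[symmetric]
      by (rule order_trans[OF two_point_sum[OF T] add_right_mono[OF initial_interaction_le[OF T]]])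
    also have "\<dots> \<le> Eb + potential_bound T * (ennreal (2 * \<delta> * q) * X N + M)"
      by (intro add_left_mono mult_left_mono IS_le) simp
    also have "\<dots> = ennreal (e + K * (2 * \<delta> * q * x + \<mu>))"
      using e K x \<mu> \<delta> q by (simp add: ennreal_mult ennreal_plus)
    finally have "ennreal x \<le> ennreal (e + K * (2 * \<delta> * q * x + \<mu>))"
      unfolding x(2) .
    moreover have "0 \<le> e + K * (2 * \<delta> * q * x + \<mu>)"
      using x e K \<mu> \<delta> q by simp
    ultimately have "x \<le> e + K * (2 * \<delta> * q * x + \<mu>)"
      by (simp only: ennreal_le_iff)
    moreover have "K * (2 * \<delta> * q * x) \<le> x / 2"
    proof -
      have "K * (2 * \<delta> * q) \<le> 1 / 2"
        using K q by (simp add: \<delta>_def divide_le_eq)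
      then have "K * (2 * \<delta> * q) * x \<le> 1 / 2 * x"
        using x by (intro mult_right_mono) auto
      then show ?thesis by (simp add: mult.assoc)
    qed
    ultimately have "x \<le> 2 * (e + K * \<mu>)" by (simp add: distrib_left)
    then show ?thesis using x by (simp add: ennreal_leI)
  qed
  let ?C = "ennreal (2 * \<delta> * q) * ennreal (2 * (e + K * \<mu>)) + M"
  have "IS N \<le> ?C" for N
    by (rule order_trans[OF IS_le]) (intro add_right_mono mult_left_mono X_le, simp)
  moreover have "?C < \<infinity>" using \<open>M < \<infinity>\<close> by (simp add: ennreal_mult_less_top)
  ultimately show ?thesis unfolding IS_def by blast
qed

lemma moment_L1_bound:
  assumes T: "0 < T"
  shows "\<exists>C<\<infinity>. \<forall>N. \<forall>t<T. (\<Sum>n\<le>N. ennreal (real n ^ Suc b) * (\<integral>\<^sup>+x. u n (x, t) \<partial>lborel)) \<le> C"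
proof -
  obtain C where C: "C < \<infinity>" "\<And>N. integral_before T (excess_rate b N) \<le> C"
    using interaction_bound[OF T, of b] by blast
  define w where "w n = ennreal (real n ^ Suc b)" for n
  let ?h = "\<Sum>n. w n * (\<integral>\<^sup>+x. h n x \<partial>lborel)"
  have "(\<Sum>n\<le>N. w n * (\<integral>\<^sup>+x. u n (x, t) \<partial>lborel)) \<le> ?h + C" if t: "t < T" for N t
  proof (cases "0 < t")
    case True
    define I where "I q = (\<Sum>n\<le>N. w n * integral_before t (q n))"
      for q :: "nat \<Rightarrow> 'a \<times> real \<Rightarrow> ennreal"
    have I_eq: "I q = (\<integral>\<^sup>+s. indicator {..<t} s * (\<integral>\<^sup>+y. (\<Sum>n\<le>N. w n * 1 * q n (y, s)) \<partial>lborel) \<partial>lborel)"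
      if [measurable]: "\<And>n. q n \<in> borel_measurable (borel \<Otimes>\<^sub>M borel)" for q
    proof -
      have "(\<integral>\<^sup>+s. indicator {..<t} s * (\<integral>\<^sup>+y. (\<Sum>n\<le>N. w n * 1 * q n (y, s)) \<partial>lborel) \<partial>lborel)
        = (\<integral>\<^sup>+s. (\<Sum>n\<le>N. w n * (indicator {..<t} s * (\<integral>\<^sup>+y. q n (y, s) \<partial>lborel))) \<partial>lborel)"
        by (simp add: nn_integral_sum nn_integral_cmult sum_distrib_left ac_simps)
      also have "\<dots> = I q"
        unfolding I_def by (simp add: nn_integral_sum nn_integral_cmult)
      finally show ?thesis ..
    qed
    have "I G \<le> I L + integral_before t (excess_rate b N)"
    proof -
      have "I G \<le> (\<integral>\<^sup>+s. indicator {..<t} s * (\<integral>\<^sup>+y. (\<Sum>n\<le>N. w n * 1 * L n (y, s)) + 1 * excess_rate b N (y, s) \<partial>lborel) \<partial>lborel)"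
        unfolding I_eq[OF G_meas] w_def by (intro nn_integral_mono mult_left_mono power_gain_le_loss) auto
      also have "\<dots> = I L + integral_before t (excess_rate b N)"
        unfolding I_eq[OF L_meas] by (simp add: nn_integral_add distrib_left)
      finally show ?thesis .
    qed
    also have "integral_before t (excess_rate b N)
      \<le> integral_before T (excess_rate b N)"
      using t by (intro nn_integral_mono mult_right_mono) (auto simp: indicator_def)
    also note C(2)[of N]
    finally have GL: "I G \<le> I L + C" by simp
    have bal: "(\<Sum>n\<le>N. w n * (\<integral>\<^sup>+x. u n (x, t) \<partial>lborel)) + I L = (\<Sum>n\<le>N. w n * (\<integral>\<^sup>+x. h n x \<partial>lborel)) + I G"
      unfolding I_def by (simp only: sum.distrib[symmetric] distrib_left[symmetric] mass_balance[OF True])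
    have "(\<Sum>n\<le>N. w n * (\<integral>\<^sup>+x. h n x \<partial>lborel)) + I G \<le> ?h + (I L + C)"
      by (intro add_mono GL sum_le_suminf) auto
    then have "I L + (\<Sum>n\<le>N. w n * (\<integral>\<^sup>+x. u n (x, t) \<partial>lborel)) \<le> I L + (?h + C)"
      unfolding bal[symmetric] by (simp only: ac_simps)
    moreover have "I L < \<infinity>"
      unfolding I_def w_def using loss_L1[of t] by (simp add: ennreal_mult_less_top)
    ultimately show ?thesis by (auto simp: ennreal_add_left_cancel_le)
  qed (simp add: u_nonpos)
  moreover have "?h + C < \<infinity>" using h_L1[of "Suc b"] C(1) by (simp add: w_def)
  ultimately show ?thesis unfolding w_def by blast
qed

section \<open>Decay of the suprema in the mass\<close>

lemma G_0: "G 0 p = 0"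
  by (simp add: gain_def u_0)

lemma gain_sup_bound:
  obtains C p where "0 \<le> C" "\<And>n s. AE y in lborel. G n (y, s) \<le> ennreal (C * real (Suc n) ^ p)"
proof -
  obtain U b where U: "0 \<le> U" "\<And>n t. AE x in lborel. u n (x, t) \<le> ennreal (U * real (Suc n) ^ b)"
    using u_poly_bound by blast
  obtain C0 where C0: "0 \<le> C0" "\<And>n m. al n m \<le> C0 * real (n + m)" using al_lin by blast
  let ?C = "C0 * U * U"
  have "AE y in lborel. G n (y, s) \<le> ennreal (?C * real (Suc n) ^ (2 * b + 2))" for n s
  proof -
    have "AE y in lborel. \<forall>m. u m (y, s) \<le> ennreal (U * real (Suc m) ^ b)"
      unfolding AE_all_countable using U by blast
    then show ?thesis
    proof eventually_elim
      case (elim y)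
      have "G n (y, s) \<le> (\<Sum>m\<le>n. ennreal (C0 * real (Suc n)) * ennreal (U * real (Suc n) ^ b) * ennreal (U * real (Suc n) ^ b))"
        unfolding gain_def
      proof (intro sum_mono mult_mono)
        fix m assume "m \<in> {..n}"
        then have m: "m \<le> n" by simp
        show "ennreal (al m (n - m)) \<le> ennreal (C0 * real (Suc n))"
        proof (rule ennreal_leI)
          have "C0 * real (m + (n - m)) \<le> C0 * real (Suc n)"
            using m C0 by (intro mult_left_mono) auto
          then show "al m (n - m) \<le> C0 * real (Suc n)" using C0(2)[of m "n - m"] by simp
        qed
        have mono: "ennreal (U * real (Suc l) ^ b) \<le> ennreal (U * real (Suc n) ^ b)" if "l \<le> n" for l
          using that U by (intro ennreal_leI mult_left_mono power_mono) auto
        show "u m (y, s) \<le> ennreal (U * real (Suc n) ^ b)" "u (n - m) (y, s) \<le> ennreal (U * real (Suc n) ^ b)"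
          using order_trans[OF elim[rule_format, of m] mono[of m]]
            order_trans[OF elim[rule_format, of "n - m"] mono[of "n - m"]] m by simp_all
      qed auto
      also have "\<dots> = ennreal (real (Suc n) * (C0 * real (Suc n) * (U * real (Suc n) ^ b) * (U * real (Suc n) ^ b)))"
        using C0 U by (simp add: ennreal_mult ennreal_of_nat_eq_real_of_nat del: of_nat_Suc)
      also have "real (Suc n) * (C0 * real (Suc n) * (U * real (Suc n) ^ b) * (U * real (Suc n) ^ b)) = ?C * real (Suc n) ^ (2 * b + 2)"
        by (simp add: power_add mult_2 power2_eq_square del: of_nat_Suc)
      finally show ?case .
    qed
  qed
  moreover have "0 \<le> ?C" using C0 U by simp
  ultimately show ?thesis using that by blast
qed

text \<open>
  In every merging pair with total mass \<open>n\<close>, one mass is at least \<open>n / 2\<close>; the other density is bounded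
  by a power of \<open>n\<close>. So any power of \<open>n\<close> is absorbed by a higher moment.
\<close>

lemma gain_decay:
  assumes T: "0 < T"
  shows "\<exists>C<\<infinity>. \<forall>n. ennreal (real n ^ k) * integral_before T (G n) \<le> C"
proof -
  obtain U b where U: "0 \<le> U" "\<And>n t. AE x in lborel. u n (x, t) \<le> ennreal (U * real (Suc n) ^ b)"
    using u_poly_bound by blast
  obtain C0 where C0: "0 \<le> C0" "\<And>n m. al n m \<le> C0 * real (n + m)" using al_lin by blast
  define j where "j = k + b"
  obtain M where M: "M < \<infinity>" "\<And>N t. t < T \<Longrightarrow> (\<Sum>n\<le>N. ennreal (real n ^ Suc j) * (\<integral>\<^sup>+x. u n (x, t) \<partial>lborel)) \<le> M"
    using moment_L1_bound[OF T, of j] by blast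
  define C1 where "C1 = C0 * U * 3 ^ Suc j"
  have C1: "0 \<le> C1" using C0 U by (simp add: C1_def)
  let ?C = "ennreal C1 * (2 * M)"
  have pw: "AE y in lborel. ennreal (real n ^ k) * G n (y, s) \<le> ennreal C1 * (2 * (\<Sum>m\<le>n. ennreal (real m ^ Suc j) * u m (y, s)))" for n s
  proof -
    have "AE y in lborel. \<forall>m. u m (y, s) \<le> ennreal (U * real (Suc m) ^ b)"
      unfolding AE_all_countable using U by blast
    then show ?thesis
    proof eventually_elim
      case (elim y)
      have big: "ennreal (real n ^ k) * (ennreal (al m l) * u m (y, s) * u l (y, s))
          \<le> ennreal C1 * (ennreal (real m ^ Suc j) * u m (y, s))" if "m + l = n" "l \<le> m" "0 < m" for m l
      proof -
        have "real n ^ k * al m l * (U * real (Suc l) ^ b) \<le> real (3 * m) ^ k * (C0 * real (3 * m)) * (U * real (3 * m) ^ b)"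
          using that C0 U al_nonneg
        proof (intro mult_mono power_mono)
          show "al m l \<le> C0 * real (3 * m)"
            using that C0(1) by (intro order_trans[OF C0(2)[of m l]] mult_left_mono) auto
        qed auto
        also have "\<dots> = C1 * real m ^ Suc j"
          by (simp add: C1_def j_def power_add power_mult_distrib)
        finally have r: "real n ^ k * al m l * (U * real (Suc l) ^ b) \<le> C1 * real m ^ Suc j" .
        have "ennreal (real n ^ k) * (ennreal (al m l) * u m (y, s) * u l (y, s))
          \<le> ennreal (real n ^ k) * (ennreal (al m l) * u m (y, s) * ennreal (U * real (Suc l) ^ b))"
          using elim by (intro mult_left_mono) auto
        also have "\<dots> = ennreal (real n ^ k * al m l * (U * real (Suc l) ^ b)) * u m (y, s)"
          using U al_nonneg by (simp add: ennreal_mult ac_simps del: of_nat_Suc)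
        also have "\<dots> \<le> ennreal (C1 * real m ^ Suc j) * u m (y, s)"
          by (intro mult_right_mono ennreal_leI r) simp
        also have "\<dots> = ennreal C1 * (ennreal (real m ^ Suc j) * u m (y, s))"
          using C1 by (simp add: ennreal_mult mult.assoc del: power_Suc)
        finally show ?thesis .
      qed
      have each: "ennreal (real n ^ k) * (ennreal (al m (n - m)) * u m (y, s) * u (n - m) (y, s))
          \<le> ennreal C1 * (ennreal (real m ^ Suc j) * u m (y, s)) + ennreal C1 * (ennreal (real (n - m) ^ Suc j) * u (n - m) (y, s))"
        if "m \<le> n" for m
      proof (cases "m = 0 \<or> n - m = 0")
        case True
        then show ?thesis by (auto simp: u_0)
      next
        case False
        show ?thesis
        proof (cases "n - m \<le> m")
          case True
          then show ?thesis using big[of m "n - m"] that False by (auto intro: order_trans)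
        next
          case 2: False
          have "ennreal (real n ^ k) * (ennreal (al m (n - m)) * u m (y, s) * u (n - m) (y, s))
            = ennreal (real n ^ k) * (ennreal (al (n - m) m) * u (n - m) (y, s) * u m (y, s))"
            by (simp add: al_sym[of m] ac_simps)
          also have "\<dots> \<le> ennreal C1 * (ennreal (real (n - m) ^ Suc j) * u (n - m) (y, s))"
            using that False 2 by (intro big) auto
          finally show ?thesis by (rule order_trans) simp
        qed
      qed
      have "ennreal (real n ^ k) * G n (y, s)
        \<le> (\<Sum>m\<le>n. ennreal C1 * (ennreal (real m ^ Suc j) * u m (y, s)) + ennreal C1 * (ennreal (real (n - m) ^ Suc j) * u (n - m) (y, s)))"
        unfolding gain_def sum_distrib_left by (intro sum_mono each) simp
      also have "\<dots> = ennreal C1 * (2 * (\<Sum>m\<le>n. ennreal (real m ^ Suc j) * u m (y, s)))"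
      proof -
        have "(\<Sum>m\<le>n. ennreal C1 * (ennreal (real (n - m) ^ Suc j) * u (n - m) (y, s)))
          = (\<Sum>m\<le>n. ennreal C1 * (ennreal (real m ^ Suc j) * u m (y, s)))"
          by (rule sum.reindex_bij_witness[of _ "\<lambda>m. n - m" "\<lambda>m. n - m"]) auto
        then show ?thesis
          unfolding sum.distrib sum_distrib_left[symmetric] by (simp add: mult_2 distrib_left)
      qed
      finally show ?case .
    qed
  qed
  have "ennreal (real n ^ k) * integral_before T (G n) \<le> ?C * ennreal T" for n
  proof -
    have "ennreal (real n ^ k) * integral_before T (G n)
      = (\<integral>\<^sup>+s. indicator {..<T} s * (\<integral>\<^sup>+y. ennreal (real n ^ k) * G n (y, s) \<partial>lborel) \<partial>lborel)"
      by (simp add: nn_integral_cmult[symmetric] ac_simps)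
    also have "\<dots> \<le> (\<integral>\<^sup>+s. ?C * indicator {0<..<T} s \<partial>lborel)"
    proof (rule nn_integral_mono)
      fix s
      show "indicator {..<T} s * (\<integral>\<^sup>+y. ennreal (real n ^ k) * G n (y, s) \<partial>lborel) \<le> ?C * indicator {0<..<T} s"
      proof (cases "0 < s \<and> s < T")
        case True
        have "(\<integral>\<^sup>+y. ennreal (real n ^ k) * G n (y, s) \<partial>lborel)
          \<le> (\<integral>\<^sup>+y. ennreal C1 * (2 * (\<Sum>m\<le>n. ennreal (real m ^ Suc j) * u m (y, s))) \<partial>lborel)"
          by (rule nn_integral_mono_AE) (rule pw)
        also have "\<dots> = ennreal C1 * (2 * (\<Sum>m\<le>n. ennreal (real m ^ Suc j) * (\<integral>\<^sup>+y. u m (y, s) \<partial>lborel)))"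
          by (simp add: nn_integral_cmult nn_integral_sum)
        also have "\<dots> \<le> ?C"
          using True by (intro mult_left_mono M) auto
        finally show ?thesis using True by simp
      next
        case False
        then show ?thesis by (cases "s \<le> 0") (auto simp: G_nonpos)
      qed
    qed
    also have "\<dots> = ?C * ennreal T"
      using T by (simp add: nn_integral_cmult_indicator)
    finally show ?thesis .
  qed
  moreover have "?C * ennreal T < \<infinity>" using M by (simp add: ennreal_mult_less_top)
  ultimately show ?thesis by blast
qed

text \<open>
  The gain term has a supremum of order \<open>n\<^sup>p\<close> and an integral that decays faster than any power. The time
  \<open>\<epsilon> = (n + 1)\<^bsup>-(p + k + 2)\<^esup>\<close> makes the recent part small, and it costs only the power \<open>r * D\<close> of \<open>n\<close>
  in the earlier part.
\<close>

lemma u_decay: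
  assumes T: "0 < T"
  obtains C where "0 \<le> C" "\<And>n t. t < T \<Longrightarrow> AE x in lborel.
    ennreal (real n ^ k) * u n (x, t) \<le> ennreal (real n ^ k) * H n + ennreal (C / real (Suc n) ^ 2)"
proof -
  obtain C2 p where C2: "0 \<le> C2" "\<And>n s. AE y in lborel. G n (y, s) \<le> ennreal (C2 * real (Suc n) ^ p)"
    using gain_sup_bound by blast
  obtain C b0 where C: "1 \<le> C" and Cb: "\<And>n. 1 \<le> d n * (C * real (Suc n) ^ b0)"
    using d_low by blast
  \<comment> \<open>\<open>C * N ^ r\<close> bounds \<open>1 / (d n * \<epsilon>)\<close>, and the exponent \<open>k'\<close> absorbs its \<open>D\<close>-th power\<close>
  define r where "r = b0 + (p + k + 2)"
  define k' where "k' = r * DIM('a) + k + 2"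
  define g where "g n = integral_before T (G n)" for n
  obtain C3' where C3': "C3' < \<infinity>" "\<And>n. ennreal (real n ^ k') * g n \<le> C3'"
    using gain_decay[OF T, of k'] unfolding g_def by blast
  obtain C3 where C3: "0 \<le> C3" "\<And>n. ennreal (real n ^ k') * g n \<le> ennreal C3"
    using C3' by (cases C3') auto
  define C4 where "C4 = C2 + C ^ DIM('a) * 2 ^ k' * C3"
  have C4: "0 \<le> C4" using C2 C C3 by (simp add: C4_def)
  have key: "ennreal (real n ^ k) * duhamel (d n) (G n) x t \<le> ennreal (C4 / real (Suc n) ^ 2)" if t: "t < T" for n t x
  proof (cases "n = 0")
    case True
    then show ?thesis by (simp add: duhamel_def G_0)
  next
    case False
    define N where "N = real (Suc n)"
    have N: "1 \<le> N" "real n \<le> N" "N \<le> 2 * real n" using False by (auto simp: N_def)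
    define \<epsilon> where "\<epsilon> = 1 / N ^ (p + k + 2)"
    have \<epsilon>: "0 < \<epsilon>" using N by (simp add: \<epsilon>_def)
    let ?R = "(4 * pi * (d n * \<epsilon>)) powr (- real DIM('a) / 2)"
    have "g n < \<infinity>" unfolding g_def by (rule gain_L1)
    then obtain \<gamma> where \<gamma>: "0 \<le> \<gamma>" "g n = ennreal \<gamma>" by (cases "g n") auto
    have "duhamel (d n) (G n) x t \<le> ennreal \<epsilon> * ennreal (C2 * N ^ p) + ennreal ?R * integral_before t (G n)"
      unfolding N_def by (rule duhamel_split) (use \<epsilon> d_pos C2 in auto)
    also have "\<dots> \<le> ennreal \<epsilon> * ennreal (C2 * N ^ p) + ennreal ?R * g n"
      unfolding g_def using t by (intro add_left_mono mult_left_mono nn_integral_mono mult_right_mono) (auto simp: indicator_def)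
    also have "\<dots> = ennreal (\<epsilon> * (C2 * N ^ p) + ?R * \<gamma>)"
      using \<epsilon> C2 N \<gamma> by (simp add: ennreal_mult ennreal_plus)
    finally have "ennreal (real n ^ k) * duhamel (d n) (G n) x t \<le> ennreal (real n ^ k) * ennreal (\<epsilon> * (C2 * N ^ p) + ?R * \<gamma>)"
      by (rule mult_left_mono) simp
    also have "\<dots> = ennreal (real n ^ k * (\<epsilon> * (C2 * N ^ p) + ?R * \<gamma>))"
      using \<epsilon> C2 N \<gamma> by (subst ennreal_mult) auto
    also have "\<dots> \<le> ennreal (C4 / N ^ 2)"
    proof (rule ennreal_leI)
      have "real n ^ k * (\<epsilon> * (C2 * N ^ p)) \<le> N ^ k * (\<epsilon> * (C2 * N ^ p))"
        using N \<epsilon> C2 by (intro mult_right_mono power_mono) auto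
      also have "\<dots> = C2 / N ^ 2"
        using N by (simp add: \<epsilon>_def power_add power2_eq_square field_simps)
      finally have 1: "real n ^ k * (\<epsilon> * (C2 * N ^ p)) \<le> C2 / N ^ 2" .
      have R: "?R \<le> (C * N ^ r) ^ DIM('a)"
      proof -
        have y: "1 \<le> C * N ^ r" using C N mult_mono[of 1 C 1 "N ^ r"] by simp
        have "1 \<le> (d n * (C * N ^ b0)) * 1" using Cb[of n] by (simp add: N_def)
        also have "\<dots> = (d n * \<epsilon>) * (C * N ^ r)" using N by (simp add: \<epsilon>_def r_def power_add)
        finally have d1: "1 / (C * N ^ r) \<le> d n * \<epsilon>"
          using y by (simp add: divide_le_eq)
        have "4 * pi \<ge> 1" using pi_gt3 by simp
        then have "1 * (d n * \<epsilon>) \<le> 4 * pi * (d n * \<epsilon>)"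
          using d_pos[of n] \<epsilon> by (intro mult_right_mono) auto
        then have d2: "1 / (C * N ^ r) \<le> 4 * pi * (d n * \<epsilon>)" using d1 by simp
        have "?R \<le> (1 / (C * N ^ r)) powr (- real DIM('a) / 2)"
          using y d2 by (intro powr_mono2') auto
        also have "\<dots> = (C * N ^ r) powr (real DIM('a) / 2)"
          using y by (simp add: powr_divide powr_minus)
        also have "\<dots> \<le> (C * N ^ r) powr real DIM('a)"
          using y by (intro powr_mono) auto
        also have "\<dots> = (C * N ^ r) ^ DIM('a)" using y by (simp add: powr_realpow)
        finally show ?thesis .
      qed
      have "ennreal (real n ^ k' * \<gamma>) \<le> ennreal C3"
        using C3(2)[of n] \<gamma> by (simp add: ennreal_mult)
      then have \<gamma>3: "real n ^ k' * \<gamma> \<le> C3" using C3(1) by (simp only: ennreal_le_iff)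
      have "N ^ 2 * (real n ^ k * (?R * \<gamma>)) \<le> N ^ 2 * (N ^ k * ((C * N ^ r) ^ DIM('a) * \<gamma>))"
        using N \<gamma> R C by (intro mult_left_mono mult_mono power_mono) auto
      also have "\<dots> = C ^ DIM('a) * (N ^ k' * \<gamma>)"
        by (simp add: k'_def power_add power_mult_distrib power_mult power2_eq_square ac_simps)
      also have "\<dots> \<le> C ^ DIM('a) * ((2 * real n) ^ k' * \<gamma>)"
        using N C \<gamma> by (intro mult_left_mono mult_right_mono power_mono) auto
      also have "\<dots> = C ^ DIM('a) * 2 ^ k' * (real n ^ k' * \<gamma>)"
        by (simp add: power_mult_distrib)
      also have "\<dots> \<le> C ^ DIM('a) * 2 ^ k' * C3"
        using C \<gamma>3 by (intro mult_left_mono) auto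
      finally have 2: "real n ^ k * (?R * \<gamma>) \<le> C ^ DIM('a) * 2 ^ k' * C3 / N ^ 2"
        using N by (simp add: le_divide_eq mult.commute)
      from 1 2 show "real n ^ k * (\<epsilon> * (C2 * N ^ p) + ?R * \<gamma>) \<le> C4 / N ^ 2"
        by (simp add: C4_def distrib_left add_divide_distrib)
    qed
    finally show ?thesis by (simp add: N_def)
  qed
  have "AE x in lborel. ennreal (real n ^ k) * u n (x, t) \<le> ennreal (real n ^ k) * H n + ennreal (C4 / real (Suc n) ^ 2)"
    if t: "t < T" for n t
  proof (cases "0 < t")
    case True
    show ?thesis
      using mild[OF True, of n]
    proof eventually_elim
      case (elim x)
      have "u n (x, t) \<le> u n (x, t) + duhamel (d n) (L n) x t" by simp
      also have "\<dots> \<le> H n + duhamel (d n) (G n) x t"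
        unfolding elim by (intro add_right_mono heat_le_const h_le)
      finally have "ennreal (real n ^ k) * u n (x, t) \<le> ennreal (real n ^ k) * (H n + duhamel (d n) (G n) x t)"
        by (rule mult_left_mono) simp
      then show ?case
        unfolding distrib_left by (rule order_trans) (intro add_left_mono key t)
    qed
  qed (simp add: u_nonpos)
  then show ?thesis using that C4 by blast
qed

lemma moment_sup_bound:
  assumes T: "0 < T"
  obtains C where "C < \<infinity>" "\<And>t. t < T \<Longrightarrow> AE x in lborel. (\<Sum>n. ennreal (real n ^ k) * u n (x, t)) \<le> C"
proof -
  obtain C where C: "0 \<le> C" "\<And>n t. t < T \<Longrightarrow> AE x in lborel.
    ennreal (real n ^ k) * u n (x, t) \<le> ennreal (real n ^ k) * H n + ennreal (C / real (Suc n) ^ 2)"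
    using u_decay[OF T, of k] by blast
  let ?M = "(\<Sum>n. ennreal (real n ^ k) * H n) + (\<Sum>n. ennreal (C / real (Suc n) ^ 2))"
  have "summable (\<lambda>n. inverse (real (Suc n) ^ 2))"
    using inverse_power_summable[of 2, where 'a=real] by (subst summable_Suc_iff) (simp add: )
  then have "summable (\<lambda>n. C / real (Suc n) ^ 2)"
    using summable_mult[of "\<lambda>n. inverse (real (Suc n) ^ 2)" C] by (simp only: divide_inverse)
  then have "(\<Sum>n. ennreal (C / real (Suc n) ^ 2)) \<noteq> top"
    using C by (intro ennreal_suminf_neq_top) auto
  then have "?M < \<infinity>" using H_sum[of k] by (simp add: less_top)
  moreover have "AE x in lborel. (\<Sum>n. ennreal (real n ^ k) * u n (x, t)) \<le> ?M" if t: "t < T" for t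
  proof -
    have "AE x in lborel. \<forall>n. ennreal (real n ^ k) * u n (x, t) \<le> ennreal (real n ^ k) * H n + ennreal (C / real (Suc n) ^ 2)"
      unfolding AE_all_countable using C(2)[OF t] by blast
    then show ?thesis
    proof eventually_elim
      case (elim x)
      have "(\<Sum>n. ennreal (real n ^ k) * u n (x, t)) \<le> (\<Sum>n. ennreal (real n ^ k) * H n + ennreal (C / real (Suc n) ^ 2))"
        using elim by (intro suminf_le) auto
      also have "\<dots> = ?M" by (rule suminf_add[symmetric]) auto
      finally show ?case .
    qed
  qed
  ultimately show ?thesis using that by blast
qed

lemma moment_integral_finite:
  assumes T: "0 < T"
  shows "(\<integral>\<^sup>+t. indicator {..<T} t * (\<integral>\<^sup>+x. (\<Sum>n. ennreal (real n ^ Suc b) * u n (x, t)) \<partial>lborel) \<partial>lborel) < \<infinity>"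
proof -
  obtain C where C: "C < \<infinity>" "\<And>N t. t < T \<Longrightarrow> (\<Sum>n\<le>N. ennreal (real n ^ Suc b) * (\<integral>\<^sup>+x. u n (x, t) \<partial>lborel)) \<le> C"
    using moment_L1_bound[OF T, of b] by blast
  have "(\<integral>\<^sup>+t. indicator {..<T} t * (\<integral>\<^sup>+x. (\<Sum>n. ennreal (real n ^ Suc b) * u n (x, t)) \<partial>lborel) \<partial>lborel)
    \<le> (\<integral>\<^sup>+t. C * indicator {0<..<T} t \<partial>lborel)"
  proof (rule nn_integral_mono)
    fix t
    show "indicator {..<T} t * (\<integral>\<^sup>+x. (\<Sum>n. ennreal (real n ^ Suc b) * u n (x, t)) \<partial>lborel) \<le> C * indicator {0<..<T} t"
    proof (cases "0 < t \<and> t < T")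
      case True
      have "(\<integral>\<^sup>+x. (\<Sum>n. ennreal (real n ^ Suc b) * u n (x, t)) \<partial>lborel)
        = (\<Sum>n. ennreal (real n ^ Suc b) * (\<integral>\<^sup>+x. u n (x, t) \<partial>lborel))"
        by (simp add: nn_integral_suminf nn_integral_cmult)
      also have "\<dots> \<le> C"
        unfolding suminf_eq_SUP
      proof (rule SUP_least)
        fix N
        have "(\<Sum>n<N. ennreal (real n ^ Suc b) * (\<integral>\<^sup>+x. u n (x, t) \<partial>lborel))
          \<le> (\<Sum>n\<le>N. ennreal (real n ^ Suc b) * (\<integral>\<^sup>+x. u n (x, t) \<partial>lborel))"
          by (rule sum_mono2) auto
        also have "\<dots> \<le> C" using True by (intro C(2)) simp
        finally show "(\<Sum>n<N. ennreal (real n ^ Suc b) * (\<integral>\<^sup>+x. u n (x, t) \<partial>lborel)) \<le> C" .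
      qed
      finally show ?thesis using True by simp
    next
      case False
      then show ?thesis by (cases "t \<le> 0") (auto simp: u_nonpos)
    qed
  qed
  also have "\<dots> < \<infinity>" using C T by (simp add: nn_integral_cmult_indicator ennreal_mult_less_top)
  finally show ?thesis .
qed

end

section \<open>From weak solutions to the nonnegative Duhamel identity\<close>

lemma heat_kernel_measurable[measurable (raw)]:
  assumes [measurable]: "f \<in> borel_measurable M" "g \<in> borel_measurable M"
  shows "(\<lambda>p. heat_kernel (f p) (g p)) \<in> borel_measurable M"
  unfolding heat_kernel_def by measurable

lemma heat_semigroup_eq_heat:
  assumes [measurable]: "v \<in> borel_measurable borel" and v: "\<And>y. 0 \<le> v y" and "0 < c * t"
  shows "heat_semigroup c t v x = enn2real (heat (c * t) (\<lambda>y. ennreal (v y)) x)"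
proof -
  have "heat_semigroup c t v x = (LINT y|lborel. heat_kernel (c * t) (x - y) * v y)"
    using assms by (simp add: heat_semigroup_def)
  also have "\<dots> = enn2real (\<integral>\<^sup>+y. ennreal (heat_kernel (c * t) (x - y) * v y) \<partial>lborel)"
    by (rule integral_eq_nn_integral) (auto simp: heat_kernel_nonneg v)
  also have "\<dots> = enn2real (heat (c * t) (\<lambda>y. ennreal (v y)) x)"
    using assms by (simp add: heat_def gauss_def ennreal_mult' heat_kernel_nonneg)
  finally show ?thesis .
qed

text \<open>
  Finiteness almost everywhere ensures that \<open>enn2real\<close> loses nothing, so the signed integral is the
  difference of two nonnegative ones.
\<close>

lemma lint_diff_enn2real:
  assumes [measurable]: "A \<in> borel_measurable M" "B \<in> borel_measurable M" "k \<in> borel_measurable M"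
    and k: "\<And>y. 0 \<le> k y"
    and A: "(\<integral>\<^sup>+y. ennreal (k y) * A y \<partial>M) < \<infinity>" and B: "(\<integral>\<^sup>+y. ennreal (k y) * B y \<partial>M) < \<infinity>"
    and fin: "AE y in M. A y < \<infinity>" "AE y in M. B y < \<infinity>"
  shows "(LINT y|M. k y * (enn2real (A y) - enn2real (B y)))
    = enn2real (\<integral>\<^sup>+y. ennreal (k y) * A y \<partial>M) - enn2real (\<integral>\<^sup>+y. ennreal (k y) * B y \<partial>M)"
proof -
  have *: "integrable M (\<lambda>y. k y * enn2real (C y)) \<and>
      (LINT y|M. k y * enn2real (C y)) = enn2real (\<integral>\<^sup>+y. ennreal (k y) * C y \<partial>M)"
    if [measurable]: "C \<in> borel_measurable M" and C: "(\<integral>\<^sup>+y. ennreal (k y) * C y \<partial>M) < \<infinity>" "AE y in M. C y < \<infinity>" for C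
  proof -
    have eq: "(\<integral>\<^sup>+y. ennreal (k y * enn2real (C y)) \<partial>M) = (\<integral>\<^sup>+y. ennreal (k y) * C y \<partial>M)"
      using C(2) k by (intro nn_integral_cong_AE) (auto elim!: eventually_mono simp: ennreal_mult less_top)
    have "integrable M (\<lambda>y. k y * enn2real (C y))"
      using C(1) k by (intro integrableI_nonneg) (auto simp: eq)
    moreover have "(LINT y|M. k y * enn2real (C y)) = enn2real (\<integral>\<^sup>+y. ennreal (k y * enn2real (C y)) \<partial>M)"
      using k by (intro integral_eq_nn_integral) auto
    ultimately show ?thesis by (simp add: eq)
  qed
  show ?thesis
    unfolding right_diff_distrib using *[of A] *[of B] assms by (simp add: Bochner_Integration.integral_diff)
qed

text \<open>
  Almost every \<open>x\<close> has finite gain and loss terms. For such \<open>x\<close>, all the iterated integrals in the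
  definition of a weak solution converge absolutely and split into gain and loss.
\<close>

lemma duhamel_lint:
  fixes qp qm :: "'a::euclidean_space \<times> real \<Rightarrow> ennreal" and R :: "'a \<times> real \<Rightarrow> real"
  assumes [measurable]: "qp \<in> borel_measurable (borel \<Otimes>\<^sub>M borel)" "qm \<in> borel_measurable (borel \<Otimes>\<^sub>M borel)"
      "R \<in> borel_measurable (borel \<Otimes>\<^sub>M borel)"
    and c: "0 < c"
    and fin: "integral_before t qp < \<infinity>"
      "integral_before t qm < \<infinity>"
    and early: "\<And>y s. s \<le> 0 \<Longrightarrow> qp (y, s) = 0" "\<And>y s. s \<le> 0 \<Longrightarrow> qm (y, s) = 0"
    and R: "\<And>y s. 0 < s \<Longrightarrow> s < t \<Longrightarrow> R (y, s) = enn2real (qp (y, s)) - enn2real (qm (y, s))"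
  shows "AE x in lborel. (LINT s:{0..t}|lborel. heat_semigroup c (t - s) (\<lambda>y. R (y, s)) x)
    = enn2real (duhamel c qp x t) - enn2real (duhamel c qm x t)"
proof -
  have slices: "AE s in lborel. s < t \<longrightarrow> (AE y in lborel. q (y, s) < \<infinity>)"
    if [measurable]: "q \<in> borel_measurable (borel \<Otimes>\<^sub>M borel)"
      and q: "integral_before t q < \<infinity>" for q :: "'a \<times> real \<Rightarrow> ennreal"
  proof -
    have "AE s in lborel. indicator {..<t} s * (\<integral>\<^sup>+y. q (y, s) \<partial>lborel) \<noteq> \<infinity>"
      using q by (intro nn_integral_PInf_AE) auto
    then show ?thesis
    proof eventually_elim
      case (elim s)
      show ?case
      proof
        assume "s < t"
        then have "(\<integral>\<^sup>+y. q (y, s) \<partial>lborel) \<noteq> \<infinity>" using elim by simp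
        then have "AE y in lborel. q (y, s) \<noteq> \<infinity>" by (intro nn_integral_PInf_AE) auto
        then show "AE y in lborel. q (y, s) < \<infinity>" by eventually_elim (simp add: less_top)
      qed
    qed
  qed
  from AE_duhamel_finite[OF _ c fin(1)] AE_duhamel_finite[OF _ c fin(2)]
  have "AE x in lborel. duhamel c qp x t < \<infinity>" "AE x in lborel. duhamel c qm x t < \<infinity>" by simp_all
  then show ?thesis
  proof eventually_elim
    case (elim x)
    define A where "A q s = heat (c * (t - s)) (\<lambda>y. q (y, s)) x" for q :: "'a \<times> real \<Rightarrow> ennreal" and s
    have [measurable]: "A q \<in> borel_measurable borel" if [measurable]: "q \<in> borel_measurable (borel \<Otimes>\<^sub>M borel)" for q
      unfolding A_def by measurable
    have dA: "duhamel c q x t = (\<integral>\<^sup>+s. A q s \<partial>lborel)" for q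
      by (simp add: duhamel_def A_def)
    have Afin: "AE s in lborel. A q s < \<infinity>" if [measurable]: "q \<in> borel_measurable (borel \<Otimes>\<^sub>M borel)"
      and "duhamel c q x t < \<infinity>" for q
    proof -
      have "AE s in lborel. A q s \<noteq> \<infinity>" using that by (intro nn_integral_PInf_AE) (auto simp: dA)
      then show ?thesis by eventually_elim (simp add: less_top)
    qed
    have kernel: "AE s in lborel. indicator {0..t} s *\<^sub>R heat_semigroup c (t - s) (\<lambda>y. R (y, s)) x
      = 1 * (enn2real (A qp s) - enn2real (A qm s))"
      using slices[OF assms(1) fin(1)] slices[OF assms(2) fin(2)] Afin[OF assms(1) elim(1)] Afin[OF assms(2) elim(2)]
        AE_lborel_singleton[of 0] AE_lborel_singleton[of t]
    proof eventually_elim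
      case (elim s)
      show ?case
      proof (cases "0 < s \<and> s < t")
        case True
        then have pos: "0 < c * (t - s)" using c by simp
        have "heat_semigroup c (t - s) (\<lambda>y. R (y, s)) x
          = (LINT y|lborel. heat_kernel (c * (t - s)) (x - y) * (enn2real (qp (y, s)) - enn2real (qm (y, s))))"
          using True pos R by (simp add: heat_semigroup_def)
        also have "\<dots> = enn2real (\<integral>\<^sup>+y. ennreal (heat_kernel (c * (t - s)) (x - y)) * qp (y, s) \<partial>lborel)
          - enn2real (\<integral>\<^sup>+y. ennreal (heat_kernel (c * (t - s)) (x - y)) * qm (y, s) \<partial>lborel)"
          by (rule lint_diff_enn2real)
            (use elim True pos in \<open>auto simp: A_def heat_def gauss_def heat_kernel_nonneg\<close>)
        also have "\<dots> = enn2real (A qp s) - enn2real (A qm s)"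
          using pos by (simp add: A_def heat_def gauss_def)
        finally show ?thesis using True by simp
      next
        case False
        then have "s < 0 \<or> t < s" using elim by auto
        then show ?thesis
          using c early by (auto simp: A_def mult_nonneg_nonpos)
      qed
    qed
    have "(LINT s:{0..t}|lborel. heat_semigroup c (t - s) (\<lambda>y. R (y, s)) x)
      = (LINT s|lborel. 1 * (enn2real (A qp s) - enn2real (A qm s)))"
      unfolding set_lebesgue_integral_def
    proof (rule integral_cong_AE)
      show "(\<lambda>s. indicator {0..t} s *\<^sub>R heat_semigroup c (t - s) (\<lambda>y. R (y, s)) x) \<in> borel_measurable lborel"
        unfolding heat_semigroup_def by measurable
    qed (use kernel in auto)
    also have "\<dots> = enn2real (\<integral>\<^sup>+s. ennreal 1 * A qp s \<partial>lborel) - enn2real (\<integral>\<^sup>+s. ennreal 1 * A qm s \<partial>lborel)"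
      by (rule lint_diff_enn2real) (use elim Afin in \<open>auto simp: dA\<close>)
    finally show ?case by (simp add: dA)
  qed
qed

lemma suminf_ennreal_shift:
  fixes f :: "nat \<Rightarrow> ennreal"
  assumes "f 0 = 0"
  shows "(\<Sum>n. f n) = (\<Sum>n. f (Suc n))"
  using suminf_offset[of f 1] assms by simp

lemma Q_plus_eq_gain:
  assumes al: "\<And>n m. 1 \<le> n \<Longrightarrow> 1 \<le> m \<Longrightarrow> 0 \<le> \<alpha> n m \<and> al n m = \<alpha> n m"
    and f: "\<And>n. 1 \<le> n \<Longrightarrow> 0 \<le> f n x t \<and> u n (x, t) = ennreal (f n x t)" and u0: "u 0 (x, t) = 0"
  shows "gain al u n (x, t) = Q_plus \<alpha> f n x t"
proof -
  have "gain al u n (x, t) = (\<Sum>m\<in>{1..<n}. ennreal (al m (n - m)) * u m (x, t) * u (n - m) (x, t))"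
    unfolding gain_def
  proof (rule sum.mono_neutral_right)
    show "\<forall>m\<in>{..n} - {1..<n}. ennreal (al m (n - m)) * u m (x, t) * u (n - m) (x, t) = 0"
    proof
      fix m assume "m \<in> {..n} - {1..<n}"
      then have "m = 0 \<or> n - m = 0" by auto
      then show "ennreal (al m (n - m)) * u m (x, t) * u (n - m) (x, t) = 0" by (auto simp: u0)
    qed
  qed auto
  also have "\<dots> = (\<Sum>m\<in>{1..<n}. ennreal (\<alpha> m (n - m) * f m x t * f (n - m) x t))"
    using al f by (intro sum.cong) (auto simp: ennreal_mult)
  also have "\<dots> = Q_plus \<alpha> f n x t"
    unfolding Q_plus_def using al f by (intro sum_ennreal) auto
  finally show ?thesis .
qed

lemma Q_minus_eq_loss:
  assumes al: "\<And>n m. 1 \<le> n \<Longrightarrow> 1 \<le> m \<Longrightarrow> 0 \<le> \<alpha> n m \<and> al n m = \<alpha> n m"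
    and f: "\<And>n. 1 \<le> n \<Longrightarrow> 0 \<le> f n x t \<and> u n (x, t) = ennreal (f n x t)" and u0: "u 0 (x, t) = 0"
    and n: "1 \<le> n"
  shows "loss al u n (x, t) = Q_minus \<alpha> f n x t"
proof -
  have "(\<Sum>k. ennreal (al n k) * u k (x, t)) = (\<Sum>k. ennreal (al n (Suc k)) * u (Suc k) (x, t))"
    by (rule suminf_ennreal_shift) (simp add: u0)
  also have "\<dots> = (\<Sum>k. ennreal (\<alpha> n (Suc k) * f (Suc k) x t))"
    using al[OF n] f by (intro suminf_cong) (simp add: ennreal_mult)
  finally show ?thesis
    unfolding loss_def Q_minus_def using f n by simp
qed

lemma powr_lower_bound:
  fixes d :: "nat \<Rightarrow> real"
  assumes r: "0 < r" and d: "\<And>n. 1 \<le> n \<Longrightarrow> r * real n powr (- b) \<le> d n"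
  shows "\<exists>C\<ge>1. \<exists>k::nat. \<forall>n. 1 \<le> d (max 1 n) * (C * real (Suc n) ^ k)"
proof (intro exI conjI allI)
  let ?C = "max 1 (1 / r)" and ?k = "nat \<lceil>b\<rceil>"
  show "1 \<le> ?C" by simp
  fix n :: nat
  let ?m = "max 1 n"
  have m: "1 \<le> real ?m" "real ?m \<le> real (Suc n)" by auto
  have "b \<le> real ?k" by linarith
  then have "real ?m powr b \<le> real ?m powr real ?k" using m(1) by (intro powr_mono) auto
  also have "\<dots> = real ?m ^ ?k" using m(1) by (subst powr_realpow) auto
  also have "\<dots> \<le> real (Suc n) ^ ?k" using m by (intro power_mono) auto
  finally have p: "real ?m powr b \<le> real (Suc n) ^ ?k" .
  have "1 = (r * real ?m powr (- b)) * (1 / r * real ?m powr b)"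
    using r m(1) by (simp add: powr_minus field_simps)
  also have "\<dots> \<le> d ?m * (?C * real (Suc n) ^ ?k)"
  proof (rule mult_mono)
    show "r * real ?m powr (- b) \<le> d ?m" by (rule d) simp
    then show "0 \<le> d ?m" using r by (auto intro: order_trans[rotated])
    show "1 / r * real ?m powr b \<le> ?C * real (Suc n) ^ ?k"
      by (rule mult_mono[OF _ p]) auto
  qed (use r in auto)
  finally show "1 \<le> d ?m * (?C * real (Suc n) ^ ?k)" .
qed

section \<open>Functions on space-time slabs\<close>

lemma nn_integral_slab:
  fixes g :: "'a::euclidean_space \<times> real \<Rightarrow> ennreal"
  assumes [measurable]: "g \<in> borel_measurable (borel \<Otimes>\<^sub>M borel)"
  shows "(\<integral>\<^sup>+p. g p \<partial>slab T) = (\<integral>\<^sup>+t. \<integral>\<^sup>+x. g (x, t) * indicator {0..T} t \<partial>lborel \<partial>lborel)"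
proof -
  have [measurable]: "g \<in> borel_measurable borel" using assms by (simp add: borel_prod)
  have "(\<integral>\<^sup>+p. g p \<partial>slab T) = (\<integral>\<^sup>+p. g p * indicator (UNIV \<times> {0..T}) p \<partial>lborel)"
    unfolding slab_def by (rule nn_integral_restrict_space) (simp add: borel_closed closed_Times)
  also have "\<dots> = (\<integral>\<^sup>+p. g p * indicator {0..T} (snd p) \<partial>(lborel \<Otimes>\<^sub>M lborel))"
    unfolding lborel_prod by (intro nn_integral_cong) (auto simp: indicator_def)
  also have "\<dots> = (\<integral>\<^sup>+t. \<integral>\<^sup>+x. g (x, t) * indicator {0..T} t \<partial>lborel \<partial>lborel)"
    by (subst lborel_pair.nn_integral_snd[symmetric]) auto
  finally show ?thesis .
qed

lemma AE_slab:
  fixes g :: "'a::euclidean_space \<times> real \<Rightarrow> ennreal"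
  assumes [measurable]: "g \<in> borel_measurable (borel \<Otimes>\<^sub>M borel)"
    and le: "\<And>t. t \<le> T \<Longrightarrow> AE x in lborel. g (x, t) \<le> C"
  shows "AE p in slab T. snd p \<noteq> 0 \<and> g p \<le> C"
proof -
  have [measurable]: "g \<in> borel_measurable borel" using assms(1) by (simp add: borel_prod)
  define b where "b p = (indicator {p. g p > C \<or> snd p = 0} p :: ennreal)" for p :: "'a \<times> real"
  have b_meas: "b \<in> borel_measurable (borel \<Otimes>\<^sub>M borel)"
    unfolding b_def[abs_def] indicator_def mem_Collect_eq by measurable
  have "(\<integral>\<^sup>+p. b p \<partial>slab T) = (\<integral>\<^sup>+t. \<integral>\<^sup>+x. b (x, t) * indicator {0..T} t \<partial>lborel \<partial>lborel)"
    by (rule nn_integral_slab[OF b_meas])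
  also have "\<dots> = (\<integral>\<^sup>+(t::real). 0 \<partial>lborel)"
  proof (rule nn_integral_cong_AE)
    show "AE t in lborel. (\<integral>\<^sup>+x. b (x, t) * indicator {0..T} t \<partial>lborel) = 0"
      using AE_lborel_singleton[of "0::real"]
    proof eventually_elim
      case (elim t)
      have "(\<integral>\<^sup>+x. b (x, t) * indicator {0..T} t \<partial>lborel) = (\<integral>\<^sup>+(x::'a). 0 \<partial>lborel)"
      proof (rule nn_integral_cong_AE)
        show "AE x in lborel. b (x, t) * indicator {0..T} t = 0"
        proof (cases "t \<le> T")
          case True
          show ?thesis using le[OF True] elim
            by (auto elim!: eventually_mono simp: b_def indicator_def not_less)
        qed simp
      qed
      then show ?case by simp
    qed
  qed
  finally have "(\<integral>\<^sup>+p. b p \<partial>slab T) = 0" by simp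
  moreover have "b \<in> borel_measurable (slab T)"
    unfolding slab_def using b_meas by (intro measurable_restrict_space1) (simp add: borel_prod)
  ultimately have "AE p in slab T. b p = 0"
    by (simp add: nn_integral_0_iff_AE)
  then show ?thesis
    by eventually_elim (auto simp: b_def indicator_def not_less split: if_splits)
qed

section \<open>Bounded and integrable moments\<close>

theorem mainTheorem5:
  fixes d :: "nat \<Rightarrow> real"
    and \<alpha> :: "nat \<Rightarrow> nat \<Rightarrow> real"
    and f0 :: "nat \<Rightarrow> 'a::euclidean_space \<Rightarrow> real"
    and f :: "nat \<Rightarrow> 'a \<Rightarrow> real \<Rightarrow> real"
    and C\<^sub>0 r\<^sub>1 r\<^sub>2 b\<^sub>1 b\<^sub>2 :: real
  assumes d_nonneg: "\<forall>n\<ge>1. 0 \<le> d n"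
    and alpha_nonneg: "\<forall>n\<ge>1. \<forall>m\<ge>1. 0 \<le> \<alpha> n m"
    and alpha_sym: "\<forall>n\<ge>1. \<forall>m\<ge>1. \<alpha> n m = \<alpha> m n"
    and hyp1_alpha: "\<forall>\<delta>>0. \<exists>k\<^sub>0::nat>0. \<forall>n\<ge>1. \<forall>m\<ge>1.
           n + m > k\<^sub>0 \<longrightarrow> \<alpha> n m \<le> \<delta> * real (n + m) * (d n + d m)"
    and hyp1_d: "\<exists>B. \<forall>n\<ge>1. d n \<le> B"
    and hyp2_mono: "\<forall>n\<ge>1. \<forall>m\<ge>n. d m \<le> d n"
    and hyp2_alpha: "\<forall>n\<ge>1. \<forall>m\<ge>1. \<alpha> n m \<le> C\<^sub>0 * real (n + m)"
    and hyp2_consts: "0 < r\<^sub>1" "0 < r\<^sub>2" "0 \<le> b\<^sub>2" "b\<^sub>2 \<le> b\<^sub>1"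
    and hyp2_d: "\<forall>n\<ge>1. r\<^sub>1 * real n powr (- b\<^sub>1) \<le> d n \<and> d n \<le> r\<^sub>2 * real n powr (- b\<^sub>2)"
    and sol: "weak_solution d \<alpha> f0 f"
    and init_L1: "\<forall>a\<ge>1. in_L1 lborel (\<lambda>x. moment a (\<lambda>n. f0 n x))"
    and init_Linf: "\<forall>a\<ge>1. (\<Sum>k. ennreal (real (Suc k) ^ a) * Linf_norm (f0 (Suc k))) < \<infinity>"
  shows "\<forall>a\<ge>1. \<forall>T>0.
           in_Linf (slab T) (\<lambda>(x, t). moment a (\<lambda>n. f n x t)) \<and>
           in_L1 (slab T) (\<lambda>(x, t). moment a (\<lambda>n. f n x t))"
proof -
  note w = sol[unfolded weak_solution_def]
  note w0 = conjunct1[OF w] and wf = conjunct1[OF conjunct2[OF w]]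
    and wQ = conjunct1[OF conjunct2[OF conjunct2[OF w]]] and wD = conjunct2[OF conjunct2[OF conjunct2[OF w]]]
  have f0: "f0 n \<in> borel_measurable borel" "0 \<le> f0 n x" if "1 \<le> n" for n x
    using w0 that by simp_all
  have f_meas: "set_borel_measurable borel (UNIV \<times> {0..}) (\<lambda>(x, t). f n x t)" if "1 \<le> n" for n
    using wf that by simp
  have f_nn: "0 \<le> f n x t" if "1 \<le> n" "0 \<le> t" for n x t
    using wf that by simp
  have Qp_L1: "in_L1 (slab T) (\<lambda>(x, t). Q_plus \<alpha> f n x t)"
    and Qm_L1: "in_L1 (slab T) (\<lambda>(x, t). Q_minus \<alpha> f n x t)" if "1 \<le> n" "0 \<le> T" for n T
    using wQ that by simp_all
  have duh: "AE x in lborel. f n x t = heat_semigroup (d n) t (f0 n) x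
      + (LINT s:{0..t}|lborel. heat_semigroup (d n) (t - s) (\<lambda>y. Q_coag \<alpha> f n y s) x)"
    if "1 \<le> n" "0 \<le> t" for n t
    using wD[rule_format, OF that] .
  \<comment> \<open>nonnegative data that vanish at index \<open>0\<close> and at nonpositive times; the rate at index \<open>0\<close> repeats \<open>d 1\<close> to remain positive and monotone\<close>
  define cu where "cu n p = (if 1 \<le> n \<and> 0 < snd p then ennreal (f n (fst p) (snd p)) else 0)" for n and p :: "'a \<times> real"
  define ch where "ch n x = (if 1 \<le> n then ennreal (f0 n x) else 0)" for n and x :: 'a
  define cd where "cd n = d (max 1 n)" for n
  define cal where "cal n m = (if 1 \<le> n \<and> 1 \<le> m then \<alpha> n m else 0)" for n m
  define cH where "cH n = (if 1 \<le> n then Linf_norm (f0 n) else 0)" for n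

  have cu_eq: "cu n (x, t) = ennreal (f n x t)" if "1 \<le> n" "0 < t" for n x t
    using that by (simp add: cu_def)
  have gain_eq: "gain cal cu n (x, t) = Q_plus \<alpha> f n x t" if "0 < t" for n x t
    by (rule Q_plus_eq_gain) (use that alpha_nonneg f_nn in \<open>auto simp: cal_def cu_def\<close>)
  have loss_eq: "loss cal cu n (x, t) = Q_minus \<alpha> f n x t" if "1 \<le> n" "0 < t" for n x t
    by (rule Q_minus_eq_loss) (use that alpha_nonneg f_nn in \<open>auto simp: cal_def cu_def\<close>)
  have d_pos: "0 < d n" if "1 \<le> n" for n
  proof -
    have "0 < r\<^sub>1 * real n powr (- b\<^sub>1)" using that hyp2_consts(1) by simp
    then show ?thesis using hyp2_d that by force
  qed

  have slab_sets: "UNIV \<times> {0..T} \<in> sets (borel :: ('a \<times> real) measure)" for T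
    by (simp add: borel_closed closed_Times)
  have fr_meas: "(\<lambda>p. indicator (UNIV \<times> {0..}) p *\<^sub>R f n (fst p) (snd p)) \<in> borel_measurable (borel :: ('a \<times> real) measure)"
    if "1 \<le> n" for n
    using f_meas[OF that] by (simp add: set_borel_measurable_def case_prod_beta)
  have cu_meas: "cu n \<in> borel_measurable (borel \<Otimes>\<^sub>M borel)" for n
  proof (cases "1 \<le> n")
    case True
    have [measurable]: "(\<lambda>p. indicator (UNIV \<times> {0..}) p *\<^sub>R f n (fst p) (snd p)) \<in> borel_measurable (borel \<Otimes>\<^sub>M borel :: ('a \<times> real) measure)"
      using fr_meas[OF True] by (simp add: borel_prod)
    have "cu n = (\<lambda>p. if 0 < snd p then ennreal (indicator (UNIV \<times> {0..}) p *\<^sub>R f n (fst p) (snd p)) else 0)"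
      using True by (auto simp: cu_def fun_eq_iff indicator_def)
    then show ?thesis by simp
  next
    case False
    then have "cu n = (\<lambda>p. 0)" by (auto simp: cu_def fun_eq_iff)
    then show ?thesis by simp
  qed
  have gm: "gain cal cu n \<in> borel_measurable (borel \<Otimes>\<^sub>M borel)" and lm: "loss cal cu n \<in> borel_measurable (borel \<Otimes>\<^sub>M borel)" for n
    using cu_meas by (auto intro: gain_measurable loss_measurable)
  have early: "gain cal cu n (y, s) = 0" "loss cal cu n (y, s) = 0" if "s \<le> 0" for n y s
    using that by (simp_all add: gain_def loss_def cu_def)

  have L1: "integral_before T q < \<infinity>"
    if [measurable]: "q \<in> borel_measurable (borel \<Otimes>\<^sub>M borel)"
      and Q: "\<And>T. 0 \<le> T \<Longrightarrow> in_L1 (slab T) (\<lambda>(x, t). Q x t)"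
      and eq: "\<And>x t. 0 < t \<Longrightarrow> q (x, t) = Q x t" and q0: "\<And>x t. t \<le> 0 \<Longrightarrow> q (x, t) = 0"
    for q :: "'a \<times> real \<Rightarrow> ennreal" and Q T
  proof (cases "0 \<le> T")
    case True
    have "integral_before T q
      \<le> (\<integral>\<^sup>+s. (\<integral>\<^sup>+y. q (y, s) * indicator {0..T} s \<partial>lborel) \<partial>lborel)"
    proof (rule nn_integral_mono)
      fix s
      show "indicator {..<T} s * (\<integral>\<^sup>+y. q (y, s) \<partial>lborel) \<le> (\<integral>\<^sup>+y. q (y, s) * indicator {0..T} s \<partial>lborel)"
        by (cases "s \<le> 0") (auto simp: q0 indicator_def)
    qed
    also have "\<dots> = (\<integral>\<^sup>+p. q p \<partial>slab T)" by (rule nn_integral_slab[symmetric]) measurable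
    also have "\<dots> \<le> (\<integral>\<^sup>+p. (case p of (x, t) \<Rightarrow> Q x t) \<partial>slab T)"
    proof (rule nn_integral_mono)
      fix p :: "'a \<times> real"
      show "q p \<le> (case p of (x, t) \<Rightarrow> Q x t)"
        by (cases p, cases "0 < snd p") (auto simp: eq q0)
    qed
    also have "\<dots> < \<infinity>" using Q[OF True] by (simp add: in_L1_def)
    finally show ?thesis .
  next
    case False
    then have "indicator {..<T} s * (\<integral>\<^sup>+y. q (y, s) \<partial>lborel) = 0" for s
      by (cases "s \<le> 0") (auto simp: q0)
    then have "integral_before T q = (\<integral>\<^sup>+(s::real). 0 \<partial>lborel)"
      by (intro nn_integral_cong)
    then show ?thesis by simp
  qed
  have gL1: "integral_before T (gain cal cu n) < \<infinity>" for T n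
  proof (cases "1 \<le> n")
    case True
    show ?thesis by (rule L1[OF gm Qp_L1[OF True] gain_eq early(1)])
  next
    case False
    then have "gain cal cu n p = 0" for p by (simp add: gain_def cu_def)
    then show ?thesis by simp
  qed
  have lL1: "integral_before T (loss cal cu n) < \<infinity>" for T n
  proof (cases "1 \<le> n")
    case True
    show ?thesis by (rule L1[OF lm Qm_L1[OF True] loss_eq[OF True] early(2)])
  next
    case False
    then have "loss cal cu n p = 0" for p by (simp add: loss_def cu_def)
    then show ?thesis by simp
  qed

  have ch_meas: "ch n \<in> borel_measurable borel" for n
    using f0(1)[of n] by (cases "1 \<le> n") (auto simp: ch_def[abs_def])
  have ch_L1: "(\<Sum>n. ennreal (real n ^ a) * (\<integral>\<^sup>+x. ch n x \<partial>lborel)) < \<infinity>" for a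
  proof -
    have "(\<Sum>n. ennreal (real n ^ a) * (\<integral>\<^sup>+x. ch n x \<partial>lborel)) \<le> (\<Sum>n. ennreal (real n ^ Suc a) * (\<integral>\<^sup>+x. ch n x \<partial>lborel))"
    proof (rule suminf_le)
      fix n
      show "ennreal (real n ^ a) * (\<integral>\<^sup>+x. ch n x \<partial>lborel) \<le> ennreal (real n ^ Suc a) * (\<integral>\<^sup>+x. ch n x \<partial>lborel)"
        by (cases "1 \<le> n") (auto simp: ch_def intro!: mult_right_mono ennreal_leI power_increasing simp del: power_Suc)
    qed auto
    also have "\<dots> = (\<Sum>k. ennreal (real (Suc k) ^ Suc a) * (\<integral>\<^sup>+x. ch (Suc k) x \<partial>lborel))"
      by (rule suminf_ennreal_shift) simp
    also have "\<dots> = (\<Sum>k. (\<integral>\<^sup>+x. ennreal (real (Suc k) ^ Suc a * f0 (Suc k) x) \<partial>lborel))"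
      using f0 ch_meas by (intro suminf_cong)
        (simp add: nn_integral_cmult[symmetric] ch_def ennreal_mult' del: power_Suc of_nat_Suc)
    also have "\<dots> = (\<integral>\<^sup>+x. moment (Suc a) (\<lambda>n. f0 n x) \<partial>lborel)"
      unfolding moment_def using f0(1) by (intro nn_integral_suminf[symmetric]) simp
    also have "\<dots> < \<infinity>" using init_L1 by (auto simp: in_L1_def)
    finally show ?thesis .
  qed
  have cH_sum: "(\<Sum>n. ennreal (real n ^ a) * cH n) < \<infinity>" for a
  proof -
    have "(\<Sum>n. ennreal (real n ^ a) * cH n) \<le> (\<Sum>n. ennreal (real n ^ Suc a) * cH n)"
    proof (rule suminf_le)
      fix n
      show "ennreal (real n ^ a) * cH n \<le> ennreal (real n ^ Suc a) * cH n"
        by (cases "1 \<le> n") (auto simp: cH_def intro!: mult_right_mono ennreal_leI power_increasing simp del: power_Suc)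
    qed auto
    also have "\<dots> = (\<Sum>k. ennreal (real (Suc k) ^ Suc a) * cH (Suc k))"
      by (rule suminf_ennreal_shift) simp
    also have "\<dots> = (\<Sum>k. ennreal (real (Suc k) ^ Suc a) * Linf_norm (f0 (Suc k)))"
      by (simp add: cH_def)
    also have "\<dots> < \<infinity>" using init_Linf[rule_format, of "Suc a"] by simp
    finally show ?thesis .
  qed
  have ch_le: "AE x in lborel. ch n x \<le> cH n" for n
  proof (cases "1 \<le> n")
    case True
    have "AE x in lborel. ennreal \<bar>f0 n x\<bar> \<le> Linf_norm (f0 n)"
      unfolding Linf_norm_def by (rule esssup_AE)
    then show ?thesis using True f0(2) by (simp add: ch_def cH_def)
  qed (simp add: ch_def)

  have mild: "AE x in lborel. cu n (x, t) + duhamel (cd n) (loss cal cu n) x t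
      = heat (cd n * t) (ch n) x + duhamel (cd n) (gain cal cu n) x t" if t: "0 < t" for n t
  proof (cases "1 \<le> n")
    case False
    then have "gain cal cu n p = 0" "loss cal cu n p = 0" for p by (simp_all add: gain_def loss_def cu_def)
    then show ?thesis using False by (simp add: duhamel_def cu_def ch_def[abs_def])
  next
    case n: True
    have cdn: "cd n = d n" using n by (simp add: cd_def max_def)
    define R where "R p = indicator (UNIV \<times> {0..t}) p *\<^sub>R Q_coag \<alpha> f n (fst p) (snd p)" for p :: "'a \<times> real"
    have "(\<lambda>(x, t). Q_plus \<alpha> f n x t) \<in> borel_measurable (slab t)"
      "(\<lambda>(x, t). Q_minus \<alpha> f n x t) \<in> borel_measurable (slab t)"
      using Qp_L1[OF n, of t] Qm_L1[OF n, of t] t by (simp_all add: in_L1_def)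
    then have [measurable]: "(\<lambda>p. Q_plus \<alpha> f n (fst p) (snd p)) \<in> borel_measurable (slab t)"
      "(\<lambda>p. Q_minus \<alpha> f n (fst p) (snd p)) \<in> borel_measurable (slab t)"
      unfolding case_prod_beta .
    have "(\<lambda>p. Q_coag \<alpha> f n (fst p) (snd p)) \<in> borel_measurable (slab t)"
      unfolding Q_coag_def by measurable
    then have "R \<in> borel_measurable borel"
      unfolding slab_def R_def[abs_def] using slab_sets by (subst (asm) borel_measurable_restrict_space_iff) auto
    then have R_meas: "R \<in> borel_measurable (borel \<Otimes>\<^sub>M borel)" by (simp add: borel_prod)
    have set_eq: "(LINT s:{0..t}|lborel. heat_semigroup (d n) (t - s) (\<lambda>y. Q_coag \<alpha> f n y s) x)
      = (LINT s:{0..t}|lborel. heat_semigroup (d n) (t - s) (\<lambda>y. R (y, s)) x)" for x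
      by (rule set_lebesgue_integral_cong) (auto simp: R_def indicator_def)
    have lint: "AE x in lborel. (LINT s:{0..t}|lborel. heat_semigroup (d n) (t - s) (\<lambda>y. R (y, s)) x)
      = enn2real (duhamel (d n) (gain cal cu n) x t) - enn2real (duhamel (d n) (loss cal cu n) x t)"
      by (rule duhamel_lint[OF gm lm R_meas d_pos[OF n] gL1 lL1 early])
        (use n in \<open>auto simp: R_def Q_coag_def gain_eq loss_eq\<close>)
    have init: "heat_semigroup (d n) t (f0 n) x = enn2real (heat (d n * t) (ch n) x)" for x
      using heat_semigroup_eq_heat[of "f0 n" "d n" t x] f0 n t d_pos[OF n] by (simp add: ch_def[abs_def])
    have init_fin: "heat (d n * t) (ch n) x < \<infinity>" for x
    proof -
      have "ennreal (real n ^ 0) * (\<integral>\<^sup>+x. ch n x \<partial>lborel) \<le> (\<Sum>n. ennreal (real n ^ 0) * (\<integral>\<^sup>+x. ch n x \<partial>lborel))"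
        using sum_le_suminf[of "\<lambda>n. ennreal (real n ^ 0) * (\<integral>\<^sup>+x. ch n x \<partial>lborel)" "{n}"] by simp
      then have "(\<integral>\<^sup>+x. ch n x \<partial>lborel) < \<infinity>" using ch_L1[of 0] by simp
      then show ?thesis using heat_le_L1[OF ch_meas, of "d n * t" n x]
        by (auto simp: ennreal_mult_less_top intro: le_less_trans)
    qed
    have "AE x in lborel. duhamel (d n) (gain cal cu n) x t < \<infinity>"
      "AE x in lborel. duhamel (d n) (loss cal cu n) x t < \<infinity>"
      by (rule AE_duhamel_finite[OF gm d_pos[OF n] gL1], rule AE_duhamel_finite[OF lm d_pos[OF n] lL1])
    with duh[OF n less_imp_le[OF t]] lint
    show ?thesis
    proof eventually_elim
      case (elim x)
      obtain a where a: "0 \<le> a" "heat (d n * t) (ch n) x = ennreal a"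
        using init_fin[of x] by (cases "heat (d n * t) (ch n) x") auto
      obtain g where g: "0 \<le> g" "duhamel (d n) (gain cal cu n) x t = ennreal g"
        using elim(3) by (cases "duhamel (d n) (gain cal cu n) x t") auto
      obtain l where l: "0 \<le> l" "duhamel (d n) (loss cal cu n) x t = ennreal l"
        using elim(4) by (cases "duhamel (d n) (loss cal cu n) x t") auto
      have "f n x t = a + (g - l)"
        using elim(1,2) a g l by (simp add: set_eq init)
      then have "f n x t + l = a + g" by simp
      then have "ennreal (f n x t) + ennreal l = ennreal a + ennreal g"
        using f_nn[OF n, of t x] t a g l by (simp flip: ennreal_plus)
      then show ?case using n t a g l by (simp add: cu_eq cdn)
    qed
  qed

  interpret coagulation cd cal cu ch cH
  proof
    show "0 < cd n" for n by (simp add: cd_def d_pos)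
    show "cd m \<le> cd n" if "n \<le> m" for n m
      using hyp2_mono[rule_format, of "max 1 n" "max 1 m"] that by (simp add: cd_def)
    show "\<exists>C\<ge>1. \<exists>b::nat. \<forall>n. 1 \<le> cd n * (C * real (Suc n) ^ b)"
      unfolding cd_def using hyp2_consts(1) hyp2_d by (intro powr_lower_bound) auto
    show "0 \<le> cal n m" "cal n m = cal m n" for n m
      using alpha_nonneg alpha_sym by (auto simp: cal_def)
    show "\<exists>C\<ge>0. \<forall>n m. cal n m \<le> C * real (n + m)"
    proof (intro exI[of _ "max 0 C\<^sub>0"] conjI allI)
      fix n m
      have "C\<^sub>0 * real (n + m) \<le> max 0 C\<^sub>0 * real (n + m)" by (intro mult_right_mono) auto
      then show "cal n m \<le> max 0 C\<^sub>0 * real (n + m)"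
        using hyp2_alpha by (auto simp: cal_def intro: order_trans)
    qed simp
    show "\<exists>k::nat. \<forall>n m. n + m > k \<longrightarrow> cal n m \<le> \<delta> * real (n + m) * (cd n + cd m)" if \<delta>: "0 < \<delta>" for \<delta>
    proof -
      obtain k :: nat where k: "\<forall>n\<ge>1. \<forall>m\<ge>1. n + m > k \<longrightarrow> \<alpha> n m \<le> \<delta> * real (n + m) * (d n + d m)"
        using hyp1_alpha \<delta> by blast
      have "cal n m \<le> \<delta> * real (n + m) * (cd n + cd m)" if "n + m > k" for n m
      proof (cases "1 \<le> n \<and> 1 \<le> m")
        case True
        then show ?thesis using k that by (simp add: cal_def cd_def max_def)
      next
        case False
        have "0 \<le> cd n" "0 \<le> cd m" using d_nonneg by (simp_all add: cd_def)
        then have "0 \<le> \<delta> * real (n + m) * (cd n + cd m)" using \<delta> by simp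
        then show ?thesis using False by (auto simp: cal_def)
      qed
      then show ?thesis by blast
    qed
  qed (use cu_meas ch_meas ch_L1 ch_le cH_sum gL1 lL1 mild in \<open>auto simp: cu_def\<close>)

  show ?thesis
  proof (intro allI impI)
    fix a :: nat and T :: real assume a: "1 \<le> a" and T: "0 < T"
    define X where "X p = (\<Sum>n. ennreal (real n ^ a) * cu n p)" for p :: "'a \<times> real"
    have X_meas: "X \<in> borel_measurable (borel \<Otimes>\<^sub>M borel)"
      unfolding X_def[abs_def] by measurable
    have X_eq: "moment a (\<lambda>n. f n x t) = X (x, t)" if "0 < t" for x t
    proof -
      have "X (x, t) = (\<Sum>k. ennreal (real (Suc k) ^ a) * cu (Suc k) (x, t))"
        unfolding X_def using a by (intro suminf_ennreal_shift) (simp add: u_0)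
      then show ?thesis
        unfolding moment_def using that f_nn by (simp add: cu_eq ennreal_mult' del: of_nat_Suc)
    qed
    \<comment> \<open>the bounds hold for \<open>t < T + 1\<close>, which covers the endpoint of the closed slab\<close>
    obtain C where C: "C < \<infinity>" "\<And>t. t < T + 1 \<Longrightarrow> AE x in lborel. X (x, t) \<le> C"
      using moment_sup_bound[of "T + 1" a] T unfolding X_def by (auto simp: less_top)
    have bad: "AE p in slab T. snd p \<noteq> 0 \<and> X p \<le> C"
      using C(2) by (intro AE_slab X_meas) auto
    have sp: "p \<in> space (slab T) \<Longrightarrow> 0 \<le> snd p" for p :: "'a \<times> real"
      by (auto simp: slab_def space_restrict_space)
    let ?m = "\<lambda>(x, t). moment a (\<lambda>n. f n x t)"
    have m_eq: "AE p in slab T. ?m p = X p"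
      using bad AE_space by eventually_elim (use sp X_eq in \<open>force simp: less_le\<close>)
    have m_meas: "?m \<in> borel_measurable (slab T)"
    proof -
      have [measurable]: "(\<lambda>p. indicator (UNIV \<times> {0..}) p *\<^sub>R f (Suc k) (fst p) (snd p)) \<in> borel_measurable (slab T)" for k
        unfolding slab_def using fr_meas[of "Suc k"] by (intro measurable_restrict_space1) simp
      have "(\<lambda>p. \<Sum>k. ennreal (real (Suc k) ^ a * (indicator (UNIV \<times> {0..}) p *\<^sub>R f (Suc k) (fst p) (snd p))))
          \<in> borel_measurable (slab T)"
        by measurable
      also have "?this \<longleftrightarrow> ?thesis"
        by (intro measurable_cong) (auto simp: moment_def slab_def space_restrict_space)
      finally show ?thesis .
    qed
    have "esssup (slab T) ?m \<le> C"
      using m_meas by (rule esssup_I) (use bad m_eq in eventually_elim, auto)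
    then have 1: "in_Linf (slab T) ?m"
      using m_meas C(1) by (auto simp: in_Linf_def)
    obtain b where b: "a = Suc b" using a by (cases a) auto
    have "(\<integral>\<^sup>+p. ?m p \<partial>slab T) = (\<integral>\<^sup>+p. X p \<partial>slab T)"
      by (rule nn_integral_cong_AE) (rule m_eq)
    also have "\<dots> = (\<integral>\<^sup>+t. \<integral>\<^sup>+x. X (x, t) * indicator {0..T} t \<partial>lborel \<partial>lborel)"
      by (rule nn_integral_slab[OF X_meas])
    also have "\<dots> \<le> (\<integral>\<^sup>+t. indicator {..<T + 1} t * (\<integral>\<^sup>+x. X (x, t) \<partial>lborel) \<partial>lborel)"
      by (intro nn_integral_mono) (auto simp: indicator_def)
    also have "\<dots> < \<infinity>"
      using moment_integral_finite[of "T + 1" b] T unfolding X_def b by simp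
    finally have 2: "in_L1 (slab T) ?m" using m_meas by (simp add: in_L1_def)
    show "in_Linf (slab T) ?m \<and> in_L1 (slab T) ?m" using 1 2 ..
  qed
qed

end
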